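(* Let $L>0$ and let $b_j^{(n)},m_j^{(n)},T_j^{(n)}$ ($n\ge1$, $j=1,2$) be the coefficients and profiles constructed recursively in the context. Then, for $j=1,2$, $T_j^{(1)}=T_j^{(2)}=0$, $$b_j^{(2)}=\frac{(-1)^{j-1}\|Q\|_{L^2}^2}{4\pi\lambda_{j+1}}\frac{\alpha}{|\alpha|^3},$$ and $$b_j^{(n)}=0\ \text{ for } 1\le n\le 6,\ n\ne 2;\qquad m_j^{(n)}=0\ \text{ for } 1\le n\le 6.$$
   Context: For a function $f$ on $\mathbb R^3$, $\phi_f=\Delta^{-1}f=-\frac{1}{4\pi|x|}*f$. $Q$ is the unique positive radial solution of $\Delta Q-\phi_{Q^2}Q=Q$ on $\mathbb R^3$. $\Lambda=2+x\cdot\nabla$; $(\cdot,\cdot)$ is the $L^2(\mathbb R^3)$ inner product. The linearized operators are $L_+f=-\Delta f+f+\phi_{Q^2}f+2\phi_{Qf}Q$ and $L_-f=-\Delta f+f+\phi_{Q^2}f$; $\ker L_+=\mathrm{span}\{\partial_1Q,\partial_2Q,\partial_3Q\}$, $\ker L_-=\mathrm{span}\{Q\}$. Indices $j\in\{1,2\}$ are taken modulo $2$. Parameters: $\alpha\in\mathbb R^3\setminus\{0\}$, $\beta\in\mathbb R^3$, $\lambda_1,\lambda_2>0$. Expansion. $F_n(\alpha,\zeta)$ are the terms of the Taylor expansion $\frac1{|\alpha-\zeta|}=\sum_{n\ge1}F_n(\alpha,\zeta)$ near $\zeta=0$, with $F_n$ homogeneous of degree $-n$ in $\alpha$ and $n-1$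 in $\zeta$. For a function $f$ attached to index $j+1$, $$\psi^{(n)}_{f,j+1}(y_j)=-\frac{1}{4\pi\lambda_{j+1}}\int_{\mathbb R^3}f(\xi)F_n\big(\alpha,(-1)^j(\lambda_{j+1}\xi-\lambda_jy_j)\big)\,d\xi .$$ Fix a smooth $\chi:\mathbb R^3\to\mathbb R_{\ge0}$ with $\chi=1$ on $|x|\le1$ and $\chi=0$ on $|x|\ge2$. For $L>0$ put $\psi^{(n),L}_{f,j+1}=\psi^{(n)}_{f,j+1}$ if $n\le10$ and $\psi^{(n),L}_{f,j+1}(y_j)=\psi^{(n)}_{f,j+1}(y_j)\chi(y_j/L)$ if $n>10$. Recursive construction. Put $T_j^{(0)}=Q$. For $N\ge0$, given all quantities of order $\le N$, let $$\begin{aligned}\hat E_j^{(N)}=&-\lambda_j^{-2}\sum_{k+l+m=N+1}\phi_{\mathrm{Re}(T_j^{(k)}\overline{T_j^{(l)}})}T_j^{(m)}-\sum_{k+l+m+n=N+1}\psi^{(n),L}_{\mathrm{Re}(T_{j+1}^{(k)}\overline{T_{j+1}^{(l)}}),\,j+1}T_j^{(m)}\\&-\frac{i}{\lambda_j}\sum_{m+n=N+1}m_j^{(n)}\Lambda T_j^{(m)}-\lambda_j\sum_{m+n=N+1}b_j^{(n)}\cdot y_jT_j^{(m)}-\frac{\|Q\|_{L^2}^2}{4\pi\lambda_{j+1}}\frac1{|\alpha|}T_j^{(N)}\\&+i\frac{\partial T_j^{(N)}}{\partial\alpha}\cdot2\beta+i\sum_{m+n=N+1}\Big[\frac{\partial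 T_j^{(m)}}{\partial\beta}\cdot(b_2^{(n)}-b_1^{(n)})+\frac{\partial T_j^{(m)}}{\partial\lambda_1}m_1^{(n)}+\frac{\partial T_j^{(m)}}{\partial\lambda_2}m_2^{(n)}\Big],\end{aligned}$$ with $k,l,m$ ranging over $0,\dots,N$ and $n$ over $1,\dots,N$. Then $b_j^{(N+1)}\in\mathbb R^3$, $m_j^{(N+1)}\in\mathbb R$ (functions of $\alpha,\beta,\lambda_1,\lambda_2$) are determined by $$\big(\lambda_jb_j^{(N+1)}\cdot y_jQ+\psi^{(N+1),L}_{Q^2,j+1}Q-\mathrm{Re}\,\hat E_j^{(N)},\nabla Q\big)=0,\qquad \big(m_j^{(N+1)}\Lambda Q-\lambda_j\mathrm{Im}\,\hat E_j^{(N)},Q\big)=0,$$ and $T_j^{(N+1)}(\alpha,\beta,\lambda_1,\lambda_2,y_j)$ is the exponentially decaying solution of $$L_+\mathrm{Re}\,T_j^{(N+1)}=-\lambda_j^3b_j^{(N+1)}\cdot y_jQ-\lambda_j^2\psi^{(N+1),L}_{Q^2,j+1}Q+\lambda_j^2\mathrm{Re}\,\hat E_j^{(N)},\qquad L_-\mathrm{Im}\,T_j^{(N+1)}=-\lambda_jm_j^{(N+1)}\Lambda Q+\lambda_j^2\mathrm{Im}\,\hat E_j^{(N)},$$ normalized by $(\mathrm{Re}\,T_j^{(N+1)},xQ)=0$ and $(\mathrm{Im}\,T_j^{(N+1)},\Lambda Q)=0$. *)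

theory Defs
  imports "HOL-Analysis.Analysis"
begin

text \<open>
  Conventions. Points of space are of type \<^typ>\<open>real ^ 3\<close>. The indices \<open>j \<in> {1, 2}\<close>, which
  are taken modulo 2, are elements of the numeral type \<^typ>\<open>2\<close>, i.e. of the integers modulo 2
  (where the literal \<open>2\<close> denotes \<open>0\<close>), so \<open>j + 1\<close> is the other index. The pair of scaling
  parameters is \<open>lam :: real ^ 2\<close> with components \<open>lam $ 1\<close> and \<open>lam $ 2\<close>.
\<close>

subsection \<open>Differentiation and function classes\<close>

definition dird ::
  "'a::real_normed_vector \<Rightarrow> ('a \<Rightarrow> 'b::real_normed_vector) \<Rightarrow> 'a \<Rightarrow> 'b" where
  "dird v f x = frechet_derivative f (at x) v"

definition laplacian :: "(real ^ 3 \<Rightarrow> real) \<Rightarrow> real ^ 3 \<Rightarrow> real" where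
  "laplacian f x = (\<Sum>e\<in>Basis. dird e (dird e f) x)"

fun Ck :: "nat \<Rightarrow> (real ^ 3 \<Rightarrow> 'b::real_normed_vector) \<Rightarrow> bool" where
  "Ck 0 f \<longleftrightarrow> continuous_on UNIV f"
| "Ck (Suc k) f \<longleftrightarrow> (\<forall>x. f differentiable (at x)) \<and> (\<forall>e\<in>Basis. Ck k (dird e f))"

definition exp_decaying :: "(real ^ 3 \<Rightarrow> 'b::real_normed_vector) \<Rightarrow> bool" where
  "exp_decaying f \<longleftrightarrow> (\<exists>C. \<exists>c>0. \<forall>x. norm (f x) \<le> C * exp (- c * norm x))"

definition ip :: "(real ^ 3 \<Rightarrow> real) \<Rightarrow> (real ^ 3 \<Rightarrow> real) \<Rightarrow> real" where
  "ip f g = (LINT x|lborel. f x * g x)"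

text \<open>The Bochner integral of a non-integrable function is 0 by convention, so the equation
  \<open>(f, g) = 0\<close> has to be accompanied by the convergence of the integral.\<close>

definition orth :: "(real ^ 3 \<Rightarrow> real) \<Rightarrow> (real ^ 3 \<Rightarrow> real) \<Rightarrow> bool" where
  "orth f g \<longleftrightarrow> integrable lborel (\<lambda>x. f x * g x) \<and> ip f g = 0"

definition L2norm :: "(real ^ 3 \<Rightarrow> real) \<Rightarrow> real" where
  "L2norm f = sqrt (LINT x|lborel. (f x)\<^sup>2)"

subsection \<open>The ground state and the linearized operators\<close>

definition phi :: "(real ^ 3 \<Rightarrow> real) \<Rightarrow> real ^ 3 \<Rightarrow> real" where
  "phi f x = - (1 / (4 * pi)) * (LINT y|lborel. f y / norm (x - y))"

definition Lam :: "(real ^ 3 \<Rightarrow> 'b::real_normed_vector) \<Rightarrow> real ^ 3 \<Rightarrow> 'b" where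
  "Lam f x = 2 *\<^sub>R f x + dird x f x"

text \<open>The positive radial solution is taken in the class of classical, exponentially decaying
  functions, the class in which all the profiles are constructed.\<close>

definition ground_state :: "(real ^ 3 \<Rightarrow> real) \<Rightarrow> bool" where
  "ground_state Q \<longleftrightarrow>
     Ck 2 Q \<and> exp_decaying Q \<and> (\<forall>x. Q x > 0) \<and> (\<forall>x y. norm x = norm y \<longrightarrow> Q x = Q y) \<and>
     (\<forall>x. laplacian Q x - phi (\<lambda>y. (Q y)\<^sup>2) x * Q x = Q x)"

definition Lplus :: "(real ^ 3 \<Rightarrow> real) \<Rightarrow> (real ^ 3 \<Rightarrow> real) \<Rightarrow> real ^ 3 \<Rightarrow> real" where
  "Lplus Q f x = - laplacian f x + f x + phi (\<lambda>y. (Q y)\<^sup>2) x * f x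
                 + 2 * phi (\<lambda>y. Q y * f y) x * Q x"

definition Lminus :: "(real ^ 3 \<Rightarrow> real) \<Rightarrow> (real ^ 3 \<Rightarrow> real) \<Rightarrow> real ^ 3 \<Rightarrow> real" where
  "Lminus Q f x = - laplacian f x + f x + phi (\<lambda>y. (Q y)\<^sup>2) x * f x"

text \<open>The kernel in \<open>L\<^sup>2\<close>; by elliptic regularity its elements are classical solutions.\<close>

definition kernel_L2 ::
  "((real ^ 3 \<Rightarrow> real) \<Rightarrow> real ^ 3 \<Rightarrow> real) \<Rightarrow> (real ^ 3 \<Rightarrow> real) set" where
  "kernel_L2 A = {f. Ck 2 f \<and> integrable lborel (\<lambda>x. (f x)\<^sup>2) \<and> (\<forall>x. A f x = 0)}"

definition cutoff :: "(real ^ 3 \<Rightarrow> real) \<Rightarrow> bool" where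
  "cutoff chi \<longleftrightarrow> (\<forall>k. Ck k chi) \<and> (\<forall>x. chi x \<ge> 0) \<and>
     (\<forall>x. norm x \<le> 1 \<longrightarrow> chi x = 1) \<and> (\<forall>x. norm x \<ge> 2 \<longrightarrow> chi x = 0)"

subsection \<open>Expansion of the interaction\<close>

text \<open>The term of degree \<open>n - 1\<close> in \<open>\<zeta>\<close> of the Taylor expansion of \<open>1 / |\<alpha> - \<zeta>|\<close> at \<open>\<zeta> = 0\<close>
  (for \<open>n \<ge> 1\<close>, \<open>\<alpha> \<noteq> 0\<close>), obtained from the one-variable expansion along \<open>t \<mapsto> t \<zeta>\<close>.\<close>

definition F :: "nat \<Rightarrow> real ^ 3 \<Rightarrow> real ^ 3 \<Rightarrow> real" where
  "F n \<alpha> \<zeta> = (deriv ^^ (n - 1)) (\<lambda>t. 1 / norm (\<alpha> - t *\<^sub>R \<zeta>)) 0 / fact (n - 1)"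

text \<open>\<open>sg j\<close> is \<open>(-1)^j\<close>.\<close>

definition sg :: "2 \<Rightarrow> real" where
  "sg j = (if j = 1 then -1 else 1)"

text \<open>\<open>psi n f j \<alpha> lam\<close> and \<open>psiL chi L n f j \<alpha> lam\<close> are \<open>\<psi>\<close> with subscript \<open>f, j + 1\<close>, as
  functions of \<open>y\<^sub>j\<close>.\<close>

definition psi ::
  "nat \<Rightarrow> (real ^ 3 \<Rightarrow> real) \<Rightarrow> 2 \<Rightarrow> real ^ 3 \<Rightarrow> real ^ 2 \<Rightarrow> real ^ 3 \<Rightarrow> real" where
  "psi n f j \<alpha> lam y =
     - (1 / (4 * pi * lam $ (j + 1))) *
       (LINT \<xi>|lborel. f \<xi> * F n \<alpha> (sg j *\<^sub>R ((lam $ (j + 1)) *\<^sub>R \<xi> - (lam $ j) *\<^sub>R y)))"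

definition psiL ::
  "(real ^ 3 \<Rightarrow> real) \<Rightarrow> real \<Rightarrow> nat \<Rightarrow> (real ^ 3 \<Rightarrow> real) \<Rightarrow> 2 \<Rightarrow> real ^ 3 \<Rightarrow> real ^ 2 \<Rightarrow>
   real ^ 3 \<Rightarrow> real" where
  "psiL chi L n f j \<alpha> lam y =
     (if n \<le> 10 then psi n f j \<alpha> lam y else psi n f j \<alpha> lam y * chi ((1 / L) *\<^sub>R y))"

subsection \<open>The recursive construction\<close>

text \<open>Arguments: order, index \<open>j\<close>, then \<open>\<alpha>\<close>, \<open>\<beta>\<close>, \<open>lam\<close> (and \<open>y\<^sub>j\<close> for the profiles).\<close>

type_synonym 'a family = "nat \<Rightarrow> 2 \<Rightarrow> real ^ 3 \<Rightarrow> real ^ 3 \<Rightarrow> real ^ 2 \<Rightarrow> 'a"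

definition Ehat ::
  "(real ^ 3 \<Rightarrow> real) \<Rightarrow> real \<Rightarrow> (real ^ 3 \<Rightarrow> real) \<Rightarrow>
   (real ^ 3) family \<Rightarrow> real family \<Rightarrow> (real ^ 3 \<Rightarrow> complex) family \<Rightarrow>
   (real ^ 3 \<Rightarrow> complex) family" where
  "Ehat chi L Q b \<mu> T N j \<alpha> \<beta> lam y =
     - (1 / (lam $ j)\<^sup>2) *\<^sub>R
         (\<Sum>(k, l, m) \<in> {(k, l, m) \<in> {0..N} \<times> {0..N} \<times> {0..N}. k + l + m = N + 1}.
            phi (\<lambda>x. Re (T k j \<alpha> \<beta> lam x * cnj (T l j \<alpha> \<beta> lam x))) y *\<^sub>R T m j \<alpha> \<beta> lam y)
     - (\<Sum>(k, l, m, n) \<in> {(k, l, m, n) \<in> {0..N} \<times> {0..N} \<times> {0..N} \<times> {1..N}.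
                            k + l + m + n = N + 1}.
            psiL chi L n (\<lambda>x. Re (T k (j + 1) \<alpha> \<beta> lam x * cnj (T l (j + 1) \<alpha> \<beta> lam x)))
              j \<alpha> lam y *\<^sub>R T m j \<alpha> \<beta> lam y)
     - (\<i> / of_real (lam $ j)) *
         (\<Sum>(m, n) \<in> {(m, n) \<in> {0..N} \<times> {1..N}. m + n = N + 1}.
            \<mu> n j \<alpha> \<beta> lam *\<^sub>R Lam (T m j \<alpha> \<beta> lam) y)
     - (lam $ j) *\<^sub>R
         (\<Sum>(m, n) \<in> {(m, n) \<in> {0..N} \<times> {1..N}. m + n = N + 1}.
            (b n j \<alpha> \<beta> lam \<bullet> y) *\<^sub>R T m j \<alpha> \<beta> lam y)
     - ((L2norm Q)\<^sup>2 / (4 * pi * lam $ (j + 1)) * (1 / norm \<alpha>)) *\<^sub>R T N j \<alpha> \<beta> lam y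
     + \<i> * dird (2 *\<^sub>R \<beta>) (\<lambda>a. T N j a \<beta> lam y) \<alpha>
     + \<i> * (\<Sum>(m, n) \<in> {(m, n) \<in> {0..N} \<times> {1..N}. m + n = N + 1}.
            dird (b n 2 \<alpha> \<beta> lam - b n 1 \<alpha> \<beta> lam) (\<lambda>v. T m j \<alpha> v lam y) \<beta>
            + \<mu> n 1 \<alpha> \<beta> lam *\<^sub>R dird (axis 1 1) (\<lambda>l. T m j \<alpha> \<beta> l y) lam
            + \<mu> n 2 \<alpha> \<beta> lam *\<^sub>R dird (axis 2 1) (\<lambda>l. T m j \<alpha> \<beta> l y) lam)"

definition admissible :: "real ^ 3 \<Rightarrow> real ^ 2 \<Rightarrow> bool" where
  "admissible \<alpha> lam \<longleftrightarrow> \<alpha> \<noteq> 0 \<and> lam $ 1 > 0 \<and> lam $ 2 > 0"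

definition coefficient_eqs ::
  "(real ^ 3 \<Rightarrow> real) \<Rightarrow> real \<Rightarrow> (real ^ 3 \<Rightarrow> real) \<Rightarrow>
   (real ^ 3) family \<Rightarrow> real family \<Rightarrow> (real ^ 3 \<Rightarrow> complex) family \<Rightarrow>
   nat \<Rightarrow> 2 \<Rightarrow> real ^ 3 \<Rightarrow> real ^ 3 \<Rightarrow> real ^ 2 \<Rightarrow> bool" where
  "coefficient_eqs chi L Q b \<mu> T N j \<alpha> \<beta> lam \<longleftrightarrow>
     (\<forall>e\<in>Basis.
        orth (\<lambda>y. lam $ j * (b (N + 1) j \<alpha> \<beta> lam \<bullet> y) * Q y
                  + psiL chi L (N + 1) (\<lambda>x. (Q x)\<^sup>2) j \<alpha> lam y * Q y
                  - Re (Ehat chi L Q b \<mu> T N j \<alpha> \<beta> lam y))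
             (dird e Q)) \<and>
     orth (\<lambda>y. \<mu> (N + 1) j \<alpha> \<beta> lam * Lam Q y
               - lam $ j * Im (Ehat chi L Q b \<mu> T N j \<alpha> \<beta> lam y))
          Q"

definition profile_eqs ::
  "(real ^ 3 \<Rightarrow> real) \<Rightarrow> real \<Rightarrow> (real ^ 3 \<Rightarrow> real) \<Rightarrow>
   (real ^ 3) family \<Rightarrow> real family \<Rightarrow> (real ^ 3 \<Rightarrow> complex) family \<Rightarrow>
   nat \<Rightarrow> 2 \<Rightarrow> real ^ 3 \<Rightarrow> real ^ 3 \<Rightarrow> real ^ 2 \<Rightarrow> bool" where
  "profile_eqs chi L Q b \<mu> T N j \<alpha> \<beta> lam \<longleftrightarrow>
     (let S = T (N + 1) j \<alpha> \<beta> lam; E = Ehat chi L Q b \<mu> T N j \<alpha> \<beta> lam in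
        Ck 2 S \<and> exp_decaying S \<and>
        (\<forall>y. Lplus Q (\<lambda>x. Re (S x)) y =
               - ((lam $ j) ^ 3) * (b (N + 1) j \<alpha> \<beta> lam \<bullet> y) * Q y
               - (lam $ j)\<^sup>2 * psiL chi L (N + 1) (\<lambda>x. (Q x)\<^sup>2) j \<alpha> lam y * Q y
               + (lam $ j)\<^sup>2 * Re (E y)) \<and>
        (\<forall>y. Lminus Q (\<lambda>x. Im (S x)) y =
               - (lam $ j) * \<mu> (N + 1) j \<alpha> \<beta> lam * Lam Q y + (lam $ j)\<^sup>2 * Im (E y)) \<and>
        (\<forall>e\<in>Basis. orth (\<lambda>y. Re (S y)) (\<lambda>y. (y \<bullet> e) * Q y)) \<and>
        orth (\<lambda>y. Im (S y)) (Lam Q))"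

text \<open>The total function \<^const>\<open>frechet_derivative\<close> is meaningful only where the derivative exists;
  the differentiability conjuncts express that the parameter derivatives occurring in \<^const>\<open>Ehat\<close>
  exist.\<close>

definition recursive_construction ::
  "(real ^ 3 \<Rightarrow> real) \<Rightarrow> real \<Rightarrow> (real ^ 3 \<Rightarrow> real) \<Rightarrow>
   (real ^ 3) family \<Rightarrow> real family \<Rightarrow> (real ^ 3 \<Rightarrow> complex) family \<Rightarrow> bool" where
  "recursive_construction chi L Q b \<mu> T \<longleftrightarrow>
     (\<forall>j \<alpha> \<beta> lam. admissible \<alpha> lam \<longrightarrow>
        (\<forall>y. T 0 j \<alpha> \<beta> lam y = of_real (Q y)) \<and>
        (\<forall>N y. (\<lambda>a. T N j a \<beta> lam y) differentiable (at \<alpha>) \<and>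
               (\<lambda>v. T N j \<alpha> v lam y) differentiable (at \<beta>) \<and>
               (\<lambda>l. T N j \<alpha> \<beta> l y) differentiable (at lam)) \<and>
        (\<forall>N. coefficient_eqs chi L Q b \<mu> T N j \<alpha> \<beta> lam \<and>
             profile_eqs chi L Q b \<mu> T N j \<alpha> \<beta> lam))"

end

theory Submission
  imports Defs
begin

text \<open>
  All cancellations in the construction come from rotation symmetry. The expansion term of order \<open>n\<close>
  is a spherical harmonic of degree \<open>n - 1\<close> in \<open>\<zeta>\<close>, so \<open>\<psi>\<^sup>(\<^sup>n\<^sup>)\<close> of the radial density \<open>Q\<^sup>2\<close> is annihilated by
  every finite signed combination of rotations that annihilates such harmonics. These combinations
  commute with \<open>L\<^sub>+\<close> and \<open>L\<^sub>-\<close>, and the normalization makes the solutions unique, so the profiles inherit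
  the annihilation pointwise; being a pointwise linear identity, it also passes to the parameter
  derivatives. Testing against \<open>Q\<close> sees only degree 0 and testing against \<open>\<nabla>Q\<close> only degree 1. With
  \<open>T\<^sup>(\<^sup>1\<^sup>) = T\<^sup>(\<^sup>2\<^sup>) = 0\<close>, the real and imaginary parts of the sources up to order 6 consist of pieces that are even, odd,
  or derived from harmonics of degrees 2 to 5, and the only contribution that survives the testing is
  \<open>\<psi>\<^sup>(\<^sup>2\<^sup>)\<close>, which is linear and produces \<open>b\<^sup>(\<^sup>2\<^sup>)\<close>.
\<close>

text \<open>Finite combinations replace integration over the rotation group because
  \<open>recursive_construction\<close> gives differentiability of the profiles in the parameters
  only pointwise in y: a finite sum of values can be differentiated, an integral would need uniform
  bounds. The price is that concrete combinations must be exhibited. Averaging about an axis turns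
  every harmonic of degree n into a multiple of the zonal one; tilting the axis and averaging again
  multiplies that by P_n of the cosine of the tilt. Subtracting the right multiple of the first
  average kills degree n and keeps any degree with another Legendre value. The cosine 3/5, with sine
  4/5, makes these values rational. A second obstacle is that \<open>ground_state\<close> gives no
  decay of the gradient of Q. Its square integrability is read off the kernel of
  \<open>Lplus\<close>, which also yields uniqueness of the normalized solutions. Two families of
  terms are not removed by symmetry but cancel at every order where they occur: \<psi>^(1) of Q^2
  against the mass term of \<open>Ehat\<close>, and \<psi>^(2) of Q^2 against the
  b^(2)-term.\<close>

section \<open>Orthogonal maps, translations and integration on the whole space\<close>

lemma orthogonal_transformation_inverse:
  fixes R :: "'a::euclidean_space \<Rightarrow> 'a"
  assumes "orthogonal_transformation R"
  obtains R' where "orthogonal_transformation R'" "\<And>x. R (R' x) = x" "\<And>x. R' (R x) = x"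
    "\<And>x y. R x \<bullet> y = x \<bullet> R' y" "\<And>x y. x \<bullet> R y = R' x \<bullet> y"
proof -
  let ?R' = "inv R"
  have o: "orthogonal_transformation ?R'" and b: "bij R"
    using assms by (simp_all add: orthogonal_transformation_inv orthogonal_transformation_bij)
  have 1: "R (?R' x) = x" "?R' (R x) = x" for x
    using b by (simp_all add: bij_is_surj surj_f_inv_f bij_is_inj)
  have 2: "R x \<bullet> y = x \<bullet> ?R' y" for x y
    using assms 1 unfolding orthogonal_transformation_def by metis
  have "x \<bullet> R y = ?R' x \<bullet> y" for x y
    using 2[of y x] by (simp add: inner_commute)
  with o 1 2 that show thesis by blast
qed

lemma orthogonal_transformation_borel_measurable:
  fixes R :: "'a::euclidean_space \<Rightarrow> 'a"
  assumes "orthogonal_transformation R"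
  shows "R \<in> borel_measurable borel"
  using assms linear_continuous_on linear_conv_bounded_linear orthogonal_transformation_linear
  by (blast intro: borel_measurable_continuous_onI)

text \<open>Lebesgue measure is determined by its values on boxes, and the preimage of a box is its
  image under the inverse map. The measure of an orthogonal image is available for
  \<open>lebesgue\<close>, hence the passage from \<open>lborel\<close> and back.\<close>

lemma lborel_distr_orthogonal:
  fixes R :: "real ^ 3 \<Rightarrow> real ^ 3"
  assumes R: "orthogonal_transformation R"
  shows "distr lborel borel R = lborel"
proof -
  obtain R' where R': "orthogonal_transformation R'" "\<And>x. R (R' x) = x" "\<And>x. R' (R x) = x"
    using orthogonal_transformation_inverse[OF R] by metis
  note [measurable] = orthogonal_transformation_borel_measurable[OF R]
  show ?thesis
  proof (rule lborel_eqI[symmetric])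
    fix l u :: "real ^ 3"
    assume lu: "\<And>b. b \<in> Basis \<Longrightarrow> l \<bullet> b \<le> u \<bullet> b"
    have im: "R -` box l u = R' ` box l u"
      using R' by (auto simp: image_iff) metis+
    have meas: "R' ` box l u \<in> lmeasurable" "measure lebesgue (R' ` box l u) = measure lebesgue (box l u)"
      using R'(1) by (simp_all add: measurable_orthogonal_image measure_orthogonal_image)
    have borel: "R' ` box l u \<in> sets borel"
      unfolding im[symmetric] using measurable_sets[OF orthogonal_transformation_borel_measurable[OF R], of "box l u"]
      by simp
    have "emeasure (distr lborel borel R) (box l u) = emeasure lborel (R' ` box l u)"
      by (subst emeasure_distr) (simp_all add: im)
    also have "\<dots> = emeasure lebesgue (R' ` box l u)"
      using borel by simp
    also have "\<dots> = ennreal (measure lebesgue (R' ` box l u))"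
      using fmeasurableD2[OF meas(1)] by (rule emeasure_eq_ennreal_measure)
    also have "\<dots> = ennreal (measure lborel (box l u))"
      using meas(2) by simp
    also have "\<dots> = ennreal (\<Prod>b\<in>Basis. (u - l) \<bullet> b)"
      using lu by (simp add: measure_lborel_box)
    finally show "emeasure (distr lborel borel R) (box l u) = ennreal (\<Prod>b\<in>Basis. (u - l) \<bullet> b)" .
  qed simp
qed

text \<open>Integrability transfers in both directions, through the inverse map. The equality of
  integrals therefore carries no integrability hypothesis: in the divergent case both sides are the
  default value 0.\<close>

lemma
  fixes R :: "real ^ 3 \<Rightarrow> real ^ 3" and f :: "real ^ 3 \<Rightarrow> 'b::{banach, second_countable_topology}"
  assumes R: "orthogonal_transformation R"
  shows integrable_orthogonal_iff: "integrable lborel (\<lambda>x. f (R x)) \<longleftrightarrow> integrable lborel f"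
    and integral_orthogonal: "(LINT x|lborel. f (R x)) = (LINT x|lborel. f x)"
proof -
  have one: "integrable lborel (\<lambda>x. f (R x)) \<and> (LINT x|lborel. f (R x)) = (LINT x|lborel. f x)"
    if f: "integrable lborel f" and R: "orthogonal_transformation R" for f :: "real ^ 3 \<Rightarrow> 'b" and R :: "real ^ 3 \<Rightarrow> real ^ 3"
  proof -
    note [measurable] = orthogonal_transformation_borel_measurable[OF R]
    have i: "integrable (distr lborel borel R) f"
      using f by (simp add: lborel_distr_orthogonal[OF R])
    have [measurable]: "f \<in> borel_measurable borel"
      using borel_measurable_integrable[OF f] by simp
    show ?thesis
      using i integral_distr[of R lborel borel f] integrable_distr_eq[of R lborel borel f]
      by (simp add: lborel_distr_orthogonal[OF R])
  qed
  obtain R' where R': "orthogonal_transformation R'" "\<And>x. R (R' x) = x" "\<And>x. R' (R x) = x"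
    using orthogonal_transformation_inverse[OF R] by metis
  show iff: "integrable lborel (\<lambda>x. f (R x)) \<longleftrightarrow> integrable lborel f"
    using one[of f R] one[of "\<lambda>x. f (R x)" R'] R R' by auto
  show "(LINT x|lborel. f (R x)) = (LINT x|lborel. f x)"
    using one[of f R] R iff by (cases "integrable lborel f") (auto simp: not_integrable_integral_eq)
qed

lemma translation_integrable_integral:
  fixes f :: "'a::euclidean_space \<Rightarrow> 'b::{banach, second_countable_topology}"
  assumes f: "integrable lborel f"
  shows "integrable lborel (\<lambda>x. f (x + c))" "(LINT x|lborel. f (x + c)) = (LINT x|lborel. f x)"
proof -
  have [measurable]: "f \<in> borel_measurable borel"
    using borel_measurable_integrable[OF f] by simp
  have d: "distr lborel borel (\<lambda>x. x + c) = lborel"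
    using lborel_distr_plus[of c] by (simp add: add.commute[of _ c])
  show "integrable lborel (\<lambda>x. f (x + c))"
    using integrable_distr_eq[of "\<lambda>x. x + c" lborel borel f] f d by simp
  show "(LINT x|lborel. f (x + c)) = (LINT x|lborel. f x)"
    using integral_distr[of "\<lambda>x. x + c" lborel borel f] d by simp
qed

text \<open>Integration by parts on the whole space: \<open>f (x + e) - f x\<close> is the integral of the derivative
  along a unit segment, and Fubini's theorem together with translation invariance evaluates it.\<close>

lemma integral_dird_eq_0:
  fixes f :: "'a::euclidean_space \<Rightarrow> real"
  assumes diff: "\<And>x. f differentiable (at x)" and cont: "continuous_on UNIV (dird e f)"
    and f: "integrable lborel f" and g: "integrable lborel (dird e f)"
  shows "(LINT x|lborel. dird e f x) = 0"
proof -
  define g where "g = dird e f"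
  have gint: "integrable lborel g" and gc: "continuous_on UNIV g"
    using g cont by (simp_all add: g_def)
  have [measurable]: "g \<in> borel_measurable borel"
    by (rule borel_measurable_continuous_onI[OF gc])
  define h where "h = (\<lambda>(s::real) x. indicator {0..1} s * g (x + s *\<^sub>R e))"
  have hm: "case_prod h \<in> borel_measurable (lborel \<Otimes>\<^sub>M lborel)"
    unfolding h_def by measurable
  have inner: "integrable lborel (h s)" "(LINT x|lborel. h s x) = indicator {0..1} s * (LINT x|lborel. g x)"
    "(LINT x|lborel. norm (h s x)) = indicator {0..1} s * (LINT x|lborel. norm (g x))" for s
    unfolding h_def
    using translation_integrable_integral[OF gint, of "s *\<^sub>R e"]
      translation_integrable_integral(2)[OF integrable_norm[OF gint], of "s *\<^sub>R e"]
    by (auto simp: abs_mult)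
  have hi: "integrable (lborel \<Otimes>\<^sub>M lborel) (case_prod h)"
    by (rule lborel_pair.Fubini_integrable[OF hm]) (use inner in auto)
  have ftc: "(LINT s|lborel. h s x) = f (x + e) - f x" for x
  proof -
    have "(LINT s|lborel. h s x) = f (x + 1 *\<^sub>R e) - f (x + 0 *\<^sub>R e)"
      unfolding h_def real_scaleR_def[symmetric]
    proof (rule integral_FTC_atLeastAtMost)
      fix s :: real
      have "(f has_derivative frechet_derivative f (at (x + s *\<^sub>R e))) (at (x + s *\<^sub>R e))"
        using diff frechet_derivative_works by blast
      moreover have "((\<lambda>s. x + s *\<^sub>R e) has_derivative (\<lambda>t. t *\<^sub>R e)) (at s within {0..1})"
        by (auto intro!: derivative_eq_intros)
      ultimately have "((\<lambda>s. f (x + s *\<^sub>R e)) has_derivative (\<lambda>t. frechet_derivative f (at (x + s *\<^sub>R e)) (t *\<^sub>R e))) (at s within {0..1})"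
        using has_derivative_compose by blast
      moreover have "frechet_derivative f (at (x + s *\<^sub>R e)) (t *\<^sub>R e) = t *\<^sub>R g (x + s *\<^sub>R e)" for t
        using linear_frechet_derivative[OF diff] by (simp add: linear_cmul g_def dird_def)
      ultimately show "((\<lambda>s. f (x + s *\<^sub>R e)) has_vector_derivative g (x + s *\<^sub>R e)) (at s within {0..1})"
        by (simp add: has_vector_derivative_def)
    next
      show "continuous_on {0..1} (\<lambda>s. g (x + s *\<^sub>R e))"
        by (intro continuous_on_compose2[OF gc] continuous_intros) auto
    qed simp
    then show ?thesis by simp
  qed
  have "(LINT x|lborel. LINT s|lborel. h s x) = (LINT s|lborel. LINT x|lborel. h s x)"
    by (rule lborel_pair.Fubini_integral[OF hi])
  also have "\<dots> = (LINT s::real|lborel. indicator {0..1} s *\<^sub>R (LINT x|lborel. g x))"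
    by (simp add: inner)
  also have "\<dots> = (LINT x|lborel. g x)"
    by simp
  finally have "(LINT x|lborel. g x) = (LINT x|lborel. f (x + e) - f x)"
    by (simp add: ftc)
  also have "\<dots> = 0"
    using translation_integrable_integral[OF f, of e] f by simp
  finally show ?thesis by (simp add: g_def)
qed

section \<open>Exponential decay and polynomial growth\<close>

lemma exp_decaying_mono:
  assumes "exp_decaying f" "\<And>x. norm (g x) \<le> norm (f x)"
  shows "exp_decaying g"
  using assms unfolding exp_decaying_def by (meson order_trans)

text \<open>Products of such bounds need a positive constant, which the definition does not
  promise.\<close>

lemma exp_decaying_D:
  assumes "exp_decaying f"
  obtains C c where "C > 0" "c > 0" "\<And>x. norm (f x) \<le> C * exp (- c * norm x)"
proof -
  obtain C c where c: "c > 0" "\<And>x. norm (f x) \<le> C * exp (- c * norm x)"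
    using assms unfolding exp_decaying_def by blast
  have "norm (f x) \<le> (\<bar>C\<bar> + 1) * exp (- c * norm x)" for x
    by (rule order_trans[OF c(2)]) (simp add: mult_right_mono)
  with c(1) that[of "\<bar>C\<bar> + 1" c] show thesis by auto
qed

lemma exp_decaying_add:
  assumes "exp_decaying f" "exp_decaying g"
  shows "exp_decaying (\<lambda>x. f x + g x)"
proof -
  obtain C c where f: "C > 0" "c > 0" "\<And>x. norm (f x) \<le> C * exp (- c * norm x)"
    using exp_decaying_D[OF assms(1)] by blast
  obtain D d where g: "D > 0" "d > 0" "\<And>x. norm (g x) \<le> D * exp (- d * norm x)"
    using exp_decaying_D[OF assms(2)] by blast
  have "norm (f x + g x) \<le> (C + D) * exp (- min c d * norm x)" for x
  proof -
    have "norm (f x + g x) \<le> C * exp (- c * norm x) + D * exp (- d * norm x)"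
      using norm_triangle_le[OF add_mono[OF f(3)[of x] g(3)[of x]]] .
    also have "\<dots> \<le> C * exp (- min c d * norm x) + D * exp (- min c d * norm x)"
      using f g by (intro add_mono mult_left_mono) (auto simp: mult_right_mono)
    finally show ?thesis by (simp add: algebra_simps)
  qed
  then show ?thesis unfolding exp_decaying_def using f g by (metis min_less_iff_conj)
qed

lemma exp_decaying_scaleR:
  assumes "exp_decaying f"
  shows "exp_decaying (\<lambda>x. a *\<^sub>R f x)"
proof -
  obtain C c where f: "C > 0" "c > 0" "\<And>x. norm (f x) \<le> C * exp (- c * norm x)"
    using exp_decaying_D[OF assms] by blast
  have "norm (a *\<^sub>R f x) \<le> (\<bar>a\<bar> * C) * exp (- c * norm x)" for x
    using mult_left_mono[OF f(3)[of x], of "\<bar>a\<bar>"] by simp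
  with f(2) show ?thesis unfolding exp_decaying_def by blast
qed

lemma exp_decaying_zero: "exp_decaying (\<lambda>x. 0)"
  unfolding exp_decaying_def by (rule exI[of _ 0]) (auto intro: exI[of _ 1])

text \<open>Continuity is included so that products with continuous decaying functions remain
  continuous, hence measurable. The intended multipliers are coordinates and the polynomials of the
  expansion.\<close>

definition poly_growth :: "(real ^ 3 \<Rightarrow> real) \<Rightarrow> bool" where
  "poly_growth g \<longleftrightarrow> continuous_on UNIV g \<and> (\<exists>C k. \<forall>x. \<bar>g x\<bar> \<le> C * (1 + norm x) ^ k)"

lemma poly_growth_D:
  assumes "poly_growth g"
  obtains C k where "C \<ge> 0" "\<And>x. \<bar>g x\<bar> \<le> C * (1 + norm x) ^ k"
proof -
  obtain C k where c: "\<And>x. \<bar>g x\<bar> \<le> C * (1 + norm x) ^ k"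
    using assms unfolding poly_growth_def by blast
  have "\<bar>g x\<bar> \<le> \<bar>C\<bar> * (1 + norm x) ^ k" for x
    by (rule order_trans[OF c]) (simp add: mult_right_mono)
  with that[of "\<bar>C\<bar>" k] show thesis by auto
qed

lemma poly_growth_const: "poly_growth (\<lambda>x. c)"
proof -
  have "\<forall>x. \<bar>c\<bar> \<le> \<bar>c\<bar> * (1 + norm (x :: real ^ 3)) ^ 0" by simp
  then show ?thesis unfolding poly_growth_def by (blast intro: continuous_on_const)
qed

lemma poly_growth_linear:
  assumes "linear g"
  shows "poly_growth g"
proof -
  obtain B where "\<And>x. norm (g x) \<le> B * norm x" "B > 0"
    using assms linear_bounded_pos by blast
  then have "\<bar>g x\<bar> \<le> B * (1 + norm x) ^ 1" for x
    by (simp add: order_trans[OF \<open>norm (g x) \<le> B * norm x\<close>[unfolded real_norm_def]])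
  then show ?thesis
    unfolding poly_growth_def
    using assms linear_continuous_on linear_conv_bounded_linear by blast
qed

lemma poly_growth_add:
  assumes "poly_growth f" "poly_growth g"
  shows "poly_growth (\<lambda>x. f x + g x)"
proof -
  obtain C k where f: "C \<ge> 0" "\<And>x. \<bar>f x\<bar> \<le> C * (1 + norm x) ^ k"
    using poly_growth_D[OF assms(1)] by blast
  obtain D l where g: "D \<ge> 0" "\<And>x. \<bar>g x\<bar> \<le> D * (1 + norm x) ^ l"
    using poly_growth_D[OF assms(2)] by blast
  have "\<bar>f x + g x\<bar> \<le> (C + D) * (1 + norm x) ^ (max k l)" for x
  proof -
    have "\<bar>f x + g x\<bar> \<le> C * (1 + norm x) ^ k + D * (1 + norm x) ^ l"
      using f(2)[of x] g(2)[of x] by linarith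
    also have "\<dots> \<le> C * (1 + norm x) ^ (max k l) + D * (1 + norm x) ^ (max k l)"
      using f g by (intro add_mono mult_left_mono power_increasing) auto
    finally show ?thesis by (simp add: algebra_simps)
  qed
  then show ?thesis
    using assms unfolding poly_growth_def by (auto intro!: continuous_intros)
qed

lemma poly_growth_mult:
  assumes "poly_growth f" "poly_growth g"
  shows "poly_growth (\<lambda>x. f x * g x)"
proof -
  obtain C k where f: "C \<ge> 0" "\<And>x. \<bar>f x\<bar> \<le> C * (1 + norm x) ^ k"
    using poly_growth_D[OF assms(1)] by blast
  obtain D l where g: "D \<ge> 0" "\<And>x. \<bar>g x\<bar> \<le> D * (1 + norm x) ^ l"
    using poly_growth_D[OF assms(2)] by blast
  have "\<bar>f x * g x\<bar> \<le> (C * D) * (1 + norm x) ^ (k + l)" for x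
    using mult_mono[OF f(2)[of x] g(2)[of x]] f(1) by (simp add: abs_mult power_add mult_ac)
  then show ?thesis
    using assms unfolding poly_growth_def by (auto intro!: continuous_intros)
qed

text \<open>Half of the exponential rate absorbs the polynomial, the other half remains as
  decay.\<close>

lemma exp_decaying_poly_growth_mult:
  assumes "exp_decaying f" "poly_growth g"
  shows "exp_decaying (\<lambda>x. g x *\<^sub>R f x)"
proof -
  obtain C c where f: "C > 0" "c > 0" "\<And>x. norm (f x) \<le> C * exp (- c * norm x)"
    using exp_decaying_D[OF assms(1)] by blast
  obtain D k where g: "D \<ge> 0" "\<And>x. \<bar>g x\<bar> \<le> D * (1 + norm x) ^ k"
    using poly_growth_D[OF assms(2)] by blast
  \<comment> \<open>Each of the k factors may spend a rate of at most c / (2 k); k + 1 in place of k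
    avoids a zero denominator.\<close>
  define a where "a = c / (2 * (real k + 1))"
  have a: "a > 0" using f by (simp add: a_def)
  define K where "K = ((1 + a) / a) ^ k"
  have bound: "(1 + t) ^ k \<le> K * exp (c / 2 * t)" if "t \<ge> 0" for t :: real
  proof -
    have "1 + t \<le> (1 + a) / a * exp (a * t)"
    proof -
      have "1 + t \<le> (1 + a) / a * (1 + a * t)"
        using a that by (simp add: field_simps)
      also have "\<dots> \<le> (1 + a) / a * exp (a * t)"
        using a that exp_ge_add_one_self by (intro mult_left_mono) auto
      finally show ?thesis .
    qed
    then have "(1 + t) ^ k \<le> ((1 + a) / a * exp (a * t)) ^ k"
      using that by (intro power_mono) auto
    also have "\<dots> = K * exp (real k * (a * t))"
      by (simp add: K_def power_mult_distrib power_divide exp_of_nat_mult)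
    also have "\<dots> \<le> K * exp (c / 2 * t)"
    proof -
      have "real k * a \<le> c / 2" using f by (simp add: a_def field_simps)
      then have "real k * (a * t) \<le> c / 2 * t"
        using mult_right_mono[OF _ that] by (fastforce simp: mult.assoc)
      then show ?thesis using a by (intro mult_left_mono) (auto simp: K_def)
    qed
    finally show ?thesis .
  qed
  have "norm (g x *\<^sub>R f x) \<le> (D * K * C) * exp (- (c / 2) * norm x)" for x
  proof -
    have "norm (g x *\<^sub>R f x) \<le> (D * (1 + norm x) ^ k) * (C * exp (- c * norm x))"
      using mult_mono[OF g(2)[of x] f(3)[of x]] g(1) by simp
    also have "\<dots> \<le> (D * (K * exp (c / 2 * norm x))) * (C * exp (- c * norm x))"
      using g f bound[of "norm x"] by (intro mult_right_mono mult_left_mono) auto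
    also have "\<dots> = (D * K * C) * (exp (c / 2 * norm x) * exp (- c * norm x))"
      by simp
    also have "exp (c / 2 * norm x) * exp (- c * norm x) = exp (- (c / 2) * norm x)"
      by (simp add: exp_add[symmetric] algebra_simps)
    finally show ?thesis .
  qed
  with f(2) show ?thesis unfolding exp_decaying_def by (meson half_gt_zero)
qed

lemma exp_decaying_mult:
  fixes f g :: "real ^ 3 \<Rightarrow> real"
  assumes "exp_decaying f" "exp_decaying g"
  shows "exp_decaying (\<lambda>x. f x * g x)"
proof -
  obtain C c where f: "C > 0" "c > 0" "\<And>x. norm (f x) \<le> C * exp (- c * norm x)"
    using exp_decaying_D[OF assms(1)] by blast
  obtain D d where g: "D > 0" "d > 0" "\<And>x. norm (g x) \<le> D * exp (- d * norm x)"
    using exp_decaying_D[OF assms(2)] by blast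
  have "norm (f x * g x) \<le> (C * D) * exp (- (c + d) * norm x)" for x
    using mult_mono[OF f(3)[of x] g(3)[of x]] f(1)
    by (simp add: abs_mult distrib_right exp_add mult_ac exp_diff exp_minus field_simps)
  moreover have "c + d > 0" using f g by simp
  ultimately show ?thesis unfolding exp_decaying_def by blast
qed

section \<open>Convergence of the Newtonian integral\<close>

text \<open>Since \<open>\<bar>z\<^sub>1 z\<^sub>2 z\<^sub>3\<bar> \<le> \<bar>z\<bar>\<^sup>3\<close>, the Newtonian singularity is dominated by a product of
  integrable functions of one variable.\<close>

lemma integrable_powr_third_exp:
  assumes "a > 0"
  shows "(\<integral>\<^sup>+t. ennreal (\<bar>t\<bar> powr (-1/3) * exp (- a * \<bar>t\<bar>)) \<partial>lborel) < \<infinity>"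
proof -
  \<comment> \<open>The integrand of Gamma(2/3); rescaling it by \<open>a\<close> and by
    \<open>- a\<close> covers the two half-lines.\<close>
  define h where "h = (\<lambda>t::real. indicator {0..} t * t powr (2/3 - 1) / exp t)"
  have [measurable]: "h \<in> borel_measurable borel" unfolding h_def by measurable
  have h0: "h t \<ge> 0" for t by (auto simp: h_def)
  have fin: "(\<integral>\<^sup>+t. ennreal (h t) \<partial>lborel) < \<infinity>"
  proof -
    have "ennreal (Gamma (2/3)) = (\<integral>\<^sup>+t. ennreal (h t) \<partial>lborel)"
      unfolding h_def by (rule Gamma_conv_nn_integral_real) simp
    then show ?thesis by (metis ennreal_less_top infinity_ennreal_def)
  qed
  have ih: "integrable lborel h"
    by (rule integrableI_nonneg) (use h0 fin in auto)
  have i1: "integrable lborel (\<lambda>t. h (0 + a * t))" and i2: "integrable lborel (\<lambda>t. h (0 + (-a) * t))"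
    by (rule lborel_integrable_real_affine[OF ih], use assms in simp)+
  have i: "integrable lborel (\<lambda>t. (1 / a powr (-1/3)) * (h (0 + a * t) + h (0 + (-a) * t)))"
    by (intro integrable_mult_right Bochner_Integration.integrable_add i1 i2)
  have pos: "h (a * s) = a powr (-1/3) * (s powr (-1/3) * exp (- a * s))" if "s > 0" for s
  proof -
    have "h (a * s) = (a * s) powr (-1/3) / exp (a * s)"
      using that assms by (simp add: h_def)
    also have "\<dots> = a powr (-1/3) * (s powr (-1/3) * exp (- a * s))"
      using that assms
      by (subst powr_mult) (simp_all only: exp_minus divide_inverse mult.assoc minus_mult_left[symmetric])
    finally show ?thesis .
  qed
  have neg: "h s = 0" if "s < 0" for s
    using that by (simp add: h_def)
  have a0: "a powr (-1/3) > 0" using assms by simp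
  have eq: "\<bar>t\<bar> powr (-1/3) * exp (- a * \<bar>t\<bar>) \<le> (1 / a powr (-1/3)) * (h (0 + a * t) + h (0 + (-a) * t))" for t
  proof (cases t "0::real" rule: linorder_cases)
    case less
    then have "a * t < 0" using assms by (rule mult_pos_neg[rotated])
    then have "h (0 + a * t) = 0" "h (0 + (-a) * t) = a powr (-1/3) * (\<bar>t\<bar> powr (-1/3) * exp (- a * \<bar>t\<bar>))"
      using neg pos[of "-t"] less by simp_all
    then show ?thesis using a0 by simp
  next
    case greater
    then have "- (a * t) < 0" using assms by simp
    then have "h (0 + (-a) * t) = 0" "h (0 + a * t) = a powr (-1/3) * (\<bar>t\<bar> powr (-1/3) * exp (- a * \<bar>t\<bar>))"
      using neg pos[of t] greater by simp_all
    then show ?thesis using a0 by simp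
  next
    \<comment> \<open>Here \<open>0 powr (-1/3)\<close> is 0, so both sides vanish.\<close>
    case equal
    then show ?thesis by (simp add: h_def)
  qed
  have "(\<integral>\<^sup>+t. ennreal (\<bar>t\<bar> powr (-1/3) * exp (- a * \<bar>t\<bar>)) \<partial>lborel)
      \<le> (\<integral>\<^sup>+t. ennreal ((1 / a powr (-1/3)) * (h (0 + a * t) + h (0 + (-a) * t))) \<partial>lborel)"
    by (intro nn_integral_mono ennreal_leI eq)
  also have "\<dots> < \<infinity>"
    using i h0 a0 unfolding integrable_iff_bounded by simp
  finally show ?thesis .
qed

lemma integrable_newton_exp:
  assumes "c > 0"
  shows "integrable lborel (\<lambda>z::real ^ 3. exp (- c * norm z) / norm z)"
proof -
  define f where "f = (\<lambda>t::real. \<bar>t\<bar> powr (-1/3) * exp (- (c / 3) * \<bar>t\<bar>))"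
  have [measurable]: "f \<in> borel_measurable borel" unfolding f_def by measurable
  have f0: "f t \<ge> 0" for t by (simp add: f_def)
  have le: "exp (- c * norm z) / norm z \<le> (\<Prod>e\<in>Basis. f (z \<bullet> e))" if "\<forall>e\<in>Basis. z \<bullet> e \<noteq> 0" for z :: "real ^ 3"
  proof -
    have nz: "norm z > 0" using that by (metis inner_zero_left nonempty_Basis some_in_eq zero_less_norm_iff)
    have card: "card (Basis :: (real ^ 3) set) = 3" by simp
    have "(\<Prod>e\<in>(Basis :: (real ^ 3) set). norm z powr (-1/3)) \<le> (\<Prod>e\<in>Basis. \<bar>z \<bullet> e\<bar> powr (-1/3))"
    proof (rule prod_mono)
      fix e :: "real ^ 3" assume e: "e \<in> Basis"
      show "0 \<le> norm z powr (-1/3) \<and> norm z powr (-1/3) \<le> \<bar>z \<bullet> e\<bar> powr (-1/3)"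
        using that e Basis_le_norm[OF e, of z] powr_mono2'[of "-1/3" "\<bar>z \<bullet> e\<bar>" "norm z"] by simp
    qed
    moreover have "(\<Prod>e\<in>(Basis :: (real ^ 3) set). norm z powr (-1/3)) = 1 / norm z"
    proof -
      have "(norm z powr (-1/3)) ^ 3 = norm z powr (-1)"
        using nz by (subst powr_power) simp_all
      also have "\<dots> = 1 / norm z"
        using nz by (simp add: powr_minus_divide)
      finally show ?thesis by (simp only: prod_constant card)
    qed
    moreover have "exp (- c * norm z) \<le> (\<Prod>e\<in>Basis. exp (- (c / 3) * \<bar>z \<bullet> e\<bar>))"
    proof -
      have "(\<Sum>e\<in>Basis. \<bar>z \<bullet> e\<bar>) \<le> (\<Sum>e\<in>(Basis::(real ^ 3) set). norm z)"
        using Basis_le_norm by (intro sum_mono) auto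
      then have "(c / 3) * (\<Sum>e\<in>Basis. \<bar>z \<bullet> e\<bar>) \<le> (c / 3) * (3 * norm z)"
        using assms by (intro mult_left_mono) auto
      then show ?thesis
        by (simp add: exp_sum[symmetric] sum_negf sum_distrib_left)
    qed
    ultimately have "(1 / norm z) * exp (- c * norm z)
        \<le> (\<Prod>e\<in>Basis. \<bar>z \<bullet> e\<bar> powr (-1/3)) * (\<Prod>e\<in>Basis. exp (- (c / 3) * \<bar>z \<bullet> e\<bar>))"
      by (intro mult_mono) (auto intro!: prod_nonneg)
    then show ?thesis by (simp add: f_def prod.distrib)
  qed
  \<comment> \<open>The coordinate hyperplanes must be left out: since \<open>0 powr (-1/3)\<close>
    is 0, the product vanishes there and bounds nothing.\<close>
  have ae: "AE z in lborel. \<forall>e\<in>(Basis :: (real ^ 3) set). z \<bullet> e \<noteq> 0"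
  proof (subst AE_finite_all)
    show "\<forall>e\<in>(Basis :: (real ^ 3) set). AE z in lborel. z \<bullet> e \<noteq> 0"
    proof
      fix e :: "real ^ 3" assume "e \<in> Basis"
      then have "e \<noteq> 0" by auto
      then have "negligible {z. e \<bullet> z = 0}"
        by (intro negligible_hyperplane) auto
      then have "{z. z \<bullet> e = 0} \<in> null_sets lebesgue"
        by (simp add: negligible_iff_null_sets inner_commute)
      moreover have "{z. z \<bullet> e = 0} \<in> sets borel"
        by (intro borel_closed closed_Collect_eq continuous_intros)
      ultimately have "{z. z \<bullet> e = 0} \<in> null_sets lborel"
        by (simp add: null_sets_def)
      then show "AE z in lborel. z \<bullet> e \<noteq> 0"
        by (rule AE_I') auto
    qed
  qed simp
  show ?thesis
  proof (rule integrableI_bounded)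
    show "(\<lambda>z::real ^ 3. exp (- c * norm z) / norm z) \<in> borel_measurable lborel"
      by measurable
    have "(\<integral>\<^sup>+z. ennreal (norm (exp (- c * norm z) / norm z)) \<partial>(lborel :: (real ^ 3) measure))
        \<le> (\<integral>\<^sup>+z. (\<Prod>e\<in>Basis. ennreal (f (z \<bullet> e))) \<partial>(lborel :: (real ^ 3) measure))"
    proof (rule nn_integral_mono_AE)
      show "AE z in (lborel :: (real ^ 3) measure).
          ennreal (norm (exp (- c * norm z) / norm z)) \<le> (\<Prod>e\<in>Basis. ennreal (f (z \<bullet> e)))"
        using ae by eventually_elim (use le in \<open>simp add: prod_ennreal f0 ennreal_leI\<close>)
    qed
    also have "\<dots> = (\<Prod>e\<in>(Basis :: (real ^ 3) set). (\<integral>\<^sup>+t. ennreal (f t) \<partial>lborel))"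
      by (rule nn_integral_lborel_prod) auto
    also have "\<dots> < \<infinity>"
      using integrable_powr_third_exp[of "c / 3"] assms
      by (simp add: f_def power_less_top_ennreal)
    finally show "(\<integral>\<^sup>+z. ennreal (norm (exp (- c * norm z) / norm z)) \<partial>(lborel :: (real ^ 3) measure)) < \<infinity>" .
  qed
qed

text \<open>From |y - x| <= |y| + |x|, the density is at most a constant depending on x times a
  decaying function centred at x. This convergence is what makes \<open>phi\<close>
  additive.\<close>

lemma integrable_newton:
  fixes f :: "real ^ 3 \<Rightarrow> real"
  assumes "continuous_on UNIV f" "exp_decaying f"
  shows "integrable lborel (\<lambda>y. f y / norm (x - y))"
proof -
  obtain C c where f: "C > 0" "c > 0" "\<And>x. norm (f x) \<le> C * exp (- c * norm x)"
    using exp_decaying_D[OF assms(2)] by blast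
  have [measurable]: "f \<in> borel_measurable borel"
    by (rule borel_measurable_continuous_onI[OF assms(1)])
  define g where "g = (\<lambda>z::real ^ 3. exp (- c * norm z) / norm z)"
  have "integrable lborel (\<lambda>y. g (y + (- x)))"
    unfolding g_def by (rule translation_integrable_integral(1)[OF integrable_newton_exp[OF f(2)]])
  then have i: "integrable lborel (\<lambda>y. (C * exp (c * norm x)) * g (y + (- x)))"
    by (rule integrable_mult_right)
  show ?thesis
  proof (rule Bochner_Integration.integrable_bound[OF i])
    show "AE y in lborel. norm (f y / norm (x - y)) \<le> norm ((C * exp (c * norm x)) * g (y + (- x)))"
    proof (rule AE_I2)
      fix y
      have "norm (y - x) \<le> norm y + norm x" by (rule norm_triangle_ineq4)
      then have "c * norm (y - x) \<le> c * norm y + c * norm x"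
        using f(2) by (metis distrib_left less_imp_le mult_left_mono)
      then have "exp (- c * norm y) \<le> exp (c * norm x) * exp (- c * norm (y - x))"
        by (simp add: exp_add[symmetric])
      then have "C * exp (- c * norm y) \<le> C * (exp (c * norm x) * exp (- c * norm (y - x)))"
        using f(1) by (intro mult_left_mono) auto
      then have "\<bar>f y\<bar> \<le> C * (exp (c * norm x) * exp (- c * norm (y - x)))"
        using f(3)[of y] by simp
      then have "\<bar>f y\<bar> / norm (x - y) \<le> C * (exp (c * norm x) * exp (- c * norm (y - x))) / norm (x - y)"
        by (rule divide_right_mono) simp
      then show "norm (f y / norm (x - y)) \<le> norm ((C * exp (c * norm x)) * g (y + (- x)))"
        using f(1) by (simp add: g_def norm_minus_commute abs_mult)
    qed
  qed measurable
qed

text \<open>Reduced to the Newtonian integral at the origin with density |y| f(y): dividing by |y|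
  restores f almost everywhere.\<close>

lemma integrable_exp_decaying:
  fixes f :: "real ^ 3 \<Rightarrow> real"
  assumes "continuous_on UNIV f" "exp_decaying f"
  shows "integrable lborel f"
proof -
  have pg: "poly_growth (\<lambda>x. norm x)"
    unfolding poly_growth_def by (auto intro!: continuous_intros exI[of _ 1])
  have "continuous_on UNIV (\<lambda>x. norm x *\<^sub>R f x)"
    using assms(1) by (intro continuous_intros)
  from integrable_newton[OF this exp_decaying_poly_growth_mult[OF assms(2) pg], of 0]
  have i: "integrable lborel (\<lambda>y. norm y * f y / norm y)" by simp
  have [measurable]: "f \<in> borel_measurable borel"
    by (rule borel_measurable_continuous_onI[OF assms(1)])
  show ?thesis
  proof (rule integrable_cong_AE_imp[OF i])
    show "AE y in lborel. norm y * f y / norm y = f y"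
      using AE_lborel_singleton[of 0] by eventually_elim simp
  qed simp
qed

section \<open>Directional derivatives, the classes \<open>Ck\<close>, and invariance of
  \<open>laplacian\<close> and \<open>phi\<close>\<close>

lemma dird_has_derivative:
  assumes "(f has_derivative f') (at x)"
  shows "dird v f x = f' v"
  unfolding dird_def using frechet_derivative_at[OF assms] by simp

lemma differentiable_has_dird:
  assumes "f differentiable (at x)"
  shows "(f has_derivative (\<lambda>v. dird v f x)) (at x)"
  using assms frechet_derivative_works unfolding dird_def by blast

lemma linear_dird:
  assumes "f differentiable (at x)"
  shows "linear (\<lambda>v. dird v f x)"
  using assms linear_frechet_derivative unfolding dird_def by blast

lemma dird_Basis:
  fixes f :: "'a::euclidean_space \<Rightarrow> 'b::real_normed_vector"
  assumes "f differentiable (at x)"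
  shows "dird v f x = (\<Sum>e\<in>Basis. (v \<bullet> e) *\<^sub>R dird e f x)"
proof -
  have "dird v f x = dird (\<Sum>e\<in>Basis. (v \<bullet> e) *\<^sub>R e) f x"
    by (simp add: euclidean_representation)
  also have "\<dots> = (\<Sum>e\<in>Basis. (v \<bullet> e) *\<^sub>R dird e f x)"
    by (simp add: linear_sum[OF linear_dird[OF assms]] linear_cmul[OF linear_dird[OF assms]])
  finally show ?thesis .
qed

lemma dird_add:
  assumes "f differentiable (at x)" "g differentiable (at x)"
  shows "dird v (\<lambda>x. f x + g x) x = dird v f x + dird v g x"
  using has_derivative_add[OF assms[THEN differentiable_has_dird]] by (rule dird_has_derivative)

lemma dird_bounded_linear:
  assumes "bounded_linear L" "f differentiable (at x)"
  shows "dird v (\<lambda>x. L (f x)) x = L (dird v f x)"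
  using bounded_linear.has_derivative[OF assms(1) differentiable_has_dird[OF assms(2)]]
  by (rule dird_has_derivative)

lemma dird_const: "dird v (\<lambda>x. c) x = 0"
  by (rule dird_has_derivative) simp

lemma has_derivative_compose_linear:
  fixes R :: "'a::euclidean_space \<Rightarrow> 'a" and f :: "'a \<Rightarrow> 'b::real_normed_vector"
  assumes "linear R" "f differentiable (at (R x))"
  shows "((\<lambda>x. f (R x)) has_derivative (\<lambda>v. dird (R v) f (R x))) (at x)"
  using has_derivative_compose[OF linear_imp_has_derivative[OF assms(1)] differentiable_has_dird[OF assms(2)]] .

lemma dird_compose_linear:
  fixes R :: "'a::euclidean_space \<Rightarrow> 'a" and f :: "'a \<Rightarrow> 'b::real_normed_vector"
  assumes "linear R" "f differentiable (at (R x))"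
  shows "dird v (\<lambda>x. f (R x)) x = dird (R v) f (R x)"
  using has_derivative_compose_linear[OF assms] by (rule dird_has_derivative)

lemma Ck_continuous: "Ck k f \<Longrightarrow> continuous_on UNIV f"
  by (cases k) (auto intro!: differentiable_imp_continuous_on simp: differentiable_on_def)

lemma Ck_const: "Ck k (\<lambda>x. c)"
  by (induction k arbitrary: c) (auto simp: dird_const[abs_def])

lemma Ck_add: "Ck k f \<Longrightarrow> Ck k g \<Longrightarrow> Ck k (\<lambda>x. f x + g x)"
proof (induction k arbitrary: f g)
  case (Suc k)
  then have "dird e (\<lambda>x. f x + g x) = (\<lambda>x. dird e f x + dird e g x)" for e
    by (simp add: fun_eq_iff dird_add)
  with Suc show ?case by simp
qed (auto intro: continuous_on_add)

lemma Ck_bounded_linear: "bounded_linear L \<Longrightarrow> Ck k f \<Longrightarrow> Ck k (\<lambda>x. L (f x))"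
proof (induction k arbitrary: f)
  case (Suc k)
  then have "dird e (\<lambda>x. L (f x)) = (\<lambda>x. L (dird e f x))" for e
    by (simp add: fun_eq_iff dird_bounded_linear)
  moreover have "(\<lambda>x. L (f x)) differentiable (at x)" for x
    using Suc.prems by (simp add: bounded_linear_imp_differentiable differentiable_compose[of L f])
  ultimately show ?case using Suc by simp
qed (simp add: bounded_linear.continuous_on)

lemma Ck_sum: "(\<And>i. i \<in> I \<Longrightarrow> Ck k (f i)) \<Longrightarrow> Ck k (\<lambda>x. \<Sum>i\<in>I. f i x)"
  by (induction I rule: infinite_finite_induct) (auto intro: Ck_const Ck_add)

text \<open>\<open>Ck\<close> looks only at basis directions, whereas the chain rule produces the
  direction \<open>R e\<close>; expanding it in the basis keeps the induction going.\<close>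

lemma Ck_compose_linear: "linear R \<Longrightarrow> Ck k f \<Longrightarrow> Ck k (\<lambda>x. f (R x))"
proof (induction k arbitrary: f)
  case 0
  then have "continuous_on UNIV R" "continuous_on UNIV f"
    using linear_continuous_on linear_conv_bounded_linear by auto
  then show ?case by (auto intro: continuous_on_compose2)
next
  case (Suc k)
  have d: "f differentiable (at x)" for x using Suc.prems by simp
  have "dird e (\<lambda>x. f (R x)) = (\<lambda>x. \<Sum>b\<in>Basis. (R e \<bullet> b) *\<^sub>R dird b f (R x))" for e
    by (rule ext) (simp add: dird_compose_linear[OF Suc.prems(1) d] dird_Basis[OF d, of "R e"])
  moreover have "Ck k (\<lambda>x. \<Sum>b\<in>Basis. (R e \<bullet> b) *\<^sub>R dird b f (R x))" for e
    using Suc by (intro Ck_sum Ck_bounded_linear[OF bounded_linear_scaleR_right]) simp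
  moreover have "(\<lambda>x. f (R x)) differentiable (at x)" for x
    using has_derivative_compose_linear[OF Suc.prems(1) d] unfolding differentiable_def by blast
  ultimately show ?case by simp
qed

lemma Ck_2_cases:
  assumes "Ck 2 f"
  shows "f differentiable (at x)" "e \<in> Basis \<Longrightarrow> dird e f differentiable (at x)"
    "e \<in> Basis \<Longrightarrow> continuous_on UNIV (dird e f)"
proof -
  have c: "Ck (Suc (Suc 0)) f" using assms by (simp add: numeral_2_eq_2)
  then show "f differentiable (at x)" "e \<in> Basis \<Longrightarrow> dird e f differentiable (at x)" by simp_all
  from c show "continuous_on UNIV (dird e f)" if "e \<in> Basis"
    using that Ck_continuous[of "Suc 0" "dird e f"] by simp
qed

lemma laplacian_add:
  assumes "Ck 2 f" "Ck 2 g"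
  shows "laplacian (\<lambda>x. f x + g x) x = laplacian f x + laplacian g x"
proof -
  have "dird e (\<lambda>x. f x + g x) = (\<lambda>x. dird e f x + dird e g x)" for e
    using Ck_2_cases(1)[OF assms(1)] Ck_2_cases(1)[OF assms(2)] by (simp add: fun_eq_iff dird_add)
  then show ?thesis
    using Ck_2_cases(2)[OF assms(1)] Ck_2_cases(2)[OF assms(2)]
    by (simp add: laplacian_def dird_add sum.distrib)
qed

lemma laplacian_cmult:
  assumes "Ck 2 f"
  shows "laplacian (\<lambda>x. c * f x) x = c * laplacian f x"
proof -
  have "dird e (\<lambda>x. c * f x) = (\<lambda>x. c * dird e f x)" for e
    using Ck_2_cases(1)[OF assms(1)] dird_bounded_linear[OF bounded_linear_mult_right]
    by (fastforce simp add: fun_eq_iff)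
  moreover have "dird e (\<lambda>x. c * dird e f x) x = c * dird e (dird e f) x" if "e \<in> Basis" for e
    using Ck_2_cases(2)[OF assms(1) that] by (rule dird_bounded_linear[OF bounded_linear_mult_right])
  ultimately show ?thesis
    by (simp add: laplacian_def sum_distrib_left)
qed

text \<open>The chain rule evaluates the Hessian at the pair (R e, R e). Summed over e, the
  coefficients form the inner product of \<open>R' b\<close> and \<open>R' b'\<close>, which is that
  of b and b'.\<close>

lemma laplacian_orthogonal:
  assumes R: "orthogonal_transformation R" and f: "Ck 2 f"
  shows "laplacian (\<lambda>x. f (R x)) x = laplacian f (R x)"
proof -
  obtain R' where R': "orthogonal_transformation R'" "\<And>x y. R x \<bullet> y = x \<bullet> R' y"
    using orthogonal_transformation_inverse[OF R] by metis
  have lin: "linear R" using R by (rule orthogonal_transformation_linear)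
  note d = Ck_2_cases(1)[OF f] Ck_2_cases(2)[OF f]
  have d1: "dird e (\<lambda>x. f (R x)) = (\<lambda>x. \<Sum>b\<in>Basis. (R e \<bullet> b) * dird b f (R x))" for e
    by (rule ext) (simp add: dird_compose_linear[OF lin d(1)] dird_Basis[OF d(1), of "R e"])
  have "dird e (dird e (\<lambda>x. f (R x))) x
      = (\<Sum>b\<in>Basis. \<Sum>b'\<in>Basis. (R e \<bullet> b) * (R e \<bullet> b') * dird b' (dird b f) (R x))" for e
  proof -
    have "((\<lambda>x. \<Sum>b\<in>Basis. (R e \<bullet> b) * dird b f (R x)) has_derivative
        (\<lambda>v. \<Sum>b\<in>Basis. (R e \<bullet> b) * dird (R v) (dird b f) (R x))) (at x)"
      by (intro has_derivative_sum has_derivative_mult_right has_derivative_compose_linear lin d(2))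
    then have "dird e (dird e (\<lambda>x. f (R x))) x = (\<Sum>b\<in>Basis. (R e \<bullet> b) * dird (R e) (dird b f) (R x))"
      unfolding d1 by (rule dird_has_derivative)
    also have "\<dots> = (\<Sum>b\<in>Basis. (R e \<bullet> b) * (\<Sum>b'\<in>Basis. (R e \<bullet> b') * dird b' (dird b f) (R x)))"
      by (intro sum.cong refl arg_cong2[of _ _ _ _ "(*)"]) (simp add: dird_Basis[OF d(2), of _ "R e"])
    finally show ?thesis by (simp add: sum_distrib_left mult.assoc)
  qed
  then have "laplacian (\<lambda>x. f (R x)) x
      = (\<Sum>e\<in>Basis. \<Sum>b\<in>Basis. \<Sum>b'\<in>Basis. (R e \<bullet> b) * (R e \<bullet> b') * dird b' (dird b f) (R x))"
    by (simp add: laplacian_def)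
  also have "\<dots> = (\<Sum>b\<in>Basis. \<Sum>b'\<in>Basis. \<Sum>e\<in>Basis. (R e \<bullet> b) * (R e \<bullet> b') * dird b' (dird b f) (R x))"
    by (subst sum.swap, rule sum.cong[OF refl], rule sum.swap)
  also have "\<dots> = (\<Sum>b\<in>Basis. \<Sum>b'\<in>Basis. (b \<bullet> b') * dird b' (dird b f) (R x))"
  proof (intro sum.cong refl)
    fix b b' :: "real ^ 3"
    have "(\<Sum>e\<in>Basis. (R e \<bullet> b) * (R e \<bullet> b')) = R' b \<bullet> R' b'"
      by (subst euclidean_inner[of "R' b"]) (simp add: R'(2) inner_commute[of "R' b"] inner_commute[of "R' b'"])
    also have "\<dots> = b \<bullet> b'" using R'(1) by (simp add: orthogonal_transformation_def)
    finally show "(\<Sum>e\<in>Basis. (R e \<bullet> b) * (R e \<bullet> b') * dird b' (dird b f) (R x)) = (b \<bullet> b') * dird b' (dird b f) (R x)"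
      by (simp add: sum_distrib_right[symmetric])
  qed
  also have "\<dots> = laplacian f (R x)"
    unfolding laplacian_def
    by (intro sum.cong refl) (simp add: inner_Basis if_distrib[of "\<lambda>t. t * _"] sum.delta cong: if_cong)
  finally show ?thesis .
qed

text \<open>The kernel depends only on the distance and the measure is invariant, so the identity
  holds even where the integral diverges.\<close>

lemma phi_orthogonal:
  assumes R: "orthogonal_transformation R"
  shows "phi (\<lambda>x. f (R x)) x = phi f (R x)"
proof -
  have "norm (R x - R y) = norm (x - y)" for y
    using R by (metis linear_diff orthogonal_transformation_linear orthogonal_transformation_norm)
  then have "(LINT y|lborel. f (R y) / norm (x - y)) = (LINT y|lborel. f (R y) / norm (R x - R y))"
    by simp
  also have "\<dots> = (LINT y|lborel. f y / norm (R x - y))"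
    by (rule integral_orthogonal[OF R, of "\<lambda>y. f y / norm (R x - y)"])
  finally show ?thesis by (simp add: phi_def)
qed

lemma phi_add:
  assumes "continuous_on UNIV f" "exp_decaying f" "continuous_on UNIV g" "exp_decaying g"
  shows "phi (\<lambda>y. f y + g y) x = phi f x + phi g x"
  using integrable_newton[OF assms(1,2), of x] integrable_newton[OF assms(3,4), of x]
  by (simp add: phi_def add_divide_distrib distrib_left)

lemma phi_cmult: "phi (\<lambda>y. c * f y) x = c * phi f x"
  using integral_mult_right_zero[of lborel c "\<lambda>y. f y / norm (x - y)"] by (simp add: phi_def)

section \<open>Signed combinations of orthogonal maps\<close>

text \<open>The operators \<open>L\<^sub>\<plusminus>\<close> commute with signed combinations of orthogonal transformations, and suitable
  combinations annihilate the spherical harmonics of given degrees.\<close>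

type_synonym rot_comb = "(real \<times> (real ^ 3 \<Rightarrow> real ^ 3)) list"

definition rot_act :: "rot_comb \<Rightarrow> (real ^ 3 \<Rightarrow> real) \<Rightarrow> real ^ 3 \<Rightarrow> real" where
  "rot_act W f y = (\<Sum>(c, R)\<leftarrow>W. c * f (R y))"

definition is_rot_comb :: "rot_comb \<Rightarrow> bool" where
  "is_rot_comb W \<longleftrightarrow> (\<forall>(c, R)\<in>set W. orthogonal_transformation R)"

text \<open>The action is by composition on the right. Hence the map R that is applied first to the
  point comes from V, the combination that acts last on functions.\<close>

definition rot_comp :: "rot_comb \<Rightarrow> rot_comb \<Rightarrow> rot_comb" where
  "rot_comp V W = concat (map (\<lambda>(c, R). map (\<lambda>(d, S). (c * d, \<lambda>y. S (R y))) W) V)"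

lemma rot_act_simps [simp]:
  "rot_act [] f = (\<lambda>y. 0)"
  "rot_act ((c, R) # W) f = (\<lambda>y. c * f (R y) + rot_act W f y)"
  by (simp_all add: rot_act_def fun_eq_iff)

lemma is_rot_comb_simps [simp]:
  "is_rot_comb []"
  "is_rot_comb ((c, R) # W) \<longleftrightarrow> orthogonal_transformation R \<and> is_rot_comb W"
  by (simp_all add: is_rot_comb_def)

lemma rot_act_append: "rot_act (V @ W) f y = rot_act V f y + rot_act W f y"
  by (simp add: rot_act_def)

lemma is_rot_comb_append: "is_rot_comb (V @ W) \<longleftrightarrow> is_rot_comb V \<and> is_rot_comb W"
  by (auto simp: is_rot_comb_def)

lemma rot_act_comp: "rot_act (rot_comp V W) f = rot_act V (rot_act W f)"
proof (rule ext, induction V)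
  case (Cons a V)
  have "rot_act (map (\<lambda>(d, S). (c * d, \<lambda>y. S (R y))) W) f y = c * rot_act W f (R y)" for c R y
    by (induction W) (auto simp: algebra_simps)
  with Cons show ?case
    by (cases a) (simp add: rot_comp_def rot_act_append)
qed (simp add: rot_comp_def)

lemma is_rot_comb_comp:
  assumes "is_rot_comb V" "is_rot_comb W"
  shows "is_rot_comb (rot_comp V W)"
proof -
  have "orthogonal_transformation (\<lambda>y. S (R y))" if "(c, R) \<in> set V" "(d, S) \<in> set W" for c d R S
    using that assms orthogonal_transformation_compose[of S R] by (auto simp: is_rot_comb_def o_def)
  then show ?thesis by (auto simp: is_rot_comb_def rot_comp_def)
qed

lemma rot_act_add: "rot_act W (\<lambda>x. f x + g x) = (\<lambda>y. rot_act W f y + rot_act W g y)"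
  by (induction W) (auto simp: algebra_simps)

lemma rot_act_cmult: "rot_act W (\<lambda>x. a * f x) = (\<lambda>y. a * rot_act W f y)"
  by (induction W) (auto simp: algebra_simps)

lemma rot_act_zero: "rot_act W (\<lambda>x. 0) = (\<lambda>y. 0)"
  by (induction W) auto

text \<open>Serves to pull out the factor Q that accompanies every \<psi>.\<close>

lemma rot_act_radial_mult:
  assumes "is_rot_comb W" "\<And>R x. orthogonal_transformation R \<Longrightarrow> h (R x) = h x"
  shows "rot_act W (\<lambda>x. h x * f x) y = h y * rot_act W f y"
  using assms(1) by (induction W) (auto simp: algebra_simps assms(2))

lemma Ck_rot_act:
  assumes "is_rot_comb W" "Ck k f"
  shows "Ck k (rot_act W f)"
  using assms(1)
proof (induction W)
  case (Cons a W)
  obtain c R where a: "a = (c, R)" by fastforce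
  then have "linear R" using Cons.prems by (simp add: orthogonal_transformation_linear)
  from Ck_compose_linear[OF this assms(2)] have "Ck k (\<lambda>x. c * f (R x))"
    by (rule Ck_bounded_linear[OF bounded_linear_mult_right])
  moreover have "Ck k (rot_act W f)" using Cons a by simp
  ultimately show ?case unfolding a rot_act_simps by (rule Ck_add)
qed (simp add: Ck_const)

lemma exp_decaying_orthogonal:
  assumes "orthogonal_transformation R" "exp_decaying f"
  shows "exp_decaying (\<lambda>x. f (R x))"
proof -
  obtain C c where "c > 0" "\<And>x. norm (f x) \<le> C * exp (- c * norm x)"
    using assms(2) unfolding exp_decaying_def by blast
  moreover from this(2) have "norm (f (R x)) \<le> C * exp (- c * norm x)" for x
    by (subst orthogonal_transformation_norm[OF assms(1), symmetric])
  ultimately show ?thesis unfolding exp_decaying_def by blast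
qed

lemma exp_decaying_rot_act:
  assumes "is_rot_comb W" "exp_decaying f"
  shows "exp_decaying (rot_act W f)"
  using assms(1)
proof (induction W)
  case (Cons a W)
  obtain c R where a: "a = (c, R)" by fastforce
  then have "exp_decaying (\<lambda>x. c * f (R x))"
    using Cons.prems exp_decaying_scaleR[OF exp_decaying_orthogonal[OF _ assms(2)], of R c] by simp
  moreover have "exp_decaying (rot_act W f)" using Cons a by simp
  ultimately show ?case unfolding a rot_act_simps by (rule exp_decaying_add)
qed (simp add: exp_decaying_zero)

section \<open>Legendre polynomials and the Taylor terms of the Newtonian kernel\<close>

text \<open>Homogenized Legendre polynomials, defined by Bonnet's recursion:
  \<open>legendre n s (r\<^sup>2) = r\<^sup>n P\<^sub>n(s / r)\<close>.\<close>

fun legendre :: "nat \<Rightarrow> real \<Rightarrow> real \<Rightarrow> real" where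
  "legendre 0 s q = 1"
| "legendre (Suc 0) s q = s"
| "legendre (Suc (Suc n)) s q =
     ((2 * real n + 3) * s * legendre (Suc n) s q - (real n + 1) * q * legendre n s q) / (real n + 2)"

text \<open>The zonal solid harmonic |\<alpha>|^n |y|^n P_n(cosine of the angle between \<alpha> and
  y), in polynomial form so that y = 0 needs no separate case.\<close>

definition zonal :: "nat \<Rightarrow> real ^ 3 \<Rightarrow> real ^ 3 \<Rightarrow> real" where
  "zonal n \<alpha> y = legendre n (\<alpha> \<bullet> y) ((\<alpha> \<bullet> \<alpha>) * (y \<bullet> y))"

lemma legendre_small:
  "legendre 2 s q = (3 * s\<^sup>2 - q) / 2"
  "legendre 3 s q = (5 * s ^ 3 - 3 * s * q) / 2"
  "legendre 4 s q = (35 * s ^ 4 - 30 * s\<^sup>2 * q + 3 * q\<^sup>2) / 8"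
  "legendre 5 s q = (63 * s ^ 5 - 70 * s ^ 3 * q + 15 * s * q\<^sup>2) / 8"
  by (simp_all add: eval_nat_numeral algebra_simps add_divide_distrib diff_divide_distrib)

lemma legendre_minus: "legendre n (- s) q = (-1) ^ n * legendre n s q"
  by (induction n s q rule: legendre.induct) (simp_all add: algebra_simps)

lemma zonal_minus: "zonal n \<alpha> (- y) = (-1) ^ n * zonal n \<alpha> y"
  by (simp add: zonal_def legendre_minus)

lemma zonal_orthogonal:
  assumes "orthogonal_transformation R"
  shows "zonal n (R \<alpha>) (R y) = zonal n \<alpha> y"
  using assms by (simp add: zonal_def orthogonal_transformation_def)

text \<open>The quotient is the n-th derivative of 1 / |\<alpha> - t \<zeta>| in t, divided by n!.
  Bonnet's recursion gives this by a two-step induction, without a closed form of P_n.\<close>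

lemma zonal_derivative:
  assumes "\<alpha> - t *\<^sub>R \<zeta> \<noteq> 0"
  shows "((\<lambda>t. zonal n (\<alpha> - t *\<^sub>R \<zeta>) \<zeta> / norm (\<alpha> - t *\<^sub>R \<zeta>) ^ (2 * n + 1)) has_real_derivative
      real (Suc n) * (zonal (Suc n) (\<alpha> - t *\<^sub>R \<zeta>) \<zeta> / norm (\<alpha> - t *\<^sub>R \<zeta>) ^ (2 * Suc n + 1))) (at t)"
proof -
  define x where "x = (\<lambda>t. \<alpha> - t *\<^sub>R \<zeta>)"
  define N where "N = (\<lambda>t. norm (x t))"
  define p where "p = (\<lambda>t. x t \<bullet> \<zeta>)"
  define Z where "Z = \<zeta> \<bullet> \<zeta>"
  define G where "G = (\<lambda>n t. zonal n (x t) \<zeta> / N t ^ (2 * n + 1))"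
  have xt: "x t \<noteq> 0" using assms by (simp add: x_def)
  have N0: "N t > 0" using xt by (simp add: N_def)
  have xd: "(x has_vector_derivative - \<zeta>) (at t)"
    unfolding x_def by (auto intro!: derivative_eq_intros)
  have pd: "(p has_real_derivative - Z) (at t)"
    using bounded_linear.has_vector_derivative[OF bounded_linear_inner_left[of \<zeta>] xd]
    by (simp add: has_real_derivative_iff_has_vector_derivative p_def Z_def)
  have N_sqrt: "N = (\<lambda>t. sqrt (\<alpha> \<bullet> \<alpha> - 2 * t * (\<alpha> \<bullet> \<zeta>) + t\<^sup>2 * Z))"
    by (simp add: fun_eq_iff N_def x_def Z_def norm_eq_sqrt_inner inner_diff_left inner_diff_right
        inner_commute power2_eq_square algebra_simps)
  have p_eq: "p t = \<alpha> \<bullet> \<zeta> - t * Z"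
    by (simp add: p_def x_def Z_def inner_diff_left)
  have Nd: "(N has_real_derivative - p t / N t) (at t)"
  proof -
    have pos: "\<alpha> \<bullet> \<alpha> - 2 * t * (\<alpha> \<bullet> \<zeta>) + t\<^sup>2 * Z > 0"
      using N0 by (simp add: N_sqrt)
    have "((\<lambda>t. \<alpha> \<bullet> \<alpha> - 2 * t * (\<alpha> \<bullet> \<zeta>) + t\<^sup>2 * Z) has_real_derivative - 2 * p t) (at t)"
      by (auto intro!: derivative_eq_intros simp: p_eq algebra_simps)
    note DERIV_chain2[OF DERIV_real_sqrt[OF pos] this]
    moreover have "inverse (sqrt (\<alpha> \<bullet> \<alpha> - 2 * t * (\<alpha> \<bullet> \<zeta>) + t\<^sup>2 * Z)) / 2 * (- 2 * p t) = - p t / N t"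
      unfolding N_sqrt by (simp only: divide_inverse) simp
    ultimately show ?thesis
      unfolding N_sqrt[symmetric] by (rule DERIV_cong)
  qed
  have Grec: "G (Suc (Suc n)) u = ((2 * real n + 3) * p u * G (Suc n) u - (real n + 1) * Z * G n u)
      / ((real n + 2) * (N u)\<^sup>2)" if "N u > 0" for n u
  proof -
    have xx: "x u \<bullet> x u = (N u)\<^sup>2" by (simp add: N_def power2_norm_eq_inner)
    define K where "K = N u ^ (2 * n + 1)"
    have K: "K > 0" using that by (simp add: K_def)
    have e: "N u ^ (2 * Suc n + 1) = K * (N u)\<^sup>2" "N u ^ (2 * Suc (Suc n) + 1) = K * (N u)\<^sup>2 * (N u)\<^sup>2"
      by (simp_all add: K_def power_add power2_eq_square)
    have n: "real n + 2 > 0" by simp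
    have pZ: "x u \<bullet> \<zeta> = p u" "\<zeta> \<bullet> \<zeta> = Z" by (simp_all add: p_def Z_def)
    show ?thesis
      unfolding G_def e K_def[symmetric] zonal_def legendre.simps xx pZ
      using that K n by (simp add: divide_simps)
  qed
  have main: "(G n has_real_derivative real (Suc n) * G (Suc n) t) (at t)"
  proof (induction n rule: induct_nat_012)
    case 0
    have "((\<lambda>t. inverse (N t)) has_real_derivative - (inverse (N t) * (- p t / N t) * inverse (N t))) (at t)"
      using N0 by (intro DERIV_inverse'[OF Nd]) simp
    moreover have "- (inverse (N t) * (- p t / N t) * inverse (N t)) = real (Suc 0) * G (Suc 0) t"
      by (simp add: G_def zonal_def p_def divide_inverse power2_eq_square power3_eq_cube numeral_3_eq_3[symmetric])
    moreover have "G 0 = (\<lambda>t. inverse (N t))"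
      by (simp add: G_def zonal_def fun_eq_iff divide_inverse)
    ultimately show ?case by (metis DERIV_cong)
  next
    case 1
    have G1: "G (Suc 0) = (\<lambda>t. p t / N t ^ 3)"
      by (simp add: G_def zonal_def p_def fun_eq_iff power2_eq_square power3_eq_cube)
    have "((\<lambda>t. p t / N t ^ 3) has_real_derivative
        (- Z * N t ^ 3 - p t * (of_nat 3 * (- p t / N t * N t ^ (3 - Suc 0)))) / (N t ^ 3 * N t ^ 3)) (at t)"
      using N0 by (intro DERIV_divide[OF pd DERIV_power[OF Nd]]) simp
    moreover have "(- Z * N t ^ 3 - p t * (of_nat 3 * (- p t / N t * N t ^ (3 - Suc 0)))) / (N t ^ 3 * N t ^ 3)
        = real (Suc (Suc 0)) * G (Suc (Suc 0)) t"
      unfolding Grec[OF N0] using N0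
      by (simp add: G1 G_def zonal_def p_def divide_simps eval_nat_numeral, (simp add: algebra_simps)?)
    ultimately show ?case unfolding G1 by (rule DERIV_cong)
  next
    \<comment> \<open>Bonnet's recursion is differentiated. \<open>e2\<close> rewrites the
      numerator, the only place where \<open>g0\<close> occurs, and \<open>e3\<close> is the
      recursion one index higher.\<close>
    case (ge2 n)
    define D where "D = (\<lambda>u. ((2 * real n + 3) * p u * G (Suc n) u - (real n + 1) * Z * G n u)
      / ((real n + 2) * (N u)\<^sup>2))"
    define a where "a = real n"
    define g0 g1 g2 P M where "g0 = G n t" "g1 = G (Suc n) t" "g2 = G (Suc (Suc n)) t" "P = p t" "M = N t"
    note abbr = a_def g0_g1_g2_P_M_def
    have M: "M > 0" using N0 by (simp add: abbr)
    have a: "a \<ge> 0" by (simp add: a_def)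
    have num: "((\<lambda>u. (2 * real n + 3) * p u * G (Suc n) u - (real n + 1) * Z * G n u) has_real_derivative
        (2 * a + 3) * (- Z) * g1 + ((a + 2) * g2) * ((2 * a + 3) * P) - (a + 1) * Z * ((a + 1) * g1)) (at t)"
      using DERIV_diff[OF DERIV_mult[OF DERIV_cmult[OF pd, of "2 * real n + 3"] ge2(2)]
          DERIV_cmult[OF ge2(1), of "(real n + 1) * Z"]]
      by (simp add: abbr add_ac)
    have den: "((\<lambda>u. (real n + 2) * (N u)\<^sup>2) has_real_derivative (a + 2) * (2 * (- P / M * M))) (at t)"
      using DERIV_cmult[OF DERIV_power[OF Nd, of 2], of "real n + 2"] by (simp add: abbr)
    have den0: "(real n + 2) * (N t)\<^sup>2 \<noteq> 0" using N0 by simp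
    have e2: "(2 * a + 3) * P * g1 - (a + 1) * Z * g0 = g2 * ((a + 2) * M\<^sup>2)"
      using Grec[OF N0, of n] den0 by (simp add: abbr)
    have e3: "G (Suc (Suc (Suc n))) t = ((2 * a + 5) * P * g2 - (a + 2) * Z * g1) / ((a + 3) * M\<^sup>2)"
      using Grec[OF N0, of "Suc n"] by (simp add: abbr algebra_simps)
    have "(D has_real_derivative
       (((2 * a + 3) * (- Z) * g1 + ((a + 2) * g2) * ((2 * a + 3) * P) - (a + 1) * Z * ((a + 1) * g1)) * ((a + 2) * M\<^sup>2)
        - (g2 * ((a + 2) * M\<^sup>2)) * ((a + 2) * (2 * (- P / M * M)))) / (((a + 2) * M\<^sup>2) * ((a + 2) * M\<^sup>2))) (at t)"
      unfolding D_def e2[symmetric] using DERIV_divide[OF num den den0] by (simp add: abbr)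
    moreover have "(((2 * a + 3) * (- Z) * g1 + ((a + 2) * g2) * ((2 * a + 3) * P) - (a + 1) * Z * ((a + 1) * g1)) * ((a + 2) * M\<^sup>2)
        - (g2 * ((a + 2) * M\<^sup>2)) * ((a + 2) * (2 * (- P / M * M)))) / (((a + 2) * M\<^sup>2) * ((a + 2) * M\<^sup>2))
        = (a + 3) * (((2 * a + 5) * P * g2 - (a + 2) * Z * g1) / ((a + 3) * M\<^sup>2))"
      using M a by (simp add: divide_simps, (simp add: algebra_simps power2_eq_square)?)
    moreover have "(a + 3) * (((2 * a + 5) * P * g2 - (a + 2) * Z * g1) / ((a + 3) * M\<^sup>2))
        = real (Suc (Suc (Suc n))) * G (Suc (Suc (Suc n))) t"
      unfolding e3 by (rule arg_cong2[of _ _ _ _ "(*)"]) (simp_all add: a_def)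
    ultimately have "(D has_real_derivative real (Suc (Suc (Suc n))) * G (Suc (Suc (Suc n))) t) (at t)"
      by simp
    \<comment> \<open>The recursion is available only where \<open>N u > 0\<close>, an open set that
      contains t.\<close>
    moreover have "\<forall>\<^sub>F u in nhds t. D u = G (Suc (Suc n)) u"
    proof -
      have "continuous_on UNIV N" unfolding N_def x_def by (intro continuous_intros)
      then have "open {u. N u > 0}"
        by (intro open_Collect_less continuous_intros)
      then have "\<forall>\<^sub>F u in nhds t. N u > 0"
        using N0 eventually_nhds_in_open[of "{u. N u > 0}" t] by simp
      then show ?thesis by eventually_elim (simp add: D_def Grec)
    qed
    ultimately show ?case by (subst (asm) DERIV_cong_ev) auto
  qed
  show ?thesis using main unfolding G_def N_def x_def .
qed

text \<open>Order \<open>Suc n\<close> has degree n in \<zeta>. The iterated derivative is computed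
  on the whole open set where the line avoids the singularity, because each further
  \<open>deriv\<close> needs the previous one near the point.\<close>

lemma F_zonal:
  assumes "\<alpha> \<noteq> 0"
  shows "F (Suc n) \<alpha> \<zeta> = zonal n \<alpha> \<zeta> / norm \<alpha> ^ (2 * n + 1)"
proof -
  define G where "G = (\<lambda>n t. zonal n (\<alpha> - t *\<^sub>R \<zeta>) \<zeta> / norm (\<alpha> - t *\<^sub>R \<zeta>) ^ (2 * n + 1))"
  define U where "U = {t. \<alpha> - t *\<^sub>R \<zeta> \<noteq> 0}"
  have U: "open U"
    unfolding U_def by (intro open_Collect_neq continuous_intros)
  have "(deriv ^^ n) (\<lambda>t. 1 / norm (\<alpha> - t *\<^sub>R \<zeta>)) t = fact n * G n t" if "t \<in> U" for t
    using that
  proof (induction n arbitrary: t)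
    case 0
    then show ?case by (simp add: G_def zonal_def)
  next
    case (Suc n)
    have "\<forall>\<^sub>F u in nhds t. (deriv ^^ n) (\<lambda>t. 1 / norm (\<alpha> - t *\<^sub>R \<zeta>)) u = fact n * G n u"
      using eventually_nhds_in_open[OF U Suc.prems] by eventually_elim (rule Suc.IH)
    then have "deriv ((deriv ^^ n) (\<lambda>t. 1 / norm (\<alpha> - t *\<^sub>R \<zeta>))) t = deriv (\<lambda>u. fact n * G n u) t"
      by (intro deriv_cong_ev refl)
    also have "\<dots> = fact n * (real (Suc n) * G (Suc n) t)"
      using Suc.prems unfolding G_def U_def
      by (intro DERIV_imp_deriv DERIV_cmult zonal_derivative) simp
    finally show ?case by (simp add: mult_ac)
  qed
  moreover have "0 \<in> U" using assms by (simp add: U_def)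
  ultimately show ?thesis by (simp add: F_def G_def)
qed

lemma poly_growth_legendre:
  assumes "poly_growth s" "poly_growth q"
  shows "poly_growth (\<lambda>x. legendre n (s x) (q x))"
proof (induction n rule: induct_nat_012)
  case (ge2 n)
  have "poly_growth (\<lambda>x. ((2 * real n + 3) / (real n + 2)) * (s x * legendre (Suc n) (s x) (q x))
      + (- (real n + 1) / (real n + 2)) * (q x * legendre n (s x) (q x)))"
    by (intro poly_growth_add poly_growth_mult poly_growth_const assms ge2)
  moreover have "legendre (Suc (Suc n)) s q = ((2 * real n + 3) / (real n + 2)) * (s * legendre (Suc n) s q)
      + (- (real n + 1) / (real n + 2)) * (q * legendre n s q)" for s q
    by (simp add: diff_divide_distrib mult.assoc minus_divide_left[symmetric] del: minus_add_distrib)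
  ultimately show ?case by presburger
qed (auto simp: poly_growth_const assms)

lemma poly_growth_zonal:
  "poly_growth (\<lambda>x. zonal n \<alpha> (c *\<^sub>R (a *\<^sub>R x - z)))"
proof -
  have l: "poly_growth (\<lambda>x. v \<bullet> (c *\<^sub>R (a *\<^sub>R x - z)))" for v
  proof -
    have "linear (\<lambda>x. (c * a) * (v \<bullet> x))"
      by (intro linearI) (auto simp: inner_add_right algebra_simps)
    then have "poly_growth (\<lambda>x. (c * a) * (v \<bullet> x) + (- c * (v \<bullet> z)))"
      by (intro poly_growth_add poly_growth_linear poly_growth_const)
    then show ?thesis by (simp add: inner_diff_right algebra_simps)
  qed
  have "poly_growth (\<lambda>x. \<Sum>e\<in>S. (e \<bullet> (c *\<^sub>R (a *\<^sub>R x - z))) * (e \<bullet> (c *\<^sub>R (a *\<^sub>R x - z))))"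
    if "finite S" for S
    using that
  proof (induction S)
    case (insert e S)
    then show ?case
      unfolding sum.insert[OF insert.hyps] by (intro poly_growth_add poly_growth_mult l)
  qed (simp add: poly_growth_const)
  from this[of Basis]
  have q: "poly_growth (\<lambda>x. (c *\<^sub>R (a *\<^sub>R x - z)) \<bullet> (c *\<^sub>R (a *\<^sub>R x - z)))"
    by (subst euclidean_inner) (simp add: inner_commute)
  show ?thesis
    unfolding zonal_def by (intro poly_growth_legendre l poly_growth_mult poly_growth_const q)
qed

section \<open>Combinations of rotations annihilating spherical harmonics\<close>

text \<open>Rodrigues' formula with c and s standing for cosine and sine: only the relation between
  their squares is used, so exact algebraic values can be inserted.\<close>

definition rotation :: "real ^ 3 \<Rightarrow> real \<Rightarrow> real \<Rightarrow> real ^ 3 \<Rightarrow> real ^ 3" where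
  "rotation e c s y = c *\<^sub>R y + s *\<^sub>R cross3 e y + ((1 - c) * (e \<bullet> y)) *\<^sub>R e"

lemma orthogonal_transformation_rotation:
  assumes e: "norm e = 1" and cs: "c\<^sup>2 + s\<^sup>2 = 1"
  shows "orthogonal_transformation (rotation e c s)"
  unfolding orthogonal_transformation
proof (intro conjI allI)
  show "linear (rotation e c s)"
    by (intro linearI) (simp_all add: rotation_def cross_add_right cross_mult_right algebra_simps inner_add_right)
  fix y
  have ee: "e \<bullet> e = 1" using e by (simp add: dot_square_norm)
  have c2: "cross3 e y \<bullet> cross3 e y = y \<bullet> y - (e \<bullet> y)\<^sup>2"
    using norm_cross_dot[of e y] e by (simp add: power2_norm_eq_inner[symmetric])
  have rot: "rotation e c s y \<bullet> rotation e c s y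
      = c\<^sup>2 * (y \<bullet> y) + s\<^sup>2 * (v \<bullet> v) + (1 - c)\<^sup>2 * (e \<bullet> y)\<^sup>2 + 2 * c * (1 - c) * (e \<bullet> y)\<^sup>2"
    if "v = cross3 e y" for v
  proof -
    have v: "e \<bullet> v = 0" "v \<bullet> e = 0" "y \<bullet> v = 0" "v \<bullet> y = 0"
      using that by (simp_all add: dot_cross_self)
    have "rotation e c s y = c *\<^sub>R y + s *\<^sub>R v + ((1 - c) * (e \<bullet> y)) *\<^sub>R e"
      using that by (simp add: rotation_def)
    then show ?thesis
      by (simp only: inner_add_left inner_add_right inner_scaleR_left inner_scaleR_right v ee inner_commute[of y e])
        (simp add: power2_eq_square algebra_simps)
  qed
  have "rotation e c s y \<bullet> rotation e c s y
      = c\<^sup>2 * (y \<bullet> y) + s\<^sup>2 * (y \<bullet> y - (e \<bullet> y)\<^sup>2) + (1 - c)\<^sup>2 * (e \<bullet> y)\<^sup>2 + 2 * c * (1 - c) * (e \<bullet> y)\<^sup>2"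
    using rot[OF refl] by (simp only: c2)
  also have "\<dots> = (c\<^sup>2 + s\<^sup>2) * (y \<bullet> y) + (1 - (c\<^sup>2 + s\<^sup>2)) * (e \<bullet> y)\<^sup>2"
    by (simp add: power2_eq_square algebra_simps)
  also have "\<dots> = y \<bullet> y" by (simp add: cs)
  finally show "norm (rotation e c s y) = norm y" by (simp add: norm_eq)
qed

text \<open>The six rotations by multiples of \<open>\<pi> / 3\<close> about \<open>e\<close>; on polynomials of degree at most 5 their
  average is the average over all rotations about \<open>e\<close>.\<close>

definition axial :: "real ^ 3 \<Rightarrow> rot_comb" where
  "axial e = map (\<lambda>(c, s). (1 / 6, rotation e c s))
     [(1, 0), (-1, 0), (1/2, sqrt 3 / 2), (-1/2, - (sqrt 3 / 2)), (1/2, - (sqrt 3 / 2)), (-1/2, sqrt 3 / 2)]"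

lemma is_rot_comb_axial:
  assumes "norm e = 1"
  shows "is_rot_comb (axial e)"
proof -
  have "(sqrt 3 / 2)\<^sup>2 = 3 / 4" by (simp add: power_divide)
  then show ?thesis
    by (simp add: axial_def power_divide orthogonal_transformation_rotation[OF assms])
qed

text \<open>The six arguments are c z + r cos(t + k pi / 3), with u = r cos t and w = (sqrt 3 / 2) r
  sin t; the last hypothesis fixes r^2. Six equally spaced angles reproduce the means of the powers
  of the cosine up to the fifth, and the mean of P_n factors by the addition theorem.\<close>

lemma legendre_axial_average:
  assumes n: "n \<le> 5" and q: "q = A * Y" and P: "u\<^sup>2 + 4 / 3 * w\<^sup>2 = (A - c\<^sup>2) * (Y - z\<^sup>2)"
  shows "legendre n (c * z + u) q + legendre n (c * z - u) q
       + legendre n (c * z + (u / 2 + w)) q + legendre n (c * z - (u / 2 + w)) q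
       + legendre n (c * z + (u / 2 - w)) q + legendre n (c * z - (u / 2 - w)) q
       = 6 * (legendre n c A * legendre n z Y)"
proof -
  define m where "m = c * z"
  define P where "P = u\<^sup>2 + 4 / 3 * w\<^sup>2"
  have PP: "P = (A - c\<^sup>2) * (Y - z\<^sup>2)" using assms by (simp add: P_def)
  define S where "S = (\<lambda>g :: real \<Rightarrow> real. g (m + u) + g (m - u) + g (m + (u / 2 + w)) + g (m - (u / 2 + w))
       + g (m + (u / 2 - w)) + g (m - (u / 2 - w)))"
  have S1: "S (\<lambda>s. s) = 6 * m" by (simp add: S_def)
  \<comment> \<open>Below, 1/2 and 3/8 are the means of the second and fourth powers of the cosine,
    multiplied by binomial coefficients.\<close>
  have S2: "S (\<lambda>s. s\<^sup>2) = 6 * (m\<^sup>2 + P / 2)"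
    by (simp add: S_def P_def power2_eq_square field_simps)
  have S3: "S (\<lambda>s. s ^ 3) = 6 * (m ^ 3 + 3 * m * P / 2)"
    by (simp add: S_def P_def power2_eq_square power3_eq_cube field_simps)
  have S4: "S (\<lambda>s. s ^ 4) = 6 * (m ^ 4 + 3 * m\<^sup>2 * P + 3 / 8 * P\<^sup>2)"
    by (simp add: S_def P_def eval_nat_numeral field_simps)
  have S5: "S (\<lambda>s. s ^ 5) = 6 * (m ^ 5 + 5 * m ^ 3 * P + 15 / 8 * m * P\<^sup>2)"
    by (simp add: S_def P_def eval_nat_numeral field_simps)
  have lin: "S (\<lambda>s. a * f s + b * g s) = a * S f + b * S g" for a b f g
    by (simp add: S_def algebra_simps)
  have lin3: "S (\<lambda>s. a * f s + b * g s + d * h s) = a * S f + b * S g + d * S h" for a b d f g h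
    by (simp add: S_def algebra_simps)
  have Sc: "S (\<lambda>s. 1) = 6" by (simp add: S_def)
  consider "n = 0" | "n = 1" | "n = 2" | "n = 3" | "n = 4" | "n = 5"
    using n by linarith
  then have "S (\<lambda>s. legendre n s q) = 6 * (legendre n c A * legendre n z Y)"
  proof cases
    case 3
    have "S (\<lambda>s. legendre 2 s q) = S (\<lambda>s. 3 / 2 * s\<^sup>2 + (- q / 2) * 1)"
      by (simp add: legendre_small diff_divide_distrib)
    also have "\<dots> = 6 * (legendre 2 c A * legendre 2 z Y)"
      unfolding lin S2 Sc PP q m_def legendre_small by (simp add: field_simps eval_nat_numeral)
    finally show ?thesis using 3 by simp
  next
    case 4
    have "S (\<lambda>s. legendre 3 s q) = S (\<lambda>s. 5 / 2 * s ^ 3 + (- 3 * q / 2) * s)"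
      by (simp add: legendre_small diff_divide_distrib mult_ac)
    also have "\<dots> = 6 * (legendre 3 c A * legendre 3 z Y)"
      unfolding lin S3 S1 PP q m_def legendre_small by (simp add: field_simps eval_nat_numeral)
    finally show ?thesis using 4 by simp
  next
    case 5
    have "S (\<lambda>s. legendre 4 s q) = S (\<lambda>s. 35 / 8 * s ^ 4 + (- 30 * q / 8) * s\<^sup>2 + (3 * q\<^sup>2 / 8) * 1)"
      by (simp add: legendre_small diff_divide_distrib add_divide_distrib mult_ac)
    also have "\<dots> = 6 * (legendre 4 c A * legendre 4 z Y)"
      unfolding lin3 S4 S2 Sc PP q m_def legendre_small by (simp add: field_simps eval_nat_numeral)
    finally show ?thesis using 5 by simp
  next
    case 6
    have "S (\<lambda>s. legendre 5 s q) = S (\<lambda>s. 63 / 8 * s ^ 5 + (- 70 * q / 8) * s ^ 3 + (15 * q\<^sup>2 / 8) * s)"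
      by (simp add: legendre_small diff_divide_distrib add_divide_distrib mult_ac)
    also have "\<dots> = 6 * (legendre 5 c A * legendre 5 z Y)"
      unfolding lin3 S5 S3 S1 PP q m_def legendre_small by (simp add: field_simps eval_nat_numeral)
    finally show ?thesis using 6 by simp
  qed (simp_all add: Sc S1 m_def)
  then show ?thesis by (simp add: S_def m_def)
qed

text \<open>Project \<alpha> and y to the plane orthogonal to e: the squared inner product plus the
  squared determinant of the projections is the product of their squared lengths.\<close>

lemma gram_cross:
  assumes "norm e = 1"
  shows "(\<alpha> \<bullet> y - (\<alpha> \<bullet> e) * (e \<bullet> y))\<^sup>2 + (\<alpha> \<bullet> cross3 e y)\<^sup>2
    = (\<alpha> \<bullet> \<alpha> - (\<alpha> \<bullet> e)\<^sup>2) * (y \<bullet> y - (e \<bullet> y)\<^sup>2)"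
proof -
  have ee: "e \<bullet> e = 1" using assms by (simp add: dot_square_norm)
  have "(\<alpha> \<bullet> cross3 e y)\<^sup>2 = (e \<bullet> e) * ((\<alpha> \<bullet> \<alpha>) * (y \<bullet> y) - (\<alpha> \<bullet> y)\<^sup>2)
      - (\<alpha> \<bullet> e)\<^sup>2 * (y \<bullet> y) - (\<alpha> \<bullet> \<alpha>) * (e \<bullet> y)\<^sup>2 + 2 * (\<alpha> \<bullet> e) * (\<alpha> \<bullet> y) * (e \<bullet> y)"
    by (simp add: cross3_simps power2_eq_square)
  then show ?thesis unfolding ee by (simp add: power2_eq_square algebra_simps)
qed

text \<open>Averaging about e keeps only what is symmetric about e, and in a given degree this is a
  multiple of the zonal harmonic with axis e. Evaluation at e gives the factor.\<close>

lemma zonal_axial: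
  assumes e: "norm e = 1" and n: "n \<le> 5"
  shows "rot_act (axial e) (zonal n \<alpha>) y = zonal n \<alpha> e * zonal n e y"
proof -
  define u where "u = \<alpha> \<bullet> y - (\<alpha> \<bullet> e) * (e \<bullet> y)"
  define w where "w = sqrt 3 / 2 * (\<alpha> \<bullet> cross3 e y)"
  have ee: "e \<bullet> e = 1" using e by (simp add: dot_square_norm)
  have rr: "rotation e c s y \<bullet> rotation e c s y = y \<bullet> y" if "c\<^sup>2 + s\<^sup>2 = 1" for c s
    using orthogonal_transformation_rotation[OF e that] by (simp add: orthogonal_transformation_def)
  have ar: "\<alpha> \<bullet> rotation e c s y = (\<alpha> \<bullet> e) * (e \<bullet> y) + (c * u + s * (\<alpha> \<bullet> cross3 e y))" for c s
    by (simp add: rotation_def u_def inner_add_right algebra_simps)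
  have z: "zonal n \<alpha> (rotation e c s y)
      = legendre n ((\<alpha> \<bullet> e) * (e \<bullet> y) + (c * u + s * (\<alpha> \<bullet> cross3 e y))) ((\<alpha> \<bullet> \<alpha>) * (y \<bullet> y))"
    if "c\<^sup>2 + s\<^sup>2 = 1" for c s
    by (simp add: zonal_def ar rr[OF that])
  have w2: "4 / 3 * w\<^sup>2 = (\<alpha> \<bullet> cross3 e y)\<^sup>2"
    by (simp add: w_def power_mult_distrib power_divide)
  define m q where "m = (\<alpha> \<bullet> e) * (e \<bullet> y)" and "q = (\<alpha> \<bullet> \<alpha>) * (y \<bullet> y)"
  have r3: "(sqrt 3 / 2)\<^sup>2 = 3 / 4" by (simp add: power_divide)
  have zs: "zonal n \<alpha> (rotation e 1 0 y) = legendre n (m + u) q"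
    "zonal n \<alpha> (rotation e (-1) 0 y) = legendre n (m - u) q"
    "zonal n \<alpha> (rotation e (1/2) (sqrt 3 / 2) y) = legendre n (m + (u / 2 + w)) q"
    "zonal n \<alpha> (rotation e (-1/2) (- (sqrt 3 / 2)) y) = legendre n (m - (u / 2 + w)) q"
    "zonal n \<alpha> (rotation e (1/2) (- (sqrt 3 / 2)) y) = legendre n (m + (u / 2 - w)) q"
    "zonal n \<alpha> (rotation e (-1/2) (sqrt 3 / 2) y) = legendre n (m - (u / 2 - w)) q"
    using z[of 1 0] z[of "-1" 0] z[of "1/2" "sqrt 3 / 2"] z[of "-1/2" "- (sqrt 3 / 2)"]
      z[of "1/2" "- (sqrt 3 / 2)"] z[of "-1/2" "sqrt 3 / 2"]
    by (simp_all add: r3 m_def[symmetric] q_def[symmetric] w_def power2_minus power_divide)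
      (simp_all add: algebra_simps)
  have "rot_act (axial e) (zonal n \<alpha>) y
      = 1 / 6 * (legendre n (m + u) q + legendre n (m - u) q
        + legendre n (m + (u / 2 + w)) q + legendre n (m - (u / 2 + w)) q
        + legendre n (m + (u / 2 - w)) q + legendre n (m - (u / 2 - w)) q)"
    unfolding zs[symmetric] by (simp add: axial_def)
  also have "\<dots> = 1 / 6 * (6 * (legendre n (\<alpha> \<bullet> e) (\<alpha> \<bullet> \<alpha>) * legendre n (e \<bullet> y) (y \<bullet> y)))"
    unfolding m_def q_def
    by (subst legendre_axial_average[OF n refl]) (use gram_cross[OF e, of \<alpha> y] w2 in \<open>simp_all add: u_def\<close>)
  also have "\<dots> = zonal n \<alpha> e * zonal n e y"
    by (simp add: zonal_def ee)
  finally show ?thesis .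
qed

text \<open>\<open>A T A - p A\<close> with \<open>A\<close> the axial average and \<open>T\<close> a tilt of the axis by the angle
  \<open>arccos (3 / 5)\<close>: on harmonics of degree \<open>n\<close> it vanishes for \<open>p = P\<^sub>n(3 / 5)\<close>.\<close>

definition tilted :: "real ^ 3 \<Rightarrow> real ^ 3 \<Rightarrow> real \<Rightarrow> rot_comb" where
  "tilted e f p = rot_comp (axial e) (rot_comp [(1, rotation f (3/5) (4/5))] (axial e))
     @ rot_comp [(- p, \<lambda>y. y)] (axial e)"

lemma is_rot_comb_tilted:
  assumes "norm e = 1" "norm f = 1"
  shows "is_rot_comb (tilted e f p)"
proof -
  have "orthogonal_transformation (rotation f (3/5) (4/5))"
    by (rule orthogonal_transformation_rotation[OF assms(2)]) (simp add: power2_eq_square)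
  then show ?thesis
    unfolding tilted_def is_rot_comb_append
    using is_rot_comb_axial[OF assms(1)] by (intro conjI is_rot_comb_comp) simp_all
qed

text \<open>The first average leaves a multiple of the harmonic with axis e, the tilt moves this
  axis to \<open>T' e\<close>, and the second average contributes P_n of the inner product of e and
  \<open>T' e\<close>, which is 3/5.\<close>

lemma zonal_tilted:
  assumes e: "norm e = 1" "norm f = 1" "e \<bullet> f = 0" and n: "n \<le> 5"
  shows "rot_act (tilted e f p) (zonal n \<alpha>) y = zonal n \<alpha> e * (legendre n (3/5) 1 - p) * zonal n e y"
proof -
  let ?T = "rotation f (3/5) (4/5)"
  have T: "orthogonal_transformation ?T"
    by (rule orthogonal_transformation_rotation[OF e(2)]) (simp add: power2_eq_square)
  obtain T' where T': "orthogonal_transformation T'" "\<And>x. T' (?T x) = x" "\<And>x y. x \<bullet> ?T y = T' x \<bullet> y"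
    using orthogonal_transformation_inverse[OF T] by metis
  have ee: "e \<bullet> e = 1" using e by (simp add: dot_square_norm)
  have "T' e \<bullet> e = e \<bullet> ?T e" by (simp add: T')
  also have "\<dots> = 3 / 5"
    using e(3) by (simp add: rotation_def inner_add_right ee dot_cross_self inner_commute)
  finally have "T' e \<bullet> e = 3 / 5" .
  moreover have "T' e \<bullet> T' e = 1" using T'(1) ee by (simp add: orthogonal_transformation_def)
  ultimately have tilt: "zonal n (T' e) e = legendre n (3/5) 1"
    by (simp only: zonal_def ee mult_1)
  have A: "rot_act (axial e) (zonal n \<alpha>) = (\<lambda>y. zonal n \<alpha> e * zonal n e y)" for \<alpha>
    using zonal_axial[OF e(1) n] by blast
  have "zonal n e (?T y) = zonal n (T' e) y" for y
    using zonal_orthogonal[OF T'(1), of n e "?T y"] T'(2) by simp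
  then have TA: "rot_act (rot_comp [(1, ?T)] (axial e)) (zonal n \<alpha>) = (\<lambda>y. zonal n \<alpha> e * zonal n (T' e) y)"
    by (simp add: rot_act_comp A)
  have "rot_act (rot_comp (axial e) (rot_comp [(1, ?T)] (axial e))) (zonal n \<alpha>) y
      = zonal n \<alpha> e * (legendre n (3/5) 1 * zonal n e y)"
    by (simp add: rot_act_comp[of "axial e" "rot_comp _ _"] TA rot_act_cmult A tilt)
  then show ?thesis
    by (simp add: tilted_def rot_act_append rot_act_comp A algebra_simps)
qed

section \<open>Parity and the two kinds of test combinations\<close>

definition even_fun :: "(real ^ 3 \<Rightarrow> real) \<Rightarrow> bool" where
  "even_fun f \<longleftrightarrow> (\<forall>y. f (- y) = f y)"

definition odd_fun :: "(real ^ 3 \<Rightarrow> real) \<Rightarrow> bool" where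
  "odd_fun f \<longleftrightarrow> (\<forall>y. f (- y) = - f y)"

text \<open>Yields twice the even part for s = 1 and twice the odd part for s = -1.\<close>

definition parity :: "real \<Rightarrow> rot_comb" where
  "parity s = [(1, \<lambda>y. y), (s, uminus)]"

lemma is_rot_comb_parity: "is_rot_comb (parity s)"
  using orthogonal_transformation_neg[of "\<lambda>x. x"] by (simp add: parity_def)

lemma parity_even_odd:
  "odd_fun f \<Longrightarrow> rot_act (parity 1) f = (\<lambda>y. 0)" "even_fun f \<Longrightarrow> rot_act (parity (-1)) f = (\<lambda>y. 0)"
  by (auto simp: parity_def even_fun_def odd_fun_def fun_eq_iff)

lemma parity_zonal: "rot_act (parity s) (zonal n \<alpha>) = (\<lambda>y. (1 + s * (-1) ^ n) * zonal n \<alpha> y)"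
  by (simp add: parity_def fun_eq_iff zonal_minus algebra_simps)

text \<open>Within each parity these values differ from one another and from P_0 = 1 and P_1(3/5) =
  3/5. This keeps the degree to be detected alive while the others are removed.\<close>

lemma legendre_values:
  "legendre 2 (3/5) 1 = 1/25" "legendre 3 (3/5) 1 = -9/25" "legendre 4 (3/5) 1 = -51/125"
  "legendre 5 (3/5) 1 = -477/3125"
  by (simp_all add: legendre_small power_divide)

text \<open>A function annihilated by such a combination is orthogonal to all radial functions.\<close>

definition scalar_test :: "rot_comb \<Rightarrow> bool" where
  "scalar_test W \<longleftrightarrow> is_rot_comb W \<and> (\<Sum>(c, R)\<leftarrow>W. c) \<noteq> 0 \<and>
     (\<forall>f. odd_fun f \<longrightarrow> rot_act W f = (\<lambda>y. 0)) \<and>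
     (\<forall>n\<in>{2, 4}. \<forall>\<alpha>. rot_act W (zonal n \<alpha>) = (\<lambda>y. 0))"

text \<open>A function annihilated by such a combination is orthogonal to \<open>e \<bullet> y\<close> times any radial function.\<close>

definition vector_test :: "real ^ 3 \<Rightarrow> rot_comb \<Rightarrow> bool" where
  "vector_test e W \<longleftrightarrow> is_rot_comb W \<and> (\<exists>k. k \<noteq> 0 \<and> (\<Sum>(c, R)\<leftarrow>W. c *\<^sub>R R e) = k *\<^sub>R e) \<and>
     (\<forall>f. even_fun f \<longrightarrow> rot_act W f = (\<lambda>y. 0)) \<and>
     (\<forall>n\<in>{3, 5}. \<forall>\<alpha>. rot_act W (zonal n \<alpha>) = (\<lambda>y. 0))"

text \<open>Parity acts first, then each tilted combination removes the degree whose Legendre value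
  is its parameter.\<close>

lemma rot_act_tilted_chain:
  assumes e: "norm e = 1" "norm f = 1" "e \<bullet> f = 0" and n: "n \<le> 5"
  shows "rot_act (rot_comp (tilted e f p) (rot_comp (tilted e f q) (parity s))) (zonal n \<alpha>)
    = (\<lambda>y. (1 + s * (-1) ^ n) * (legendre n (3/5) 1 - q) * (legendre n (3/5) 1 - p) * zonal n \<alpha> e * zonal n e e * zonal n e y)"
proof -
  have t: "rot_act (tilted e f q) (zonal n \<alpha>) = (\<lambda>y. (zonal n \<alpha> e * (legendre n (3/5) 1 - q)) * zonal n e y)" for q \<alpha>
    using zonal_tilted[OF e n] by blast
  show ?thesis
    by (simp add: rot_act_comp parity_zonal rot_act_cmult t, simp add: mult_ac)
qed

lemma orthogonal_unit_exists:
  fixes e :: "real ^ 3" assumes "e \<in> Basis"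
  obtains f where "norm f = 1" "e \<bullet> f = 0"
proof -
  have "\<exists>f\<in>(Basis :: (real ^ 3) set). f \<noteq> e"
  proof (rule ccontr)
    assume "\<not> ?thesis"
    then have "(Basis :: (real ^ 3) set) \<subseteq> {e}" by auto
    then have "card (Basis :: (real ^ 3) set) \<le> card {e}" by (intro card_mono) auto
    then show False by simp
  qed
  then obtain f where "f \<in> (Basis :: (real ^ 3) set)" "f \<noteq> e" by blast
  then show thesis using that[of f] assms by (simp add: inner_Basis)
qed

lemma scalar_test_exists: "\<exists>W. scalar_test W"
proof -
  obtain e :: "real ^ 3" where e: "e \<in> Basis" using nonempty_Basis by blast
  obtain f where "norm f = 1" "e \<bullet> f = 0" using orthogonal_unit_exists[OF e] .
  with e have f: "norm e = 1" "norm f = 1" "e \<bullet> f = 0" by simp_all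
  define W where "W = rot_comp (tilted e f (legendre 4 (3/5) 1)) (rot_comp (tilted e f (legendre 2 (3/5) 1)) (parity 1))"
  have 1: "is_rot_comb W"
    unfolding W_def by (intro is_rot_comb_comp is_rot_comb_tilted is_rot_comb_parity f)
  \<comment> \<open>\<open>zonal 0 0\<close> is the constant 1, so its image is the sum of the
    weights.\<close>
  have sum: "(\<Sum>(c, R)\<leftarrow>W. c) = rot_act W (zonal 0 0) 0"
    by (simp add: rot_act_def zonal_def)
  have "rot_act W (zonal 0 0) 0 \<noteq> 0"
    unfolding W_def by (subst rot_act_tilted_chain[OF f]) (simp_all add: legendre_values zonal_def)
  then have 2: "(\<Sum>(c, R)\<leftarrow>W. c) \<noteq> 0" unfolding sum .
  have 3: "rot_act W g = (\<lambda>y. 0)" if "odd_fun g" for g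
    using that by (simp add: W_def rot_act_comp parity_even_odd rot_act_zero)
  have 4: "rot_act W (zonal n \<alpha>) = (\<lambda>y. 0)" if "n \<in> {2, 4}" for n \<alpha>
    using that unfolding W_def by (subst rot_act_tilted_chain[OF f]) auto
  show ?thesis
    unfolding scalar_test_def by (rule exI[of _ W], intro conjI allI impI ballI 1 2 3 4)
qed

lemma vector_test_exists:
  assumes e: "e \<in> Basis"
  shows "\<exists>W. vector_test e W"
proof -
  obtain f where "norm f = 1" "e \<bullet> f = 0" using orthogonal_unit_exists[OF e] .
  with e have f: "norm e = 1" "norm f = 1" "e \<bullet> f = 0" by simp_all
  define W where "W = rot_comp (tilted e f (legendre 5 (3/5) 1)) (rot_comp (tilted e f (legendre 3 (3/5) 1)) (parity (-1)))"
  have 1: "is_rot_comb W"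
    unfolding W_def by (intro is_rot_comb_comp is_rot_comb_tilted is_rot_comb_parity f)
  have 2: "\<exists>k. k \<noteq> 0 \<and> (\<Sum>(c, R)\<leftarrow>W. c *\<^sub>R R e) = k *\<^sub>R e"
  proof -
    \<comment> \<open>The eigenvalue on linear functions: 2 comes from the parity, and P_1(3/5) =
      3/5 enters both tilted factors.\<close>
    define k where "k = 2 * (3/5 - legendre 3 (3/5) 1) * (3/5 - legendre 5 (3/5) 1)"
    have ee: "e \<bullet> e = 1" using e by simp
    have "v \<bullet> (\<Sum>(c, R)\<leftarrow>W. c *\<^sub>R R e) = v \<bullet> (k *\<^sub>R e)" for v
    proof -
      have "v \<bullet> (\<Sum>(c, R)\<leftarrow>W'. c *\<^sub>R R e) = rot_act W' (zonal 1 v) e" for W'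
        by (induction W') (auto simp: zonal_def inner_add_right)
      then have "v \<bullet> (\<Sum>(c, R)\<leftarrow>W. c *\<^sub>R R e) = rot_act W (zonal 1 v) e" .
      also have "\<dots> = v \<bullet> (k *\<^sub>R e)"
        unfolding W_def by (subst rot_act_tilted_chain[OF f]) (simp_all add: zonal_def ee k_def)
      finally show ?thesis .
    qed
    then have "(\<Sum>(c, R)\<leftarrow>W. c *\<^sub>R R e) = k *\<^sub>R e" using vector_eq_ldot by blast
    moreover have "k \<noteq> 0" by (simp add: k_def legendre_values)
    ultimately show ?thesis by blast
  qed
  have 3: "rot_act W g = (\<lambda>y. 0)" if "even_fun g" for g
    using that by (simp add: W_def rot_act_comp parity_even_odd rot_act_zero)
  have 4: "rot_act W (zonal n \<alpha>) = (\<lambda>y. 0)" if "n \<in> {3, 5}" for n \<alpha>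
    using that unfolding W_def by (subst rot_act_tilted_chain[OF f]) auto
  show ?thesis
    unfolding vector_test_def by (rule exI[of _ W], intro conjI allI impI ballI 1 2 3 4)
qed

section \<open>The linearized operators\<close>

lemma integrable_L2_mult:
  fixes f g :: "real ^ 3 \<Rightarrow> real"
  assumes "continuous_on UNIV f" "continuous_on UNIV g"
    "integrable lborel (\<lambda>x. (f x)\<^sup>2)" "integrable lborel (\<lambda>x. (g x)\<^sup>2)"
  shows "integrable lborel (\<lambda>x. f x * g x)"
proof (rule Bochner_Integration.integrable_bound)
  show "integrable lborel (\<lambda>x. (f x)\<^sup>2 + (g x)\<^sup>2)"
    using assms by simp
  have "continuous_on UNIV (\<lambda>x. f x * g x)" using assms by (intro continuous_intros)
  then show "(\<lambda>x. f x * g x) \<in> borel_measurable lborel"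
    using borel_measurable_continuous_onI by auto
  show "AE x in lborel. norm (f x * g x) \<le> norm ((f x)\<^sup>2 + (g x)\<^sup>2)"
  proof (rule AE_I2)
    fix x
    have "0 \<le> (\<bar>f x\<bar> - \<bar>g x\<bar>)\<^sup>2" by simp
    then have "2 * (\<bar>f x\<bar> * \<bar>g x\<bar>) \<le> (f x)\<^sup>2 + (g x)\<^sup>2" by (simp add: power2_diff)
    moreover have "0 \<le> \<bar>f x\<bar> * \<bar>g x\<bar>" by simp
    ultimately have "\<bar>f x\<bar> * \<bar>g x\<bar> \<le> (f x)\<^sup>2 + (g x)\<^sup>2" by linarith
    then show "norm (f x * g x) \<le> norm ((f x)\<^sup>2 + (g x)\<^sup>2)" by (simp add: abs_mult)
  qed
qed

lemma poly_growth_inner: "poly_growth (\<lambda>y. y \<bullet> e)"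
  by (intro poly_growth_linear linearI) (simp_all add: inner_add_left)

lemma exp_decaying_inner_mult:
  assumes "exp_decaying f"
  shows "exp_decaying (\<lambda>y. (y \<bullet> e) * f y)"
  using exp_decaying_poly_growth_mult[OF assms poly_growth_inner] by simp

lemma integral_pos_continuous:
  fixes f :: "real ^ 3 \<Rightarrow> real"
  assumes "integrable lborel f" "\<And>x. f x > 0"
  shows "(LINT x|lborel. f x) > 0"
proof -
  have "(LINT x|lborel. f x) \<noteq> 0"
  proof
    assume "(LINT x|lborel. f x) = 0"
    then have "AE x in lborel. f x = 0"
      using integral_nonneg_eq_0_iff_AE[OF assms(1)] assms(2) less_imp_le by blast
    then have "AE x in (lborel :: (real ^ 3) measure). False"
      by eventually_elim (use assms(2) less_irrefl in metis)
    then show False by (simp add: eventually_False ae_filter_eq_bot_iff)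
  qed
  moreover have "(LINT x|lborel. f x) \<ge> 0"
    by (rule integral_nonneg_AE) (use assms(2) less_imp_le in blast)
  ultimately show ?thesis by simp
qed

locale ground_state_kernels =
  fixes Q :: "real ^ 3 \<Rightarrow> real"
  assumes ground: "ground_state Q"
    and ker_plus: "kernel_L2 (Lplus Q) = {\<lambda>x. \<Sum>i\<in>UNIV. c i * dird (axis i 1) Q x | c :: 3 \<Rightarrow> real. True}"
    and ker_minus: "kernel_L2 (Lminus Q) = {\<lambda>x. c * Q x | c :: real. True}"
begin

lemma Q_Ck: "Ck 2 Q" and Q_exp: "exp_decaying Q" and Q_pos: "Q x > 0"
  and Q_radial: "norm x = norm y \<Longrightarrow> Q x = Q y"
  using ground unfolding ground_state_def by blast+

lemma Q_cont: "continuous_on UNIV Q"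
  by (rule Ck_continuous[OF Q_Ck])

lemma Q_orthogonal: "orthogonal_transformation R \<Longrightarrow> Q (R x) = Q x"
  by (intro Q_radial orthogonal_transformation_norm)

lemma Q_minus: "Q (- x) = Q x"
  by (intro Q_radial) simp

lemmas Q_diff = Ck_2_cases(1)[OF Q_Ck] and dQ_cont = Ck_2_cases(3)[OF Q_Ck]

definition mass :: real where "mass = (LINT x|lborel. Q x * Q x)"

lemma QQ_integrable: "integrable lborel (\<lambda>x. Q x * Q x)"
  by (intro integrable_exp_decaying exp_decaying_mult Q_exp continuous_intros Q_cont)

lemma mass_pos: "mass > 0"
  unfolding mass_def by (intro integral_pos_continuous QQ_integrable mult_pos_pos Q_pos)

lemma L2norm_Q: "(L2norm Q)\<^sup>2 = mass"
  by (simp add: L2norm_def mass_def power2_eq_square real_sqrt_pow2)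

text \<open>\<open>ground_state\<close> bounds Q but not its derivatives. Square integrability comes
  from the membership of each partial derivative in \<open>kernel_L2 (Lplus Q)\<close>.\<close>

lemma dQ_L2:
  assumes "e \<in> Basis"
  shows "integrable lborel (\<lambda>x. (dird e Q x)\<^sup>2)"
proof -
  obtain i where i: "e = axis i 1" using assms by (auto simp: Basis_vec_def)
  have "(\<lambda>x. \<Sum>k\<in>UNIV. (if k = i then 1 else 0) * dird (axis k 1) Q x) \<in> kernel_L2 (Lplus Q)"
    unfolding ker_plus mem_Collect_eq by (rule exI[of _ "\<lambda>k. if k = i then 1 else 0"]) simp
  moreover have "(\<lambda>x. \<Sum>k\<in>UNIV. (if k = i then 1 else 0) * dird (axis k 1) Q x) = dird e Q"
    by (simp add: i fun_eq_iff if_distrib[of "\<lambda>t. t * _"] cong: if_cong)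
  ultimately show ?thesis by (simp add: kernel_L2_def)
qed

lemma integrable_mult_dQ:
  assumes "continuous_on UNIV f" "exp_decaying f" "e \<in> Basis"
  shows "integrable lborel (\<lambda>x. f x * dird e Q x)"
proof (rule integrable_L2_mult[OF assms(1) dQ_cont[OF assms(3)] _ dQ_L2[OF assms(3)]])
  show "integrable lborel (\<lambda>x. (f x)\<^sup>2)"
    unfolding power2_eq_square
    by (intro integrable_exp_decaying exp_decaying_mult assms continuous_intros)
qed

text \<open>The derivative of (v . x) Q^2 integrates to 0. The outcome is a nondegenerate pairing
  between x Q and the gradient of Q: it determines b, and it makes the normalization exclude the
  kernel of \<open>Lplus\<close>.\<close>

lemma moment_dQ:
  assumes e: "e \<in> Basis"
  shows "integrable lborel (\<lambda>x. ((v \<bullet> x) * Q x) * dird e Q x)"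
    "(LINT x|lborel. ((v \<bullet> x) * Q x) * dird e Q x) = - (v \<bullet> e) / 2 * mass"
proof -
  have vc: "continuous_on UNIV (\<lambda>x. (v \<bullet> x) * Q x)" by (intro continuous_intros Q_cont)
  have vd: "exp_decaying (\<lambda>x. (v \<bullet> x) * Q x)"
    using exp_decaying_inner_mult[OF Q_exp, of v] by (simp add: inner_commute)
  show i1: "integrable lborel (\<lambda>x. ((v \<bullet> x) * Q x) * dird e Q x)"
    by (rule integrable_mult_dQ[OF vc vd e])
  define f where "f = (\<lambda>x. (v \<bullet> x) * Q x * Q x)"
  have fd: "(f has_derivative (\<lambda>w. (v \<bullet> w) * (Q x * Q x) + 2 * ((v \<bullet> x) * Q x * dird w Q x))) (at x)" for x
    unfolding f_def
    by (rule derivative_eq_intros differentiable_has_dird[OF Q_diff] refl)+ (auto simp: fun_eq_iff algebra_simps)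
  have df: "dird e f = (\<lambda>x. (v \<bullet> e) * (Q x * Q x) + 2 * ((v \<bullet> x) * Q x * dird e Q x))"
    using dird_has_derivative[OF fd] by blast
  have "(LINT x|lborel. dird e f x) = 0"
  proof (rule integral_dird_eq_0)
    show "f differentiable (at x)" for x using fd unfolding differentiable_def by blast
    show "continuous_on UNIV (dird e f)"
      unfolding df by (intro continuous_intros Q_cont dQ_cont e)
    show "integrable lborel f"
      unfolding f_def by (intro integrable_exp_decaying exp_decaying_mult vd Q_exp continuous_intros Q_cont)
    show "integrable lborel (dird e f)"
      unfolding df by (intro Bochner_Integration.integrable_add integrable_mult_right QQ_integrable i1)
  qed
  moreover have "(LINT x|lborel. dird e f x) = (v \<bullet> e) * mass + 2 * (LINT x|lborel. ((v \<bullet> x) * Q x) * dird e Q x)"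
    unfolding df using QQ_integrable i1 by (simp add: mass_def)
  ultimately show "(LINT x|lborel. ((v \<bullet> x) * Q x) * dird e Q x) = - (v \<bullet> e) / 2 * mass"
    by simp
qed

lemma dQ_orthogonal:
  assumes "orthogonal_transformation R"
  shows "dird (R v) Q (R x) = dird v Q x"
proof -
  have "dird v (\<lambda>x. Q (R x)) x = dird (R v) Q (R x)"
    using assms by (intro dird_compose_linear orthogonal_transformation_linear Q_diff)
  then show ?thesis by (simp add: Q_orthogonal[OF assms])
qed

lemma Lam_Q: "Lam Q x = 2 * Q x + (\<Sum>e\<in>Basis. (e \<bullet> x) * dird e Q x)"
  using dird_Basis[OF Q_diff, of x x] by (simp add: Lam_def inner_commute)

lemma Lam_Q_orthogonal:
  assumes "orthogonal_transformation R"
  shows "Lam Q (R x) = Lam Q x"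
  using dQ_orthogonal[OF assms, of x x] Q_orthogonal[OF assms] by (simp add: Lam_def)

text \<open>No decay of x . \<nabla>Q is at hand; the coordinate weights are moved onto f, which
  leaves products with the square integrable gradient.\<close>

lemma integrable_mult_Lam_Q:
  assumes "continuous_on UNIV f" "exp_decaying f"
  shows "integrable lborel (\<lambda>x. f x * Lam Q x)"
proof -
  have "integrable lborel (\<lambda>x. ((x \<bullet> e) * f x) * dird e Q x)" if "e \<in> Basis" for e
    by (intro integrable_mult_dQ exp_decaying_inner_mult assms continuous_intros that)
  moreover have "integrable lborel (\<lambda>x. f x * Q x)"
    by (intro integrable_exp_decaying exp_decaying_mult assms Q_exp continuous_intros Q_cont)
  ultimately have "integrable lborel (\<lambda>x. 2 * (f x * Q x) + (\<Sum>e\<in>Basis. ((x \<bullet> e) * f x) * dird e Q x))"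
    by (intro Bochner_Integration.integrable_add integrable_mult_right Bochner_Integration.integrable_sum)
  then show ?thesis
    by (simp add: Lam_Q algebra_simps sum_distrib_left inner_commute)
qed

text \<open>Each of the three coordinates contributes - mass / 2 to the term 2 mass. What matters is
  that the result is nonzero: it determines \<open>\<mu>\<close> and makes the normalization exclude
  the kernel of \<open>Lminus\<close>.\<close>

lemma Q_Lam_Q: "(LINT x|lborel. Q x * Lam Q x) = mass / 2"
proof -
  have "(\<lambda>x. Q x * Lam Q x) = (\<lambda>x. 2 * (Q x * Q x) + (\<Sum>e\<in>Basis. ((e \<bullet> x) * Q x) * dird e Q x))"
    by (simp add: fun_eq_iff Lam_Q algebra_simps sum_distrib_left)
  then have "(LINT x|lborel. Q x * Lam Q x)
      = 2 * mass + (\<Sum>e\<in>(Basis :: (real ^ 3) set). LINT x|lborel. ((e \<bullet> x) * Q x) * dird e Q x)"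
    using moment_dQ(1) QQ_integrable by (simp add: mass_def)
  also have "\<dots> = 2 * mass + (\<Sum>e\<in>(Basis :: (real ^ 3) set). - 1 / 2 * mass)"
    by (intro arg_cong2[of _ _ _ _ "(+)"] refl sum.cong) (simp add: moment_dQ(2))
  also have "\<dots> = mass / 2" by simp
  finally show ?thesis .
qed

lemma Q_mult_cont_exp:
  assumes "Ck 2 f" "exp_decaying f"
  shows "continuous_on UNIV (\<lambda>y. Q y * f y)" "exp_decaying (\<lambda>y. Q y * f y)"
  using assms by (auto intro!: continuous_intros Q_cont Ck_continuous[OF assms(1)] exp_decaying_mult Q_exp)

lemma Ck_cmult: "Ck k f \<Longrightarrow> Ck k (\<lambda>x. c * f x :: real)"
  by (rule Ck_bounded_linear[OF bounded_linear_mult_right])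

lemma exp_decaying_cmult: "exp_decaying f \<Longrightarrow> exp_decaying (\<lambda>x. c * f x :: real)"
  using exp_decaying_scaleR[of f c] by simp

text \<open>Decay makes the nonlocal term additive. The potential in \<open>Lminus\<close> involves
  Q alone, so there smoothness is enough.\<close>

lemma Lplus_lin:
  assumes "Ck 2 f" "exp_decaying f" "Ck 2 g" "exp_decaying g"
  shows "Lplus Q (\<lambda>x. c * f x + g x) y = c * Lplus Q f y + Lplus Q g y"
proof -
  have "phi (\<lambda>y. Q y * (c * f y + g y)) y = phi (\<lambda>y. (c * (Q y * f y)) + Q y * g y) y"
    by (simp add: algebra_simps)
  also have "\<dots> = phi (\<lambda>y. c * (Q y * f y)) y + phi (\<lambda>y. Q y * g y) y"
    by (intro phi_add Q_mult_cont_exp assms continuous_on_mult_left exp_decaying_cmult)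
  finally have "phi (\<lambda>y. Q y * (c * f y + g y)) y = c * phi (\<lambda>y. Q y * f y) y + phi (\<lambda>y. Q y * g y) y"
    by (simp add: phi_cmult)
  then show ?thesis
    using laplacian_add[OF Ck_cmult[OF assms(1)] assms(3), of c y] laplacian_cmult[OF assms(1), of c y]
    by (simp add: Lplus_def algebra_simps)
qed

lemma Lminus_lin:
  assumes "Ck 2 f" "Ck 2 g"
  shows "Lminus Q (\<lambda>x. c * f x + g x) y = c * Lminus Q f y + Lminus Q g y"
  using laplacian_add[OF Ck_cmult[OF assms(1)] assms(2), of c y] laplacian_cmult[OF assms(1), of c y]
  by (simp add: Lminus_def algebra_simps)

lemma L_orthogonal:
  assumes R: "orthogonal_transformation R" and f: "Ck 2 f"
  shows "Lplus Q (\<lambda>x. f (R x)) y = Lplus Q f (R y)" "Lminus Q (\<lambda>x. f (R x)) y = Lminus Q f (R y)"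
proof -
  have 1: "phi (\<lambda>y. (Q y)\<^sup>2) y = phi (\<lambda>y. (Q y)\<^sup>2) (R y)"
    using phi_orthogonal[OF R, of "\<lambda>y. (Q y)\<^sup>2" y] by (simp add: Q_orthogonal[OF R])
  have 2: "phi (\<lambda>y. Q y * f (R y)) y = phi (\<lambda>y. Q y * f y) (R y)"
    using phi_orthogonal[OF R, of "\<lambda>y. Q y * f y" y] by (simp add: Q_orthogonal[OF R])
  show "Lplus Q (\<lambda>x. f (R x)) y = Lplus Q f (R y)" "Lminus Q (\<lambda>x. f (R x)) y = Lminus Q f (R y)"
    unfolding Lplus_def Lminus_def laplacian_orthogonal[OF R f] 2
    by (simp_all only: Q_orthogonal[OF R] 1)
qed

lemma L_zero: "Lplus Q (\<lambda>x. 0) y = 0" "Lminus Q (\<lambda>x. 0) y = 0"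
  by (simp_all add: Lplus_def Lminus_def phi_def laplacian_def dird_const[abs_def] dird_const)

lemma L_rot_act:
  assumes W: "is_rot_comb W" and f: "Ck 2 f" "exp_decaying f"
  shows "Lplus Q (rot_act W f) y = rot_act W (Lplus Q f) y"
    and "Lminus Q (rot_act W f) y = rot_act W (Lminus Q f) y"
proof -
  have "Lplus Q (rot_act W f) y = rot_act W (Lplus Q f) y \<and> Lminus Q (rot_act W f) y = rot_act W (Lminus Q f) y"
    using W
  proof (induction W)
    case (Cons a W)
    obtain c R where a: "a = (c, R)" by fastforce
    have R: "orthogonal_transformation R" and W: "is_rot_comb W" using Cons.prems a by simp_all
    have fR: "Ck 2 (\<lambda>x. f (R x))" "exp_decaying (\<lambda>x. f (R x))"
      using Ck_compose_linear[OF orthogonal_transformation_linear[OF R] f(1)]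
        exp_decaying_orthogonal[OF R f(2)] by auto
    note WW = Ck_rot_act[OF W f(1)] exp_decaying_rot_act[OF W f(2)]
    show ?case
      unfolding a rot_act_simps Lplus_lin[OF fR WW] Lminus_lin[OF fR(1) WW(1)] L_orthogonal[OF R f(1)]
      using Cons.IH[OF W] by simp
  qed (simp add: L_zero)
  then show "Lplus Q (rot_act W f) y = rot_act W (Lplus Q f) y"
    and "Lminus Q (rot_act W f) y = rot_act W (Lminus Q f) y" by auto
qed

lemma mem_kernel_L2:
  assumes "Ck 2 f" "exp_decaying f" "\<And>y. A f y = 0"
  shows "f \<in> kernel_L2 A"
proof -
  have "integrable lborel (\<lambda>x. (f x)\<^sup>2)"
    unfolding power2_eq_square
    by (intro integrable_exp_decaying exp_decaying_mult assms(2) continuous_intros Ck_continuous[OF assms(1)])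
  then show ?thesis using assms by (simp add: kernel_L2_def)
qed

text \<open>A kernel element is a combination of derivatives of Q, and by \<open>moment_dQ\<close>
  its moments against x Q are its coefficients times - mass / 2.\<close>

lemma Lplus_unique:
  assumes f: "Ck 2 f" "exp_decaying f" and L: "\<And>y. Lplus Q f y = 0"
    and o: "\<And>e. e \<in> Basis \<Longrightarrow> (LINT y|lborel. f y * ((y \<bullet> e) * Q y)) = 0"
  shows "f = (\<lambda>y. 0)"
proof -
  have "f \<in> kernel_L2 (Lplus Q)" by (rule mem_kernel_L2[of f "Lplus Q", OF f L])
  then obtain c :: "3 \<Rightarrow> real" where c: "f = (\<lambda>x. \<Sum>i\<in>UNIV. c i * dird (axis i 1) Q x)"
    unfolding ker_plus by blast
  have "c k = 0" for k
  proof -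
    have B: "axis i 1 \<in> (Basis :: (real ^ 3) set)" for i by simp
    have "(\<lambda>y. f y * ((y \<bullet> axis k 1) * Q y))
        = (\<lambda>y. \<Sum>i\<in>UNIV. c i * (((axis k 1 \<bullet> y) * Q y) * dird (axis i 1) Q y))"
      by (simp add: c fun_eq_iff sum_distrib_left sum_distrib_right mult_ac inner_commute)
    then have "(LINT y|lborel. f y * ((y \<bullet> axis k 1) * Q y))
        = (\<Sum>i\<in>UNIV. c i * (LINT y|lborel. ((axis k 1 \<bullet> y) * Q y) * dird (axis i 1) Q y))"
      using moment_dQ(1)[OF B] by simp
    also have "\<dots> = (\<Sum>i\<in>UNIV. c i * (- (axis k 1 \<bullet> (axis i 1 :: real ^ 3)) / 2 * mass))"
      by (simp only: moment_dQ(2)[OF B])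
    also have "\<dots> = (\<Sum>i\<in>UNIV. if i = k then c i * (- mass / 2) else 0)"
      by (intro sum.cong refl) (simp add: inner_axis_axis)
    also have "\<dots> = - c k * mass / 2" by simp
    finally show ?thesis using o[OF B, of k] mass_pos by simp
  qed
  then show ?thesis by (simp add: c)
qed

lemma Lminus_unique:
  assumes f: "Ck 2 f" "exp_decaying f" and L: "\<And>y. Lminus Q f y = 0"
    and o: "(LINT y|lborel. f y * Lam Q y) = 0"
  shows "f = (\<lambda>y. 0)"
proof -
  have "f \<in> kernel_L2 (Lminus Q)" by (rule mem_kernel_L2[of f "Lminus Q", OF f L])
  then obtain c :: real where c: "f = (\<lambda>x. c * Q x)"
    unfolding ker_minus by blast
  have "(LINT y|lborel. f y * Lam Q y) = c * (mass / 2)"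
    by (simp add: c mult.assoc Q_Lam_Q)
  then show ?thesis using o mass_pos c by simp
qed

section \<open>From annihilated sources to annihilated solutions and vanishing pairings\<close>

text \<open>Substitution moves each rotation from f to the weight. So \<open>h R\<close> is g
  composed with the inverse of R, a condition phrased without naming the inverse.\<close>

lemma integral_rot_act:
  assumes W: "is_rot_comb W"
    and h: "\<And>c R. (c, R) \<in> set W \<Longrightarrow> integrable lborel (\<lambda>y. f y * h R y) \<and> (\<forall>y. h R (R y) = g y)"
  shows "(LINT y|lborel. rot_act W f y * g y) = (\<Sum>(c, R)\<leftarrow>W. c * (LINT y|lborel. f y * h R y))
    \<and> integrable lborel (\<lambda>y. rot_act W f y * g y)"
  using W h
proof (induction W)
  case (Cons a W)
  obtain c R where a: "a = (c, R)" by fastforce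
  have R: "orthogonal_transformation R" and W: "is_rot_comb W" using Cons.prems(1) a by simp_all
  have hR: "integrable lborel (\<lambda>y. f y * h R y)" "\<And>y. h R (R y) = g y"
    using Cons.prems(2) a by auto
  have IH: "(LINT y|lborel. rot_act W f y * g y) = (\<Sum>(c, R)\<leftarrow>W. c * (LINT y|lborel. f y * h R y))"
    "integrable lborel (\<lambda>y. rot_act W f y * g y)"
    using Cons.IH[OF W] Cons.prems(2) by auto
  have "integrable lborel (\<lambda>y. f (R y) * g y)" "(LINT y|lborel. f (R y) * g y) = (LINT y|lborel. f y * h R y)"
    using integrable_orthogonal_iff[OF R, of "\<lambda>y. f y * h R y"] integral_orthogonal[OF R, of "\<lambda>y. f y * h R y"] hR
    by simp_all
  with IH show ?case by (simp add: a distrib_right mult.assoc)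
qed simp

lemma sum_list_zero: "(\<And>c R. (c, R) \<in> set W \<Longrightarrow> h c R = 0) \<Longrightarrow> (\<Sum>(c, R)\<leftarrow>W. h c R) = (0::real)"
  by (induction W) auto

text \<open>The combined function solves the homogeneous equation, and its moments against x Q are
  moments of f in rotated directions, which the normalization makes zero as well.\<close>

lemma Lplus_annihilated:
  assumes W: "is_rot_comb W" and f: "Ck 2 f" "exp_decaying f" and L: "rot_act W (Lplus Q f) = (\<lambda>y. 0)"
    and o: "\<And>e. e \<in> Basis \<Longrightarrow> orth f (\<lambda>y. (y \<bullet> e) * Q y)"
  shows "rot_act W f = (\<lambda>y. 0)"
proof (rule Lplus_unique[OF Ck_rot_act[OF W f(1)] exp_decaying_rot_act[OF W f(2)]])
  show "Lplus Q (rot_act W f) y = 0" for y by (simp add: L_rot_act[OF W f] L)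
next
  fix e :: "real ^ 3" assume e: "e \<in> Basis"
  have int: "integrable lborel (\<lambda>y. f y * ((y \<bullet> b) * Q y))" for b
    by (intro integrable_exp_decaying exp_decaying_mult exp_decaying_inner_mult f Q_exp
        continuous_intros Q_cont Ck_continuous[OF f(1)])
  have zero: "(LINT y|lborel. f y * ((y \<bullet> v) * Q y)) = 0" for v
  proof -
    have "(\<lambda>y. f y * ((y \<bullet> v) * Q y)) = (\<lambda>y. \<Sum>b\<in>Basis. (v \<bullet> b) * (f y * ((y \<bullet> b) * Q y)))"
      by (simp add: fun_eq_iff euclidean_inner[of _ v] sum_distrib_left sum_distrib_right mult_ac)
    moreover have "(LINT y|lborel. f y * ((y \<bullet> b) * Q y)) = 0" if "b \<in> Basis" for b
      using o[OF that] by (simp add: orth_def ip_def)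
    ultimately show ?thesis using int by simp
  qed
  have "(LINT y|lborel. rot_act W f y * ((y \<bullet> e) * Q y)) = (\<Sum>(c, R)\<leftarrow>W. c * (LINT y|lborel. f y * ((y \<bullet> R e) * Q y)))"
    using integral_rot_act[OF W, of f "\<lambda>R y. (y \<bullet> R e) * Q y" "\<lambda>y. (y \<bullet> e) * Q y"] int W Q_orthogonal
    by (fastforce simp: is_rot_comb_def orthogonal_transformation_def)
  then show "(LINT y|lborel. rot_act W f y * ((y \<bullet> e) * Q y)) = 0"
    by (simp add: zero sum_list_zero)
qed

text \<open>Here the single weight \<open>Lam Q\<close> is rotation invariant, so the normalization
  passes to the combination at once.\<close>

lemma Lminus_annihilated:
  assumes W: "is_rot_comb W" and f: "Ck 2 f" "exp_decaying f" and L: "rot_act W (Lminus Q f) = (\<lambda>y. 0)"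
    and o: "orth f (Lam Q)"
  shows "rot_act W f = (\<lambda>y. 0)"
proof (rule Lminus_unique[OF Ck_rot_act[OF W f(1)] exp_decaying_rot_act[OF W f(2)]])
  show "Lminus Q (rot_act W f) y = 0" for y by (simp add: L_rot_act[OF W f] L)
  have "(LINT y|lborel. rot_act W f y * Lam Q y) = (\<Sum>(c, R)\<leftarrow>W. c * (LINT y|lborel. f y * Lam Q y))"
    using integral_rot_act[OF W, of f "\<lambda>R. Lam Q" "Lam Q"] W Lam_Q_orthogonal o
    by (fastforce simp: is_rot_comb_def orth_def)
  then show "(LINT y|lborel. rot_act W f y * Lam Q y) = 0"
    using o by (simp add: orth_def ip_def sum_list_zero)
qed

text \<open>Q is radial, so all rotated copies of f have the same pairing with it and the sum of the
  weights, nonzero for a test, factors out.\<close>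

lemma scalar_test_integral:
  assumes W: "scalar_test W" and f: "rot_act W f = (\<lambda>y. 0)" and int: "integrable lborel (\<lambda>y. f y * Q y)"
  shows "(LINT y|lborel. f y * Q y) = 0"
proof -
  have "(LINT y|lborel. rot_act W f y * Q y) = (\<Sum>(c, R)\<leftarrow>W. c * (LINT y|lborel. f y * Q y))"
    using integral_rot_act[of W f "\<lambda>R. Q" Q] W Q_orthogonal int
    by (fastforce simp: is_rot_comb_def scalar_test_def)
  also have "\<dots> = (\<Sum>(c, R)\<leftarrow>W. c) * (LINT y|lborel. f y * Q y)"
    by (induction W) (auto simp: algebra_simps)
  finally show ?thesis using W f by (simp add: scalar_test_def)
qed

text \<open>The pairing of f with the derivative of Q in direction v is linear in v, so the
  combination collapses to the weighted sum of the rotated axes, a nonzero multiple of e.\<close>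

lemma vector_test_integral:
  assumes e: "e \<in> Basis" and W: "vector_test e W" and f: "rot_act W f = (\<lambda>y. 0)"
    and int: "\<And>b. b \<in> Basis \<Longrightarrow> integrable lborel (\<lambda>y. f y * dird b Q y)"
  shows "(LINT y|lborel. f y * dird e Q y) = 0"
proof -
  obtain k where k: "k \<noteq> 0" "(\<Sum>(c, R)\<leftarrow>W. c *\<^sub>R R e) = k *\<^sub>R e" and rot: "is_rot_comb W"
    using W unfolding vector_test_def by blast
  have rep: "(\<lambda>y. f y * dird v Q y) = (\<lambda>y. \<Sum>b\<in>Basis. (v \<bullet> b) * (f y * dird b Q y))" for v
    by (rule ext) (simp add: dird_Basis[OF Q_diff, of v] sum_distrib_left mult_ac)
  have int': "integrable lborel (\<lambda>y. f y * dird v Q y)" for v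
    unfolding rep using int by simp
  define I where "I = (\<lambda>v. LINT y|lborel. f y * dird v Q y)"
  have "linear I"
  proof (rule linearI)
    show "I (v + w) = I v + I w" for v w
      unfolding I_def using int'
      by (simp add: linear_add[OF linear_dird[OF Q_diff]] distrib_left)
    show "I (r *\<^sub>R v) = r *\<^sub>R I v" for r v
      unfolding I_def by (simp add: linear_cmul[OF linear_dird[OF Q_diff]] mult.left_commute)
  qed
  have "(LINT y|lborel. rot_act W f y * dird e Q y) = (\<Sum>(c, R)\<leftarrow>W. c * I (R e))"
    unfolding I_def using integral_rot_act[OF rot, of f "\<lambda>R. dird (R e) Q" "dird e Q"] rot dQ_orthogonal int'
    by (fastforce simp: is_rot_comb_def)
  also have "\<dots> = I (\<Sum>(c, R)\<leftarrow>W. c *\<^sub>R R e)"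
    by (induction W) (auto simp: linear_0[OF \<open>linear I\<close>] linear_add[OF \<open>linear I\<close>] linear_cmul[OF \<open>linear I\<close>])
  also have "\<dots> = k * I e" by (simp add: k linear_cmul[OF \<open>linear I\<close>])
  finally show ?thesis using k(1) f by (simp add: I_def)
qed

end

section \<open>The interaction terms under rotations and reflection\<close>

text \<open>In this form parity is handled by the same annihilation lemmas as the tests.\<close>

lemma even_fun_iff: "even_fun f \<longleftrightarrow> rot_act (parity (-1)) f = (\<lambda>y. 0)"
  by (auto simp: parity_def even_fun_def fun_eq_iff)

lemma odd_fun_iff: "odd_fun f \<longleftrightarrow> rot_act (parity 1) f = (\<lambda>y. 0)"
  by (auto simp: parity_def odd_fun_def fun_eq_iff eq_neg_iff_add_eq_0 add.commute)

lemma sg_pred: "sg (j - 1) = - sg j"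
  using exhaust_2[of j] by (auto simp: sg_def)

lemma exp_decaying_cont_zonal_integrable:
  assumes "continuous_on UNIV f" "exp_decaying f"
  shows "integrable lborel (\<lambda>\<xi>. f \<xi> * zonal n \<alpha> (c *\<^sub>R (a *\<^sub>R \<xi> - z)))"
proof (rule integrable_exp_decaying)
  have p: "poly_growth (\<lambda>\<xi>. zonal n \<alpha> (c *\<^sub>R (a *\<^sub>R \<xi> - z)))" by (rule poly_growth_zonal)
  then show "continuous_on UNIV (\<lambda>\<xi>. f \<xi> * zonal n \<alpha> (c *\<^sub>R (a *\<^sub>R \<xi> - z)))"
    using assms unfolding poly_growth_def by (intro continuous_intros) auto
  show "exp_decaying (\<lambda>\<xi>. f \<xi> * zonal n \<alpha> (c *\<^sub>R (a *\<^sub>R \<xi> - z)))"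
    using exp_decaying_poly_growth_mult[OF assms(2) p] by (simp add: mult.commute)
qed

lemma psi_zonal:
  assumes "\<alpha> \<noteq> 0"
  shows "psi (Suc n) f j \<alpha> lam y = - (1 / (4 * pi * lam $ (j + 1)) / norm \<alpha> ^ (2 * n + 1)) *
    (LINT \<xi>|lborel. f \<xi> * zonal n \<alpha> (sg j *\<^sub>R (lam $ (j + 1) *\<^sub>R \<xi> - lam $ j *\<^sub>R y)))"
  by (simp add: psi_def F_zonal[OF assms])

text \<open>The argument of the harmonic is linear in the pair (\<xi>, y). Rotating y can be matched
  by rotating \<xi>, which a radial density does not notice, so the combination acts on the harmonic
  under the integral.\<close>

lemma psi_annihilated:
  assumes \<alpha>: "\<alpha> \<noteq> 0" and f: "continuous_on UNIV f" "exp_decaying f"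
    and rad: "\<And>R x. orthogonal_transformation R \<Longrightarrow> f (R x) = f x"
    and W: "is_rot_comb W" and z: "rot_act W (zonal n \<alpha>) = (\<lambda>y. 0)"
  shows "rot_act W (psi (Suc n) f j \<alpha> lam) = (\<lambda>y. 0)"
proof
  fix y
  define A where "A = (\<lambda>(\<xi> :: real ^ 3) (y :: real ^ 3). sg j *\<^sub>R (lam $ (j + 1) *\<^sub>R \<xi> - lam $ j *\<^sub>R y))"
  define K where "K = - (1 / (4 * pi * lam $ (j + 1)) / norm \<alpha> ^ (2 * n + 1))"
  have psi: "psi (Suc n) f j \<alpha> lam y = K * (LINT \<xi>|lborel. f \<xi> * zonal n \<alpha> (A \<xi> y))" for y
    by (simp add: psi_zonal[OF \<alpha>] A_def K_def)
  have "rot_act W (psi (Suc n) f j \<alpha> lam) y = K * (LINT \<xi>|lborel. f \<xi> * rot_act W (zonal n \<alpha>) (A \<xi> y))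
      \<and> integrable lborel (\<lambda>\<xi>. f \<xi> * rot_act W (zonal n \<alpha>) (A \<xi> y))"
    using W
  proof (induction W)
    case (Cons a W)
    obtain c R where a: "a = (c, R)" by fastforce
    have R: "orthogonal_transformation R" and W: "is_rot_comb W" using Cons.prems a by simp_all
    have RA: "A (R \<xi>) (R y) = R (A \<xi> y)" for \<xi>
      using orthogonal_transformation_linear[OF R] by (simp add: A_def linear_diff linear_cmul)
    have i: "integrable lborel (\<lambda>\<xi>. f \<xi> * zonal n \<alpha> (A \<xi> (R y)))"
      unfolding A_def by (rule exp_decaying_cont_zonal_integrable[OF f])
    have 1: "integrable lborel (\<lambda>\<xi>. f \<xi> * zonal n \<alpha> (R (A \<xi> y)))"
      using i integrable_orthogonal_iff[OF R, of "\<lambda>\<xi>. f \<xi> * zonal n \<alpha> (A \<xi> (R y))"]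
      by (simp add: rad[OF R] RA)
    have 2: "(LINT \<xi>|lborel. f \<xi> * zonal n \<alpha> (A \<xi> (R y))) = (LINT \<xi>|lborel. f \<xi> * zonal n \<alpha> (R (A \<xi> y)))"
      using integral_orthogonal[OF R, of "\<lambda>\<xi>. f \<xi> * zonal n \<alpha> (A \<xi> (R y))"]
      by (simp add: rad[OF R] RA)
    have 3: "integrable lborel (\<lambda>\<xi>. c * (f \<xi> * zonal n \<alpha> (R (A \<xi> y))))"
      using 1 by simp
    have eq: "(\<lambda>\<xi>. f \<xi> * rot_act ((c, R) # W) (zonal n \<alpha>) (A \<xi> y))
        = (\<lambda>\<xi>. c * (f \<xi> * zonal n \<alpha> (R (A \<xi> y))) + f \<xi> * rot_act W (zonal n \<alpha>) (A \<xi> y))"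
      by (simp add: fun_eq_iff algebra_simps)
    show ?case
      unfolding a eq using Cons.IH[OF W] 3 1
      by (simp add: psi 2 distrib_left)
  qed simp
  then show "rot_act W (psi (Suc n) f j \<alpha> lam) y = 0" by (simp add: z)
qed

text \<open>Reflecting \<xi> and y together reflects the argument: degree n gives the sign (-1)^n
  and the density gives s.\<close>

lemma psi_parity:
  assumes \<alpha>: "\<alpha> \<noteq> 0" and f: "\<And>x. f (- x) = s * f x"
  shows "psi (Suc n) f j \<alpha> lam (- y) = s * (-1) ^ n * psi (Suc n) f j \<alpha> lam y"
proof -
  have u: "orthogonal_transformation (uminus :: real ^ 3 \<Rightarrow> real ^ 3)"
    using orthogonal_transformation_neg[of "\<lambda>x. x"] by simp
  define A where "A = (\<lambda>(\<xi> :: real ^ 3) (y :: real ^ 3). sg j *\<^sub>R (lam $ (j + 1) *\<^sub>R \<xi> - lam $ j *\<^sub>R y))"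
  have A: "A (- \<xi>) (- y) = - A \<xi> y" for \<xi> by (simp add: A_def algebra_simps)
  have "(LINT \<xi>|lborel. f \<xi> * zonal n \<alpha> (A \<xi> (- y))) = (LINT \<xi>|lborel. (s * (-1) ^ n) * (f \<xi> * zonal n \<alpha> (A \<xi> y)))"
    using integral_orthogonal[OF u, of "\<lambda>\<xi>. f \<xi> * zonal n \<alpha> (A \<xi> (- y))"]
    by (simp add: f A zonal_minus mult_ac)
  moreover have "psi (Suc n) f j \<alpha> lam y = - (1 / (4 * pi * lam $ (j + 1)) / norm \<alpha> ^ (2 * n + 1)) *
      (LINT \<xi>|lborel. f \<xi> * zonal n \<alpha> (A \<xi> y))" for y
    by (simp add: psi_zonal[OF \<alpha>] A_def)
  ultimately show ?thesis by simp
qed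

text \<open>The monopole field, constant in y. For the density Q^2 it is the opposite of the factor
  in the mass term of \<open>Ehat\<close>.\<close>

lemma psi_1:
  assumes \<alpha>: "\<alpha> \<noteq> 0"
  shows "psi (Suc 0) f j \<alpha> lam y = - ((LINT x|lborel. f x) / (4 * pi * lam $ (j + 1)) * (1 / norm \<alpha>))"
  by (simp add: psi_zonal[OF \<alpha>] zonal_def)

text \<open>An even density has no dipole moment, so only the part linear in y survives.\<close>

lemma psi_2_even:
  assumes \<alpha>: "\<alpha> \<noteq> 0" and f: "continuous_on UNIV f" "exp_decaying f" and even: "even_fun f"
  shows "psi (Suc (Suc 0)) f j \<alpha> lam y
    = (LINT x|lborel. f x) * sg j * lam $ j / (4 * pi * lam $ (j + 1)) * (\<alpha> \<bullet> y) / norm \<alpha> ^ 3"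
proof -
  have u: "orthogonal_transformation (uminus :: real ^ 3 \<Rightarrow> real ^ 3)"
    using orthogonal_transformation_neg[of "\<lambda>x. x"] by simp
  have i: "integrable lborel (\<lambda>\<xi>. f \<xi> * (\<alpha> \<bullet> \<xi>))"
    using exp_decaying_cont_zonal_integrable[OF f, of "Suc 0" \<alpha> 1 1 0] by (simp add: zonal_def)
  have "(LINT \<xi>|lborel. f \<xi> * (\<alpha> \<bullet> \<xi>)) = - (LINT \<xi>|lborel. f \<xi> * (\<alpha> \<bullet> \<xi>))"
    using integral_orthogonal[OF u, of "\<lambda>\<xi>. f \<xi> * (\<alpha> \<bullet> \<xi>)"] even by (simp add: even_fun_def)
  then have 0: "(LINT \<xi>|lborel. f \<xi> * (\<alpha> \<bullet> \<xi>)) = 0" by simp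
  have "(\<lambda>\<xi>. f \<xi> * zonal (Suc 0) \<alpha> (sg j *\<^sub>R (lam $ (j + 1) *\<^sub>R \<xi> - lam $ j *\<^sub>R y)))
      = (\<lambda>\<xi>. (sg j * lam $ (j + 1)) * (f \<xi> * (\<alpha> \<bullet> \<xi>)) - (sg j * lam $ j * (\<alpha> \<bullet> y)) * f \<xi>)"
    by (simp add: fun_eq_iff zonal_def inner_diff_right algebra_simps)
  then have "(LINT \<xi>|lborel. f \<xi> * zonal (Suc 0) \<alpha> (sg j *\<^sub>R (lam $ (j + 1) *\<^sub>R \<xi> - lam $ j *\<^sub>R y)))
      = - (sg j * lam $ j * (\<alpha> \<bullet> y)) * (LINT x|lborel. f x)"
    using i integrable_exp_decaying[OF f] by (simp add: 0)
  then show ?thesis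
    by (simp add: psi_zonal[OF \<alpha>] eval_nat_numeral)
qed

section \<open>Differentiation in the parameters\<close>

lemma dird_eventually_const:
  assumes "f differentiable (at x)" "\<forall>\<^sub>F a in nhds x. f a = c"
  shows "dird v f x = 0"
proof -
  have "f x = c" using assms(2) by (rule eventually_nhds_x_imp_x)
  moreover have "\<forall>\<^sub>F a in at x. f a = c"
    using assms(2) by (simp add: eventually_nhds_conv_at)
  ultimately have "((\<lambda>a. c) has_derivative (\<lambda>v. dird v f x)) (at x)"
    by (intro has_derivative_transform_eventually[OF differentiable_has_dird[OF assms(1)]]) simp_all
  from has_derivative_unique[OF this has_derivative_const] show ?thesis by meson
qed

text \<open>Pointwise linear identities between values at rotated points survive differentiation in a
  parameter; this is why no uniformity of the decay in the parameters is needed.\<close>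

lemma rot_act_dird:
  fixes h :: "'a::real_normed_vector \<Rightarrow> real ^ 3 \<Rightarrow> complex"
  assumes B: "bounded_linear B" and d: "\<And>y. (\<lambda>a. h a y) differentiable (at x)"
    and ev: "\<forall>\<^sub>F a in nhds x. rot_act W (\<lambda>y. B (h a y)) = (\<lambda>y. 0)"
  shows "rot_act W (\<lambda>y. B (dird v (\<lambda>a. h a y) x)) = (\<lambda>y. 0)"
proof
  fix y
  have der: "((\<lambda>a. rot_act W (\<lambda>y. B (h a y)) y) has_derivative
      (\<lambda>v. rot_act W (\<lambda>y. B (dird v (\<lambda>a. h a y) x)) y)) (at x)"
  proof (induction W)
    case (Cons p W)
    obtain c R where p: "p = (c, R)" by fastforce
    have "((\<lambda>a. B (h a (R y))) has_derivative (\<lambda>v. B (dird v (\<lambda>a. h a (R y)) x))) (at x)"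
      by (rule bounded_linear.has_derivative[OF B differentiable_has_dird[OF d]])
    then show ?case unfolding p rot_act_simps
      by (intro has_derivative_add has_derivative_mult_right Cons.IH)
  qed simp
  have "dird v (\<lambda>a. rot_act W (\<lambda>y. B (h a y)) y) x = 0"
  proof (rule dird_eventually_const)
    show "(\<lambda>a. rot_act W (\<lambda>y. B (h a y)) y) differentiable (at x)"
      using der unfolding differentiable_def by blast
    show "\<forall>\<^sub>F a in nhds x. rot_act W (\<lambda>y. B (h a y)) y = 0"
      using ev by eventually_elim simp
  qed
  then show "rot_act W (\<lambda>y. B (dird v (\<lambda>a. h a y) x)) y = 0"
    using dird_has_derivative[OF der, of v] by simp
qed

section \<open>The index sets of the sums in \<open>Ehat\<close>\<close>

text \<open>Meant for sums weighted by b^(n) and \<open>\<mu>\<close>, where only n = 2 will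
  contribute.\<close>

lemma sum_pairs_only_two:
  fixes g :: "nat \<Rightarrow> nat \<Rightarrow> 'a::comm_monoid_add"
  assumes "\<And>m n. n \<in> {1..N} \<Longrightarrow> n \<noteq> 2 \<Longrightarrow> g m n = 0"
  shows "(\<Sum>(m, n) \<in> {(m, n) \<in> {0..N} \<times> {1..N}. m + n = N + 1}. g m n) = (if 2 \<le> N then g (N - 1) 2 else 0)"
proof -
  have "(\<Sum>(m, n) \<in> {(m, n) \<in> {0..N} \<times> {1..N}. m + n = N + 1}. g m n)
      = (\<Sum>(m, n) \<in> (if 2 \<le> N then {(N - 1, 2)} else {}). g m n)"
  proof (rule sum.mono_neutral_right)
    show "finite {(m, n) \<in> {0..N} \<times> {1..N}. m + n = N + 1}"
      by (rule finite_subset[of _ "{0..N} \<times> {1..N}"]) auto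
    show "(if 2 \<le> N then {(N - 1, 2)} else {}) \<subseteq> {(m, n) \<in> {0..N} \<times> {1..N}. m + n = N + 1}"
      by auto
    show "\<forall>i\<in>{(m, n) \<in> {0..N} \<times> {1..N}. m + n = N + 1} - (if 2 \<le> N then {(N - 1, 2)} else {}).
        (case i of (m, n) \<Rightarrow> g m n) = 0"
    proof
      fix i assume i: "i \<in> {(m, n) \<in> {0..N} \<times> {1..N}. m + n = N + 1} - (if 2 \<le> N then {(N - 1, 2)} else {})"
      obtain m n where mn: "i = (m, n)" by fastforce
      then have "n \<in> {1..N}" "n \<noteq> 2" using i by (auto split: if_splits)
      then show "(case i of (m, n) \<Rightarrow> g m n) = 0" using assms mn by simp
    qed
  qed
  then show ?thesis by simp
qed

text \<open>No index can equal N + 1, so at least two are nonzero; as 1 and 2 contribute nothing,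
  these are at least 3 and add up to at least 6. This forces N = 5.\<close>

lemma sum_triples:
  fixes g :: "nat \<Rightarrow> nat \<Rightarrow> nat \<Rightarrow> 'a::comm_monoid_add"
  assumes N: "N \<le> 5" and v: "\<And>k l m. k \<in> {1, 2} \<or> l \<in> {1, 2} \<or> m \<in> {1, 2} \<Longrightarrow> k \<le> N \<Longrightarrow> l \<le> N \<Longrightarrow> m \<le> N \<Longrightarrow> g k l m = 0"
  shows "(\<Sum>(k, l, m) \<in> {(k, l, m) \<in> {0..N} \<times> {0..N} \<times> {0..N}. k + l + m = N + 1}. g k l m)
    = (if N = 5 then g 3 3 0 + (g 3 0 3 + g 0 3 3) else 0)"
proof -
  let ?S = "{(k, l, m) \<in> {0..N} \<times> {0..N} \<times> {0..N}. k + l + m = N + 1}"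
  let ?T = "if N = 5 then {(3, 3, 0), (3, 0, 3), (0, 3, 3)} else {}"
  have "(\<Sum>(k, l, m) \<in> ?S. g k l m) = (\<Sum>(k, l, m) \<in> ?T. g k l m)"
  proof (rule sum.mono_neutral_right)
    show "finite ?S"
      by (rule finite_subset[of _ "{0..N} \<times> {0..N} \<times> {0..N}"]) auto
    show "?T \<subseteq> ?S" by auto
    show "\<forall>i\<in>?S - ?T. (case i of (k, l, m) \<Rightarrow> g k l m) = 0"
    proof
      fix i assume i: "i \<in> ?S - ?T"
      obtain k l m where klm: "i = (k, l, m)" by (metis prod_cases3)
      have le: "k \<le> N" "l \<le> N" "m \<le> N" "k + l + m = N + 1" and nT: "(k, l, m) \<notin> ?T"
        using i klm by auto
      have "k \<in> {1, 2} \<or> l \<in> {1, 2} \<or> m \<in> {1, 2}"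
      proof (rule ccontr)
        assume "\<not> ?thesis"
        then have "k = 0 \<or> 3 \<le> k" "l = 0 \<or> 3 \<le> l" "m = 0 \<or> 3 \<le> m" by auto
        then have "N = 5 \<and> (k = 3 \<and> l = 3 \<and> m = 0 \<or> k = 3 \<and> l = 0 \<and> m = 3 \<or> k = 0 \<and> l = 3 \<and> m = 3)"
          using le N by (elim disjE) linarith+
        then show False using nT by auto
      qed
      then show "(case i of (k, l, m) \<Rightarrow> g k l m) = 0" using v le klm by simp
    qed
  qed
  then show ?thesis by simp
qed

text \<open>Two profile indices of at least 3 together with n >= 1 would exceed N + 1 <= 6, and
  three zero indices would force n = N + 1. So exactly one profile index is nonzero.\<close>

lemma sum_quadruples:
  fixes g :: "nat \<Rightarrow> nat \<Rightarrow> nat \<Rightarrow> nat \<Rightarrow> 'a::comm_monoid_add"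
  assumes N: "N \<le> 5" and v: "\<And>k l m n. k \<in> {1, 2} \<or> l \<in> {1, 2} \<or> m \<in> {1, 2} \<Longrightarrow> k \<le> N \<Longrightarrow> l \<le> N \<Longrightarrow> m \<le> N \<Longrightarrow> g k l m n = 0"
  shows "(\<Sum>(k, l, m, n) \<in> {(k, l, m, n) \<in> {0..N} \<times> {0..N} \<times> {0..N} \<times> {1..N}. k + l + m + n = N + 1}. g k l m n)
    = (\<Sum>i\<in>{3..N}. g i 0 0 (N + 1 - i) + g 0 i 0 (N + 1 - i) + g 0 0 i (N + 1 - i))"
proof -
  let ?S = "{(k, l, m, n) \<in> {0..N} \<times> {0..N} \<times> {0..N} \<times> {1..N}. k + l + m + n = N + 1}"
  let ?A = "(\<lambda>i. (i, 0, 0, N + 1 - i)) ` {3..N}" and ?B = "(\<lambda>i. (0, i, 0, N + 1 - i)) ` {3..N}"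
    and ?C = "(\<lambda>i. (0, 0, i, N + 1 - i)) ` {3..N}"
  have "(\<Sum>(k, l, m, n) \<in> ?S. g k l m n) = (\<Sum>(k, l, m, n) \<in> ?A \<union> ?B \<union> ?C. g k l m n)"
  proof (rule sum.mono_neutral_right)
    show "finite ?S"
      by (rule finite_subset[of _ "{0..N} \<times> {0..N} \<times> {0..N} \<times> {1..N}"]) auto
    show "?A \<union> ?B \<union> ?C \<subseteq> ?S" by auto
    show "\<forall>i\<in>?S - (?A \<union> ?B \<union> ?C). (case i of (k, l, m, n) \<Rightarrow> g k l m n) = 0"
    proof
      fix i assume i: "i \<in> ?S - (?A \<union> ?B \<union> ?C)"
      obtain k l m n where klm: "i = (k, l, m, n)" by (metis prod_cases4)
      have le: "k \<le> N" "l \<le> N" "m \<le> N" "k + l + m + n = N + 1" "1 \<le> n" "n \<le> N"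
        and nT: "(k, l, m, n) \<notin> ?A" "(k, l, m, n) \<notin> ?B" "(k, l, m, n) \<notin> ?C"
        using i klm by auto
      have "k \<in> {1, 2} \<or> l \<in> {1, 2} \<or> m \<in> {1, 2}"
      proof (rule ccontr)
        assume "\<not> ?thesis"
        then have "k = 0 \<or> 3 \<le> k" "l = 0 \<or> 3 \<le> l" "m = 0 \<or> 3 \<le> m" by auto
        then have "3 \<le> k \<and> l = 0 \<and> m = 0 \<and> n = N + 1 - k \<or> k = 0 \<and> 3 \<le> l \<and> m = 0 \<and> n = N + 1 - l
            \<or> k = 0 \<and> l = 0 \<and> 3 \<le> m \<and> n = N + 1 - m"
          using le N by (elim disjE) linarith+
        then show False using nT le by auto
      qed
      then show "(case i of (k, l, m, n) \<Rightarrow> g k l m n) = 0" using v le klm by simp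
    qed
  qed
  also have "\<dots> = (\<Sum>(k, l, m, n) \<in> ?A. g k l m n) + (\<Sum>(k, l, m, n) \<in> ?B. g k l m n) + (\<Sum>(k, l, m, n) \<in> ?C. g k l m n)"
    by (subst sum.union_disjoint; (subst sum.union_disjoint)?; auto)
  also have "\<dots> = (\<Sum>i\<in>{3..N}. g i 0 0 (N + 1 - i)) + (\<Sum>i\<in>{3..N}. g 0 i 0 (N + 1 - i)) + (\<Sum>i\<in>{3..N}. g 0 0 i (N + 1 - i))"
    by (simp add: sum.reindex inj_on_def)
  finally show ?thesis by (simp add: sum.distrib)
qed

section \<open>The recursive construction\<close>

locale profile_construction = ground_state_kernels +
  fixes chi :: "real ^ 3 \<Rightarrow> real" and L :: real
    and b :: "(real ^ 3) family" and \<mu> :: "real family" and T :: "(real ^ 3 \<Rightarrow> complex) family"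
  assumes construction: "recursive_construction chi L Q b \<mu> T"
begin

abbreviation "Eh \<equiv> Ehat chi L Q b \<mu> T"

abbreviation reT :: "nat \<Rightarrow> 2 \<Rightarrow> real ^ 3 \<Rightarrow> real ^ 3 \<Rightarrow> real ^ 2 \<Rightarrow> real ^ 3 \<Rightarrow> real" where
  "reT N j \<alpha> \<beta> lam y \<equiv> Re (T N j \<alpha> \<beta> lam y)"

abbreviation imT :: "nat \<Rightarrow> 2 \<Rightarrow> real ^ 3 \<Rightarrow> real ^ 3 \<Rightarrow> real ^ 2 \<Rightarrow> real ^ 3 \<Rightarrow> real" where
  "imT N j \<alpha> \<beta> lam y \<equiv> Im (T N j \<alpha> \<beta> lam y)"

text \<open>The source of the real part of the equation of order \<open>N + 1\<close> without its \<open>b\<close>-term, up to sign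
  and scaling.\<close>

definition source :: "nat \<Rightarrow> 2 \<Rightarrow> real ^ 3 \<Rightarrow> real ^ 3 \<Rightarrow> real ^ 2 \<Rightarrow> real ^ 3 \<Rightarrow> real" where
  "source N j \<alpha> \<beta> lam y
     = psiL chi L (N + 1) (\<lambda>x. (Q x)\<^sup>2) j \<alpha> lam y * Q y - Re (Eh N j \<alpha> \<beta> lam y)"

lemma admissible_lam: "admissible \<alpha> lam \<Longrightarrow> lam $ j > 0"
  using exhaust_2[of j] by (auto simp: admissible_def)

lemma admissible_eventually:
  assumes "admissible \<alpha> lam"
  shows "\<forall>\<^sub>F a in nhds \<alpha>. admissible a lam"
proof -
  have "\<forall>\<^sub>F a in nhds \<alpha>. a \<in> - {0}"
    using assms by (intro eventually_nhds_in_open) (auto simp: admissible_def)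
  then show ?thesis by eventually_elim (use assms in \<open>auto simp: admissible_def\<close>)
qed

lemma
  assumes adm: "admissible \<alpha> lam"
  shows T_0: "T 0 j \<alpha> \<beta> lam y = of_real (Q y)"
    and T_diff: "(\<lambda>a. T N j a \<beta> lam y) differentiable (at \<alpha>)" "(\<lambda>v. T N j \<alpha> v lam y) differentiable (at \<beta>)"
    and coeff: "coefficient_eqs chi L Q b \<mu> T N j \<alpha> \<beta> lam"
    and profile: "profile_eqs chi L Q b \<mu> T N j \<alpha> \<beta> lam"
proof -
  note all = construction[unfolded recursive_construction_def, THEN spec, THEN spec, THEN spec, THEN spec,
      THEN mp, OF adm, of j \<beta>]
  show "T 0 j \<alpha> \<beta> lam y = of_real (Q y)" using all[THEN conjunct1] ..
  show "(\<lambda>a. T N j a \<beta> lam y) differentiable (at \<alpha>)" "(\<lambda>v. T N j \<alpha> v lam y) differentiable (at \<beta>)"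
    using all[THEN conjunct2, THEN conjunct1, THEN spec, THEN spec, of N y] by fast+
  show "coefficient_eqs chi L Q b \<mu> T N j \<alpha> \<beta> lam" "profile_eqs chi L Q b \<mu> T N j \<alpha> \<beta> lam"
    using all[THEN conjunct2, THEN conjunct2, THEN spec, of N] by fast+
qed

lemma T_regular:
  assumes "admissible \<alpha> lam"
  shows "Ck 2 (reT (Suc N) j \<alpha> \<beta> lam)" "exp_decaying (reT (Suc N) j \<alpha> \<beta> lam)"
    "Ck 2 (imT (Suc N) j \<alpha> \<beta> lam)" "exp_decaying (imT (Suc N) j \<alpha> \<beta> lam)"
proof -
  have T: "Ck 2 (T (Suc N) j \<alpha> \<beta> lam)" "exp_decaying (T (Suc N) j \<alpha> \<beta> lam)"
    using profile[OF assms, of N j \<beta>] by (auto simp: profile_eqs_def Let_def)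
  show "Ck 2 (reT (Suc N) j \<alpha> \<beta> lam)" "Ck 2 (imT (Suc N) j \<alpha> \<beta> lam)"
    by (rule Ck_bounded_linear[OF bounded_linear_Re T(1)] Ck_bounded_linear[OF bounded_linear_Im T(1)])+
  show "exp_decaying (reT (Suc N) j \<alpha> \<beta> lam)" "exp_decaying (imT (Suc N) j \<alpha> \<beta> lam)"
    by (rule exp_decaying_mono[OF T(2)]; simp add: abs_Re_le_cmod abs_Im_le_cmod)+
qed

section \<open>Coefficients and profiles determined by annihilated sources\<close>

text \<open>Once the tests remove g, the equation contains only the moment of (v . y) Q.
  Integrability of g against the gradient is recovered by subtraction, since \<open>orth\<close>
  asserts convergence for the sum.\<close>

lemma vector_coefficient_zero:
  assumes c: "c \<noteq> 0" and o: "\<And>e. e \<in> Basis \<Longrightarrow> orth (\<lambda>y. c * (v \<bullet> y) * Q y + g y) (dird e Q)"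
    and W: "\<And>e. e \<in> Basis \<Longrightarrow> \<exists>W. vector_test e W \<and> rot_act W g = (\<lambda>y. 0)"
  shows "v = 0"
proof -
  have split: "(\<lambda>y. (c * (v \<bullet> y) * Q y + g y) * dird e Q y)
      = (\<lambda>y. c * (((v \<bullet> y) * Q y) * dird e Q y) + g y * dird e Q y)" for e
    by (simp add: fun_eq_iff algebra_simps)
  have i1: "integrable lborel (\<lambda>y. c * (((v \<bullet> y) * Q y) * dird e Q y))" if e: "e \<in> Basis" for e
    by (rule integrable_mult_right[OF moment_dQ(1)[OF e]])
  have i: "integrable lborel (\<lambda>y. g y * dird e Q y)" if e: "e \<in> Basis" for e
  proof -
    have "integrable lborel (\<lambda>y. c * (((v \<bullet> y) * Q y) * dird e Q y) + g y * dird e Q y)"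
      using o[OF e] unfolding orth_def split by blast
    from Bochner_Integration.integrable_diff[OF this i1[OF e]]
    show ?thesis by (simp only: add_diff_cancel_left')
  qed
  have "v \<bullet> e = 0" if e: "e \<in> Basis" for e
  proof -
    obtain W where W: "vector_test e W" "rot_act W g = (\<lambda>y. 0)" using W[OF e] by blast
    have "0 = (LINT y|lborel. c * (((v \<bullet> y) * Q y) * dird e Q y) + g y * dird e Q y)"
      using o[OF e] unfolding orth_def ip_def split by simp
    also have "\<dots> = (LINT y|lborel. c * (((v \<bullet> y) * Q y) * dird e Q y)) + (LINT y|lborel. g y * dird e Q y)"
      by (rule Bochner_Integration.integral_add[OF i1[OF e] i[OF e]])
    also have "(LINT y|lborel. g y * dird e Q y) = 0"
      by (rule vector_test_integral[OF e W i])
    also have "(LINT y|lborel. c * (((v \<bullet> y) * Q y) * dird e Q y)) = c * (- (v \<bullet> e) / 2 * mass)"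
      by (simp only: integral_mult_right_zero moment_dQ(2)[OF e])
    finally show ?thesis using c mass_pos by simp
  qed
  then show ?thesis by (intro euclidean_eqI[of v 0]) simp
qed

text \<open>A part of the source that already has the form (w . y) Q is compensated by b itself, so
  only the remainder has to be annihilated. Order 2 uses a nonzero w, all others w = 0.\<close>

lemma b_eq:
  assumes adm: "admissible \<alpha> lam"
    and W: "\<And>e. e \<in> Basis \<Longrightarrow> \<exists>W. vector_test e W \<and>
      rot_act W (\<lambda>y. source N j \<alpha> \<beta> lam y - lam $ j * (w \<bullet> y) * Q y) = (\<lambda>y. 0)"
  shows "b (Suc N) j \<alpha> \<beta> lam = - w"
proof -
  have "b (Suc N) j \<alpha> \<beta> lam + w = 0"
  proof (rule vector_coefficient_zero)
    show "lam $ j \<noteq> 0" using admissible_lam[OF adm, of j] by simp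
    show "orth (\<lambda>y. lam $ j * ((b (Suc N) j \<alpha> \<beta> lam + w) \<bullet> y) * Q y
        + (source N j \<alpha> \<beta> lam y - lam $ j * (w \<bullet> y) * Q y)) (dird e Q)" if "e \<in> Basis" for e
    proof -
      have "orth (\<lambda>y. lam $ j * (b (N + 1) j \<alpha> \<beta> lam \<bullet> y) * Q y
          + psiL chi L (N + 1) (\<lambda>x. (Q x)\<^sup>2) j \<alpha> lam y * Q y - Re (Eh N j \<alpha> \<beta> lam y)) (dird e Q)"
        using coeff[OF adm, of N j \<beta>] that unfolding coefficient_eqs_def by blast
      then show ?thesis by (simp add: source_def inner_add_left algebra_simps)
    qed
  qed (rule W)
  then show ?thesis by (simp add: eq_neg_iff_add_eq_0)
qed

lemma b_eq_0:
  assumes "admissible \<alpha> lam"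
    and "\<And>e W. vector_test e W \<Longrightarrow> rot_act W (source N j \<alpha> \<beta> lam) = (\<lambda>y. 0)"
  shows "b (Suc N) j \<alpha> \<beta> lam = 0"
proof -
  have "b (Suc N) j \<alpha> \<beta> lam = - 0"
  proof (rule b_eq[OF assms(1)])
    fix e :: "real ^ 3" assume "e \<in> Basis"
    then obtain W where "vector_test e W" using vector_test_exists by blast
    with assms(2) show "\<exists>W. vector_test e W \<and>
        rot_act W (\<lambda>y. source N j \<alpha> \<beta> lam y - lam $ j * (0 \<bullet> y) * Q y) = (\<lambda>y. 0)"
      by (intro exI[of _ W]) simp
  qed
  then show ?thesis by simp
qed

text \<open>A scalar test removes the pairing of the imaginary source with Q. What remains is
  \<open>\<mu>\<close> times the pairing of \<open>Lam Q\<close> with Q, which is mass / 2.\<close>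

lemma mu_eq_0:
  assumes adm: "admissible \<alpha> lam"
    and W: "\<And>W. scalar_test W \<Longrightarrow> rot_act W (\<lambda>y. Im (Eh N j \<alpha> \<beta> lam y)) = (\<lambda>y. 0)"
  shows "\<mu> (Suc N) j \<alpha> \<beta> lam = 0"
proof -
  define g where "g = (\<lambda>y. Im (Eh N j \<alpha> \<beta> lam y))"
  define c where "c = \<mu> (Suc N) j \<alpha> \<beta> lam"
  have l: "lam $ j > 0" by (rule admissible_lam[OF adm])
  have o: "orth (\<lambda>y. c * Lam Q y - lam $ j * g y) Q"
    using coeff[OF adm, of N j \<beta>] by (simp add: coefficient_eqs_def c_def g_def)
  have i1: "integrable lborel (\<lambda>y. Lam Q y * Q y)"
    using integrable_mult_Lam_Q[OF Q_cont Q_exp] by (simp add: mult.commute)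
  have "integrable lborel (\<lambda>y. (c * Lam Q y - lam $ j * g y) * Q y)"
    using o by (simp add: orth_def)
  from Bochner_Integration.integrable_diff[OF integrable_mult_right[OF i1, of c] this]
  have "integrable lborel (\<lambda>y. lam $ j * (g y * Q y))"
    by (simp add: algebra_simps)
  from integrable_mult_right[OF this, of "1 / lam $ j"]
  have i2: "integrable lborel (\<lambda>y. g y * Q y)" using l by simp
  obtain W where "scalar_test W" using scalar_test_exists by blast
  then have "(LINT y|lborel. g y * Q y) = 0"
    using W by (intro scalar_test_integral[OF _ _ i2]) (auto simp: g_def)
  moreover have "(LINT y|lborel. c * (Lam Q y * Q y) - lam $ j * (g y * Q y)) = 0"
    using o by (simp add: orth_def ip_def algebra_simps)
  ultimately have "c * (LINT y|lborel. Lam Q y * Q y) = 0"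
    using i1 i2 by simp
  then show ?thesis using Q_Lam_Q mass_pos by (simp add: c_def mult.commute)
qed

text \<open>Up to the factor - lam^2, \<open>g\<close> is the whole right-hand side, b-term
  included, so that a cancellation between b and the source can be used before anything is
  rotated.\<close>

lemma reT_annihilated:
  assumes adm: "admissible \<alpha> lam" and b: "\<And>y. lam $ j * (b (Suc N) j \<alpha> \<beta> lam \<bullet> y) * Q y + source N j \<alpha> \<beta> lam y = g y"
    and W: "is_rot_comb W" and g: "rot_act W g = (\<lambda>y. 0)"
  shows "rot_act W (reT (Suc N) j \<alpha> \<beta> lam) = (\<lambda>y. 0)"
proof (rule Lplus_annihilated[OF W T_regular(1,2)[OF adm]])
  note P = profile[OF adm, of N j \<beta>, unfolded profile_eqs_def Let_def]
  have "Lplus Q (reT (Suc N) j \<alpha> \<beta> lam) = (\<lambda>y. - ((lam $ j)\<^sup>2) * g y)"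
  proof
    fix y
    have "Lplus Q (reT (Suc N) j \<alpha> \<beta> lam) y = - ((lam $ j) ^ 3) * (b (N + 1) j \<alpha> \<beta> lam \<bullet> y) * Q y
       - (lam $ j)\<^sup>2 * psiL chi L (N + 1) (\<lambda>x. (Q x)\<^sup>2) j \<alpha> lam y * Q y + (lam $ j)\<^sup>2 * Re (Eh N j \<alpha> \<beta> lam y)"
      using P by simp
    also have "\<dots> = - ((lam $ j)\<^sup>2) * g y"
      unfolding b[symmetric] by (simp add: source_def power2_eq_square power3_eq_cube algebra_simps)
    finally show "Lplus Q (reT (Suc N) j \<alpha> \<beta> lam) y = - ((lam $ j)\<^sup>2) * g y" .
  qed
  then show "rot_act W (Lplus Q (reT (Suc N) j \<alpha> \<beta> lam)) = (\<lambda>y. 0)"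
    by (simp only: rot_act_cmult g) simp
  show "orth (reT (Suc N) j \<alpha> \<beta> lam) (\<lambda>y. (y \<bullet> e) * Q y)" if "e \<in> Basis" for e
    using P that by simp
qed

lemma imT_annihilated:
  assumes adm: "admissible \<alpha> lam" and m: "\<mu> (Suc N) j \<alpha> \<beta> lam = 0"
    and W: "is_rot_comb W" and g: "rot_act W (\<lambda>y. Im (Eh N j \<alpha> \<beta> lam y)) = (\<lambda>y. 0)"
  shows "rot_act W (imT (Suc N) j \<alpha> \<beta> lam) = (\<lambda>y. 0)"
proof (rule Lminus_annihilated[OF W T_regular(3,4)[OF adm]])
  note P = profile[OF adm, of N j \<beta>, unfolded profile_eqs_def Let_def]
  have "Lminus Q (imT (Suc N) j \<alpha> \<beta> lam) = (\<lambda>y. (lam $ j)\<^sup>2 * Im (Eh N j \<alpha> \<beta> lam y))"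
    using P m by (simp add: fun_eq_iff)
  then show "rot_act W (Lminus Q (imT (Suc N) j \<alpha> \<beta> lam)) = (\<lambda>y. 0)"
    by (simp only: rot_act_cmult g) simp
  show "orth (imT (Suc N) j \<alpha> \<beta> lam) (Lam Q)" using P by simp
qed

text \<open>The difference of two normalized solutions with equal sources lies in the kernel of
  \<open>Lplus\<close> and vanishes. Later this removes derivatives in \<beta>.\<close>

lemma reT_indep:
  assumes adm: "admissible \<alpha> lam" and b: "b (Suc N) j \<alpha> \<beta> lam = 0" "b (Suc N) j \<alpha> \<beta>' lam = 0"
    and s: "source N j \<alpha> \<beta> lam = source N j \<alpha> \<beta>' lam"
  shows "reT (Suc N) j \<alpha> \<beta> lam = reT (Suc N) j \<alpha> \<beta>' lam"
proof -
  let ?f = "reT (Suc N) j \<alpha> \<beta> lam" and ?g = "reT (Suc N) j \<alpha> \<beta>' lam"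
  have f: "Ck 2 ?f" "exp_decaying ?f" and g: "Ck 2 ?g" "exp_decaying ?g"
    using T_regular[OF adm] by auto
  have L: "Lplus Q (reT (Suc N) j \<alpha> \<beta> lam) y = - (lam $ j)\<^sup>2 * source N j \<alpha> \<beta> lam y"
    if "b (Suc N) j \<alpha> \<beta> lam = 0" for \<beta> y
    using profile[OF adm, of N j \<beta>, unfolded profile_eqs_def Let_def] that
    by (simp add: source_def algebra_simps)
  have o: "orth (reT (Suc N) j \<alpha> \<beta> lam) (\<lambda>y. (y \<bullet> e) * Q y)" if "e \<in> Basis" for \<beta> e
    using profile[OF adm, of N j \<beta>, unfolded profile_eqs_def Let_def] that by simp
  have "(\<lambda>x. (-1) * ?f x + ?g x) = (\<lambda>y. 0)"
  proof (rule Lplus_unique)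
    show "Ck 2 (\<lambda>x. (-1) * ?f x + ?g x)" by (intro Ck_add Ck_cmult f g)
    show "exp_decaying (\<lambda>x. (-1) * ?f x + ?g x)" by (intro exp_decaying_add exp_decaying_cmult f g)
    show "Lplus Q (\<lambda>x. (-1) * ?f x + ?g x) y = 0" for y
      unfolding Lplus_lin[OF f g] L[OF b(1)] L[OF b(2)] s by simp
    show "(LINT y|lborel. ((-1) * ?f y + ?g y) * ((y \<bullet> e) * Q y)) = 0" if "e \<in> Basis" for e
      using o[OF that, of \<beta>] o[OF that, of \<beta>'] by (simp add: orth_def ip_def left_diff_distrib)
  qed
  then show ?thesis by (simp add: fun_eq_iff)
qed

text \<open>Q is radial and passes through the combination; n < 10 keeps the cutoff out of
  \<open>psiL\<close>, so the term is purely polynomial times Q.\<close>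

lemma psiL_Q_annihilated:
  assumes adm: "admissible \<alpha> lam" and n: "n < 10" and W: "is_rot_comb W"
    and z: "rot_act W (zonal n \<alpha>) = (\<lambda>y. 0)"
  shows "rot_act W (\<lambda>y. psiL chi L (n + 1) (\<lambda>x. (Q x)\<^sup>2) j \<alpha> lam y * Q y) = (\<lambda>y. 0)"
proof -
  have k: "rot_act W (psi (Suc n) (\<lambda>x. (Q x)\<^sup>2) j \<alpha> lam) = (\<lambda>y. 0)"
  proof (rule psi_annihilated[OF _ _ _ _ W z])
    show "\<alpha> \<noteq> 0" using adm by (simp add: admissible_def)
    show "continuous_on UNIV (\<lambda>x. (Q x)\<^sup>2)" by (intro continuous_intros Q_cont)
    show "exp_decaying (\<lambda>x. (Q x)\<^sup>2)"
      using exp_decaying_mult[OF Q_exp Q_exp] by (simp add: power2_eq_square)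
  qed (simp add: Q_orthogonal)
  have e: "(\<lambda>y. psiL chi L (n + 1) (\<lambda>x. (Q x)\<^sup>2) j \<alpha> lam y * Q y)
      = (\<lambda>y. Q y * psi (Suc n) (\<lambda>x. (Q x)\<^sup>2) j \<alpha> lam y)"
    using n by (simp add: psiL_def mult.commute)
  show ?thesis
    unfolding e by (rule ext) (simp add: rot_act_radial_mult[where h = Q, OF W] Q_orthogonal k)
qed

text \<open>Vanishing \<open>\<mu>\<close> removes the scaling terms and the derivatives in lam.
  Vanishing b leaves only the direction 0 for the \<beta>-derivative, except for n = 2.\<close>

lemma Ehat_reduced:
  assumes adm: "admissible \<alpha> lam"
    and b: "\<And>n j. n \<in> {1..N} \<Longrightarrow> n \<noteq> 2 \<Longrightarrow> b n j \<alpha> \<beta> lam = 0"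
    and m: "\<And>n j. n \<in> {1..N} \<Longrightarrow> \<mu> n j \<alpha> \<beta> lam = 0"
  shows "Eh N j \<alpha> \<beta> lam y =
     - (1 / (lam $ j)\<^sup>2) *\<^sub>R
         (\<Sum>(k, l, m) \<in> {(k, l, m) \<in> {0..N} \<times> {0..N} \<times> {0..N}. k + l + m = N + 1}.
            phi (\<lambda>x. Re (T k j \<alpha> \<beta> lam x * cnj (T l j \<alpha> \<beta> lam x))) y *\<^sub>R T m j \<alpha> \<beta> lam y)
     - (\<Sum>(k, l, m, n) \<in> {(k, l, m, n) \<in> {0..N} \<times> {0..N} \<times> {0..N} \<times> {1..N}.
                            k + l + m + n = N + 1}.
            psiL chi L n (\<lambda>x. Re (T k (j + 1) \<alpha> \<beta> lam x * cnj (T l (j + 1) \<alpha> \<beta> lam x)))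
              j \<alpha> lam y *\<^sub>R T m j \<alpha> \<beta> lam y)
     - lam $ j *\<^sub>R (if 2 \<le> N then (b 2 j \<alpha> \<beta> lam \<bullet> y) *\<^sub>R T (N - 1) j \<alpha> \<beta> lam y else 0)
     - (mass / (4 * pi * lam $ (j + 1)) * (1 / norm \<alpha>)) *\<^sub>R T N j \<alpha> \<beta> lam y
     + \<i> * dird (2 *\<^sub>R \<beta>) (\<lambda>a. T N j a \<beta> lam y) \<alpha>
     + \<i> * (if 2 \<le> N then dird (b 2 2 \<alpha> \<beta> lam - b 2 1 \<alpha> \<beta> lam) (\<lambda>v. T (N - 1) j \<alpha> v lam y) \<beta> else 0)"
proof -
  have d0: "dird 0 (\<lambda>v. T m j \<alpha> v lam y) \<beta> = 0" for m
    using linear_dird[OF T_diff(2)[OF adm]] by (rule linear_0)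
  have 1: "(\<Sum>(m, n) \<in> {(m, n) \<in> {0..N} \<times> {1..N}. m + n = N + 1}.
      \<mu> n j \<alpha> \<beta> lam *\<^sub>R Lam (T m j \<alpha> \<beta> lam) y) = 0"
    using m by (intro sum.neutral) auto
  have 2: "(\<Sum>(m, n) \<in> {(m, n) \<in> {0..N} \<times> {1..N}. m + n = N + 1}.
      (b n j \<alpha> \<beta> lam \<bullet> y) *\<^sub>R T m j \<alpha> \<beta> lam y)
      = (if 2 \<le> N then (b 2 j \<alpha> \<beta> lam \<bullet> y) *\<^sub>R T (N - 1) j \<alpha> \<beta> lam y else 0)"
    by (rule sum_pairs_only_two) (simp add: b)
  have "(\<Sum>(m, n) \<in> {(m, n) \<in> {0..N} \<times> {1..N}. m + n = N + 1}.
      dird (b n 2 \<alpha> \<beta> lam - b n 1 \<alpha> \<beta> lam) (\<lambda>v. T m j \<alpha> v lam y) \<beta>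
      + \<mu> n 1 \<alpha> \<beta> lam *\<^sub>R dird (axis 1 1) (\<lambda>l. T m j \<alpha> \<beta> l y) lam
      + \<mu> n 2 \<alpha> \<beta> lam *\<^sub>R dird (axis 2 1) (\<lambda>l. T m j \<alpha> \<beta> l y) lam)
    = (if 2 \<le> N then dird (b 2 2 \<alpha> \<beta> lam - b 2 1 \<alpha> \<beta> lam) (\<lambda>v. T (N - 1) j \<alpha> v lam y) \<beta>
      + \<mu> 2 1 \<alpha> \<beta> lam *\<^sub>R dird (axis 1 1) (\<lambda>l. T (N - 1) j \<alpha> \<beta> l y) lam
      + \<mu> 2 2 \<alpha> \<beta> lam *\<^sub>R dird (axis 2 1) (\<lambda>l. T (N - 1) j \<alpha> \<beta> l y) lam else 0)"
    by (rule sum_pairs_only_two) (simp add: b m d0)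
  then have 3: "(\<Sum>(m, n) \<in> {(m, n) \<in> {0..N} \<times> {1..N}. m + n = N + 1}.
      dird (b n 2 \<alpha> \<beta> lam - b n 1 \<alpha> \<beta> lam) (\<lambda>v. T m j \<alpha> v lam y) \<beta>
      + \<mu> n 1 \<alpha> \<beta> lam *\<^sub>R dird (axis 1 1) (\<lambda>l. T m j \<alpha> \<beta> l y) lam
      + \<mu> n 2 \<alpha> \<beta> lam *\<^sub>R dird (axis 2 1) (\<lambda>l. T m j \<alpha> \<beta> l y) lam)
    = (if 2 \<le> N then dird (b 2 2 \<alpha> \<beta> lam - b 2 1 \<alpha> \<beta> lam) (\<lambda>v. T (N - 1) j \<alpha> v lam y) \<beta> else 0)"
    by (simp add: m)
  show ?thesis
    unfolding Ehat_def 1 2 3 L2norm_Q by (simp only: mult_zero_right diff_zero)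
qed

end

lemma is_rot_comb_id: "is_rot_comb [(1, \<lambda>y. y)]"
  by simp

lemma rot_act_id: "rot_act [(1, \<lambda>y. y)] f = f"
  by simp

lemma scalar_test_rot: "scalar_test W \<Longrightarrow> is_rot_comb W"
  and scalar_test_odd: "scalar_test W \<Longrightarrow> odd_fun f \<Longrightarrow> rot_act W f = (\<lambda>y. 0)"
  and scalar_test_zonal: "scalar_test W \<Longrightarrow> n \<in> {2, 4} \<Longrightarrow> rot_act W (zonal n \<alpha>) = (\<lambda>y. 0)"
  unfolding scalar_test_def by blast+

lemma vector_test_rot: "vector_test e W \<Longrightarrow> is_rot_comb W"
  and vector_test_even: "vector_test e W \<Longrightarrow> even_fun f \<Longrightarrow> rot_act W f = (\<lambda>y. 0)"
  and vector_test_zonal: "vector_test e W \<Longrightarrow> n \<in> {3, 5} \<Longrightarrow> rot_act W (zonal n \<alpha>) = (\<lambda>y. 0)"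
  unfolding vector_test_def by blast+

context profile_construction
begin

section \<open>Orders 1 and 2\<close>

definition vanish :: "nat \<Rightarrow> bool" where
  "vanish N \<longleftrightarrow> (\<forall>j \<alpha> \<beta> lam. admissible \<alpha> lam \<longrightarrow> b N j \<alpha> \<beta> lam = 0 \<and> \<mu> N j \<alpha> \<beta> lam = 0 \<and> (\<forall>y. T N j \<alpha> \<beta> lam y = 0))"

lemma admissible_nz: "admissible \<alpha> lam \<Longrightarrow> \<alpha> \<noteq> 0"
  by (simp add: admissible_def)

text \<open>The identity map is itself a combination, and to be annihilated by it means to be
  zero.\<close>

lemma T_zeroI:
  assumes adm: "admissible \<alpha> lam" and m: "\<mu> (Suc N) j \<alpha> \<beta> lam = 0"
    and s: "\<And>y. lam $ j * (b (Suc N) j \<alpha> \<beta> lam \<bullet> y) * Q y + source N j \<alpha> \<beta> lam y = 0"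
    and i: "\<And>y. Im (Eh N j \<alpha> \<beta> lam y) = 0"
  shows "T (Suc N) j \<alpha> \<beta> lam y = 0"
proof -
  have "reT (Suc N) j \<alpha> \<beta> lam = (\<lambda>y. 0)"
    using reT_annihilated[OF adm s is_rot_comb_id] by (simp only: rot_act_id)
  moreover have "imT (Suc N) j \<alpha> \<beta> lam = (\<lambda>y. 0)"
    using imT_annihilated[OF adm m is_rot_comb_id] i by (simp only: rot_act_id)
  ultimately show ?thesis by (simp add: fun_eq_iff complex_eq_iff)
qed

lemma psi_Q_1:
  assumes "admissible \<alpha> lam"
  shows "psiL chi L 1 (\<lambda>x. (Q x)\<^sup>2) j \<alpha> lam y = - (mass / (4 * pi * lam $ (j + 1)) * (1 / norm \<alpha>))"
  using psi_1[OF admissible_nz[OF assms], of "\<lambda>x. (Q x)\<^sup>2"]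
  by (simp add: psiL_def mass_def power2_eq_square)

text \<open>All terms with T^(1) or T^(2) are gone. Products of two profiles of positive order
  survive only in the cubic sum for N = 5.\<close>

lemma Ehat_low_order:
  assumes adm: "admissible \<alpha> lam" and N: "N \<le> 5"
    and b: "\<And>n j. n \<in> {1..N} \<Longrightarrow> n \<noteq> 2 \<Longrightarrow> b n j \<alpha> \<beta> lam = 0"
    and m: "\<And>n j. n \<in> {1..N} \<Longrightarrow> \<mu> n j \<alpha> \<beta> lam = 0"
    and T: "\<And>n j y. n \<in> {1, 2} \<Longrightarrow> n \<le> N \<Longrightarrow> T n j \<alpha> \<beta> lam y = 0"
  shows "Eh N j \<alpha> \<beta> lam y =
     - (1 / (lam $ j)\<^sup>2) *\<^sub>R
         (if N = 5 then phi (\<lambda>x. Re (T 3 j \<alpha> \<beta> lam x * cnj (T 3 j \<alpha> \<beta> lam x))) y *\<^sub>R T 0 j \<alpha> \<beta> lam y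
            + (phi (\<lambda>x. Re (T 3 j \<alpha> \<beta> lam x * cnj (T 0 j \<alpha> \<beta> lam x))) y *\<^sub>R T 3 j \<alpha> \<beta> lam y
             + phi (\<lambda>x. Re (T 0 j \<alpha> \<beta> lam x * cnj (T 3 j \<alpha> \<beta> lam x))) y *\<^sub>R T 3 j \<alpha> \<beta> lam y) else 0)
     - (\<Sum>i\<in>{3..N}. psiL chi L (N + 1 - i) (\<lambda>x. Re (T i (j + 1) \<alpha> \<beta> lam x * cnj (T 0 (j + 1) \<alpha> \<beta> lam x))) j \<alpha> lam y *\<^sub>R T 0 j \<alpha> \<beta> lam y
          + psiL chi L (N + 1 - i) (\<lambda>x. Re (T 0 (j + 1) \<alpha> \<beta> lam x * cnj (T i (j + 1) \<alpha> \<beta> lam x))) j \<alpha> lam y *\<^sub>R T 0 j \<alpha> \<beta> lam y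
          + psiL chi L (N + 1 - i) (\<lambda>x. Re (T 0 (j + 1) \<alpha> \<beta> lam x * cnj (T 0 (j + 1) \<alpha> \<beta> lam x))) j \<alpha> lam y *\<^sub>R T i j \<alpha> \<beta> lam y)
     - lam $ j *\<^sub>R (if 2 \<le> N then (b 2 j \<alpha> \<beta> lam \<bullet> y) *\<^sub>R T (N - 1) j \<alpha> \<beta> lam y else 0)
     - (mass / (4 * pi * lam $ (j + 1)) * (1 / norm \<alpha>)) *\<^sub>R T N j \<alpha> \<beta> lam y
     + \<i> * dird (2 *\<^sub>R \<beta>) (\<lambda>a. T N j a \<beta> lam y) \<alpha>
     + \<i> * (if 2 \<le> N then dird (b 2 2 \<alpha> \<beta> lam - b 2 1 \<alpha> \<beta> lam) (\<lambda>v. T (N - 1) j \<alpha> v lam y) \<beta> else 0)"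
proof -
  have t: "(\<Sum>(k, l, m) \<in> {(k, l, m) \<in> {0..N} \<times> {0..N} \<times> {0..N}. k + l + m = N + 1}.
            phi (\<lambda>x. Re (T k j \<alpha> \<beta> lam x * cnj (T l j \<alpha> \<beta> lam x))) y *\<^sub>R T m j \<alpha> \<beta> lam y)
      = (if N = 5 then phi (\<lambda>x. Re (T 3 j \<alpha> \<beta> lam x * cnj (T 3 j \<alpha> \<beta> lam x))) y *\<^sub>R T 0 j \<alpha> \<beta> lam y
            + (phi (\<lambda>x. Re (T 3 j \<alpha> \<beta> lam x * cnj (T 0 j \<alpha> \<beta> lam x))) y *\<^sub>R T 3 j \<alpha> \<beta> lam y
             + phi (\<lambda>x. Re (T 0 j \<alpha> \<beta> lam x * cnj (T 3 j \<alpha> \<beta> lam x))) y *\<^sub>R T 3 j \<alpha> \<beta> lam y) else 0)"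
    by (rule sum_triples[OF N]) (elim disjE; simp add: T phi_def)
  have q: "(\<Sum>(k, l, m, n) \<in> {(k, l, m, n) \<in> {0..N} \<times> {0..N} \<times> {0..N} \<times> {1..N}. k + l + m + n = N + 1}.
            psiL chi L n (\<lambda>x. Re (T k (j + 1) \<alpha> \<beta> lam x * cnj (T l (j + 1) \<alpha> \<beta> lam x))) j \<alpha> lam y *\<^sub>R T m j \<alpha> \<beta> lam y)
      = (\<Sum>i\<in>{3..N}. psiL chi L (N + 1 - i) (\<lambda>x. Re (T i (j + 1) \<alpha> \<beta> lam x * cnj (T 0 (j + 1) \<alpha> \<beta> lam x))) j \<alpha> lam y *\<^sub>R T 0 j \<alpha> \<beta> lam y
          + psiL chi L (N + 1 - i) (\<lambda>x. Re (T 0 (j + 1) \<alpha> \<beta> lam x * cnj (T i (j + 1) \<alpha> \<beta> lam x))) j \<alpha> lam y *\<^sub>R T 0 j \<alpha> \<beta> lam y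
          + psiL chi L (N + 1 - i) (\<lambda>x. Re (T 0 (j + 1) \<alpha> \<beta> lam x * cnj (T 0 (j + 1) \<alpha> \<beta> lam x))) j \<alpha> lam y *\<^sub>R T i j \<alpha> \<beta> lam y)"
    by (rule sum_quadruples[OF N]) (elim disjE; simp add: T psiL_def psi_def)
  show ?thesis
    by (subst Ehat_reduced[OF adm b m], assumption, assumption, assumption) (simp only: t q)
qed

text \<open>The source consists of \<psi>^(1) of Q^2 and the explicit mass term, which cancel
  identically.\<close>

lemma order_1: "vanish 1"
  unfolding vanish_def
proof (intro allI impI)
  fix j \<alpha> \<beta> lam
  assume adm: "admissible \<alpha> lam"
  \<comment> \<open>\<open>T 0\<close> is known to be Q only at admissible parameters, so constancy
    is used on a neighbourhood of \<alpha>.\<close>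
  have "dird v (\<lambda>a. T 0 j a \<beta> lam y) \<alpha> = 0" for v y
  proof (rule dird_eventually_const[OF T_diff(1)[OF adm]])
    show "\<forall>\<^sub>F a in nhds \<alpha>. T 0 j a \<beta> lam y = of_real (Q y)"
      using admissible_eventually[OF adm] by eventually_elim (rule T_0)
  qed
  then have E: "Eh 0 j \<alpha> \<beta> lam y = of_real (- (mass / (4 * pi * lam $ (j + 1)) * (1 / norm \<alpha>)) * Q y)" for y
    by (subst Ehat_low_order[OF adm]) (simp_all add: T_0[OF adm] scaleR_conv_of_real)
  have s: "source 0 j \<alpha> \<beta> lam = (\<lambda>y. 0)"
    using psi_Q_1[OF adm] by (simp add: source_def E fun_eq_iff)
  have i: "Im (Eh 0 j \<alpha> \<beta> lam y) = 0" for y by (simp add: E)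
  have b: "b (Suc 0) j \<alpha> \<beta> lam = 0" by (rule b_eq_0[OF adm]) (simp add: s rot_act_zero)
  have m: "\<mu> (Suc 0) j \<alpha> \<beta> lam = 0" by (rule mu_eq_0[OF adm]) (simp add: i rot_act_zero)
  show "b 1 j \<alpha> \<beta> lam = 0 \<and> \<mu> 1 j \<alpha> \<beta> lam = 0 \<and> (\<forall>y. T 1 j \<alpha> \<beta> lam y = 0)"
    using b m T_zeroI[OF adm m _ i] by (simp add: s)
qed

text \<open>For these N every remaining term contains T^(1) or T^(2), which vanish also for nearby
  \<alpha>. The next order is then driven by \<psi>^(N+1) of Q^2 alone; b^(2) is free to be
  nonzero.\<close>

lemma Ehat_zero:
  assumes adm: "admissible \<alpha> lam" and N: "N = Suc 0 \<or> N = 2"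
    and b: "\<And>j. b 1 j \<alpha> \<beta> lam = 0" and m: "\<And>n j. n \<in> {1..N} \<Longrightarrow> \<mu> n j \<alpha> \<beta> lam = 0"
    and T: "\<And>n j \<alpha> \<beta> y. n \<in> {1..N} \<Longrightarrow> admissible \<alpha> lam \<Longrightarrow> T n j \<alpha> \<beta> lam y = 0"
  shows "Eh N j \<alpha> \<beta> lam y = 0"
proof -
  have N5: "N \<le> 5" "N \<noteq> 5" "{3..N} = {}" using N by auto
  have bn: "b n j \<alpha> \<beta> lam = 0" if "n \<in> {1..N}" "n \<noteq> 2" for n j
  proof -
    have "n = 1" using that N by auto
    then show ?thesis using b by simp
  qed
  have T0: "T n j \<alpha> \<beta> lam y = 0" if "n \<in> {1, 2}" "n \<le> N" for n j y
    using T[OF _ adm, of n] that by auto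
  have d: "dird v (\<lambda>a. T N j a \<beta> lam y) \<alpha> = 0" for v
  proof (rule dird_eventually_const[OF T_diff(1)[OF adm]])
    show "\<forall>\<^sub>F a in nhds \<alpha>. T N j a \<beta> lam y = 0"
      using admissible_eventually[OF adm] by eventually_elim (use T[of N] N in auto)
  qed
  have "T (N - 1) j \<alpha> v lam y = 0" if "2 \<le> N" for v
    using T[OF _ adm, of "N - 1"] that N by auto
  then have 1: "(if 2 \<le> N then dird v (\<lambda>v. T (N - 1) j \<alpha> v lam y) \<beta> else 0) = 0"
    "(if 2 \<le> N then c *\<^sub>R T (N - 1) j \<alpha> \<beta> lam y else 0) = 0" for v c
    by (simp_all add: dird_const)
  have 2: "T N j \<alpha> \<beta> lam y = 0" using T0[of N] N by auto
  show ?thesis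
    by (subst Ehat_low_order[OF adm N5(1)], erule (1) bn, erule m, erule (1) T0)
      (simp only: 1 2 d N5 sum.empty if_False, simp)
qed

text \<open>The field \<psi>^(2) of Q^2 is linear in y, exactly the shape of the b-term. Choosing
  b^(2) = - w cancels it completely, so no profile is left. The last conclusion is the cancellation
  needed again in \<open>Ehat_4\<close> and \<open>Ehat_5\<close>.\<close>

lemma
  assumes adm: "admissible \<alpha> lam"
  shows b_2: "b 2 j \<alpha> \<beta> lam = (sg (j - 1) * mass / (4 * pi * lam $ (j + 1))) *\<^sub>R ((1 / norm \<alpha> ^ 3) *\<^sub>R \<alpha>)"
    and mu_2: "\<mu> 2 j \<alpha> \<beta> lam = 0" and T_2: "T 2 j \<alpha> \<beta> lam y = 0"
    and psi_Q_2: "psiL chi L 2 (\<lambda>x. (Q x)\<^sup>2) j \<alpha> lam y = - lam $ j * (b 2 j \<alpha> \<beta> lam \<bullet> y)"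
proof -
  define w where "w = (sg j * mass / (4 * pi * lam $ (j + 1))) *\<^sub>R ((1 / norm \<alpha> ^ 3) *\<^sub>R \<alpha>)"
  have E: "Eh (Suc 0) j \<alpha> \<beta> lam y = 0" for y
  proof (rule Ehat_zero[OF adm])
    show "b 1 j \<alpha> \<beta> lam = 0" for j using order_1 adm unfolding vanish_def by blast
    show "\<mu> n j \<alpha> \<beta> lam = 0" if "n \<in> {1..Suc 0}" for n j
      using order_1 adm that unfolding vanish_def by (simp add: le_antisym)
    show "T n j \<alpha> \<beta> lam y = 0" if "n \<in> {1..Suc 0}" "admissible \<alpha> lam" for n j \<alpha> \<beta> y
      using order_1 that unfolding vanish_def by (simp add: le_antisym)
  qed simp
  have psi: "psiL chi L (Suc (Suc 0)) (\<lambda>x. (Q x)\<^sup>2) j \<alpha> lam y = lam $ j * (w \<bullet> y)" for y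
  proof -
    have "psi (Suc (Suc 0)) (\<lambda>x. Q x * Q x) j \<alpha> lam y
        = (LINT x|lborel. Q x * Q x) * sg j * lam $ j / (4 * pi * lam $ (j + 1)) * (\<alpha> \<bullet> y) / norm \<alpha> ^ 3"
      by (rule psi_2_even[OF admissible_nz[OF adm]])
        (auto simp: even_fun_def Q_minus intro!: continuous_intros Q_cont exp_decaying_mult Q_exp)
    then show ?thesis
      by (simp add: psiL_def power2_eq_square mass_def w_def)
  qed
  have s: "source (Suc 0) j \<alpha> \<beta> lam = (\<lambda>y. lam $ j * (w \<bullet> y) * Q y)"
    by (rule ext) (simp add: source_def E psi)
  have b: "b (Suc (Suc 0)) j \<alpha> \<beta> lam = - w"
    using vector_test_exists by (intro b_eq[OF adm]) (simp add: s rot_act_zero)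
  have m: "\<mu> (Suc (Suc 0)) j \<alpha> \<beta> lam = 0" by (rule mu_eq_0[OF adm]) (simp add: E rot_act_zero)
  show "b 2 j \<alpha> \<beta> lam = (sg (j - 1) * mass / (4 * pi * lam $ (j + 1))) *\<^sub>R ((1 / norm \<alpha> ^ 3) *\<^sub>R \<alpha>)"
    using b by (simp add: w_def sg_pred numeral_2_eq_2)
  show "\<mu> 2 j \<alpha> \<beta> lam = 0" using m by (simp add: numeral_2_eq_2)
  have "T (Suc (Suc 0)) j \<alpha> \<beta> lam y = 0"
    by (rule T_zeroI[OF adm m]) (simp_all add: b s E)
  then show "T 2 j \<alpha> \<beta> lam y = 0" by (simp add: numeral_2_eq_2)
  show "psiL chi L 2 (\<lambda>x. (Q x)\<^sup>2) j \<alpha> lam y = - lam $ j * (b 2 j \<alpha> \<beta> lam \<bullet> y)"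
    using b psi[of y] by (simp add: numeral_2_eq_2)
qed

lemma T_1: "admissible \<alpha> lam \<Longrightarrow> T 1 j \<alpha> \<beta> lam y = 0" and b_1: "admissible \<alpha> lam \<Longrightarrow> b 1 j \<alpha> \<beta> lam = 0"
  and mu_1: "admissible \<alpha> lam \<Longrightarrow> \<mu> 1 j \<alpha> \<beta> lam = 0"
  using order_1 unfolding vanish_def by blast+

lemma T_12: "admissible \<alpha> lam \<Longrightarrow> n \<in> {1, 2} \<Longrightarrow> T n j \<alpha> \<beta> lam y = 0"
  using T_1 T_2 by auto

lemma psiL_Q_even:
  assumes adm: "admissible \<alpha> lam" and n: "n < 10" and ev: "even n"
  shows "even_fun (\<lambda>y. psiL chi L (n + 1) (\<lambda>x. (Q x)\<^sup>2) j \<alpha> lam y * Q y)"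
  unfolding even_fun_iff
  by (rule psiL_Q_annihilated[OF adm n is_rot_comb_parity]) (simp add: parity_zonal ev)

lemma psiL_Q_odd:
  assumes adm: "admissible \<alpha> lam" and n: "n < 10" and od: "odd n"
  shows "odd_fun (\<lambda>y. psiL chi L (n + 1) (\<lambda>x. (Q x)\<^sup>2) j \<alpha> lam y * Q y)"
  unfolding odd_fun_iff
  by (rule psiL_Q_annihilated[OF adm n is_rot_comb_parity]) (simp add: parity_zonal od)

subsection \<open>Order 3\<close>

text \<open>\<open>Ehat\<close> vanishes at N = 2, so the only source is \<psi>^(3) of Q^2, real and
  of degree 2. This gives even parity and the scalar tests, and since \<beta> does not enter it,
  independence of \<beta>.\<close>

lemma
  assumes adm: "admissible \<alpha> lam"
  shows b_3: "b 3 j \<alpha> \<beta> lam = 0" and mu_3: "\<mu> 3 j \<alpha> \<beta> lam = 0"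
    and imT_3: "imT 3 j \<alpha> \<beta> lam y = 0"
    and reT_3_even: "even_fun (reT 3 j \<alpha> \<beta> lam)"
    and reT_3_scalar: "scalar_test W \<Longrightarrow> rot_act W (reT 3 j \<alpha> \<beta> lam) = (\<lambda>y. 0)"
    and reT_3_indep: "reT 3 j \<alpha> \<beta> lam = reT 3 j \<alpha> \<beta>' lam"
proof -
  have E: "Eh 2 j \<alpha> \<beta> lam y = 0" for y \<beta>
  proof (rule Ehat_zero[OF adm])
    show "\<mu> n j \<alpha> \<beta> lam = 0" if "n \<in> {1..2}" for n j
      using that mu_1[OF adm] mu_2[OF adm] by (cases "n = 1") (auto simp: le_Suc_eq numeral_2_eq_2)
    show "T n j \<alpha> \<beta> lam y = 0" if "n \<in> {1..2}" "admissible \<alpha> lam" for n j \<alpha> \<beta> y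
      using that by (intro T_12) auto
    show "b 1 j \<alpha> \<beta> lam = 0" for j by (rule b_1[OF adm])
  qed simp
  have s: "source 2 j \<alpha> \<beta> lam = (\<lambda>y. psiL chi L (2 + 1) (\<lambda>x. (Q x)\<^sup>2) j \<alpha> lam y * Q y)" for \<beta>
    by (simp add: source_def E fun_eq_iff)
  have sev: "even_fun (source 2 j \<alpha> \<beta> lam)" for \<beta>
    unfolding s by (rule psiL_Q_even[OF adm]) simp_all
  have b: "b (Suc 2) j \<alpha> \<beta> lam = 0" for \<beta>
    by (rule b_eq_0[OF adm]) (rule vector_test_even[OF _ sev])
  have m: "\<mu> (Suc 2) j \<alpha> \<beta> lam = 0" by (rule mu_eq_0[OF adm]) (simp add: E rot_act_zero)
  have S: "rot_act W (reT (Suc 2) j \<alpha> \<beta> lam) = (\<lambda>y. 0)" if "is_rot_comb W" "rot_act W (source 2 j \<alpha> \<beta> lam) = (\<lambda>y. 0)" for W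
    by (rule reT_annihilated[OF adm _ that]) (simp only: b inner_zero_left mult_zero_right mult_zero_left add_0_left)
  have I: "rot_act [(1, \<lambda>y. y)] (imT (Suc 2) j \<alpha> \<beta> lam) = (\<lambda>y. 0)"
    by (rule imT_annihilated[OF adm m is_rot_comb_id]) (simp add: E)
  have Ev: "even_fun (reT (Suc 2) j \<alpha> \<beta> lam)"
    unfolding even_fun_iff by (rule S[OF is_rot_comb_parity]) (use sev in \<open>simp only: even_fun_iff\<close>)
  have Sc: "rot_act W (reT (Suc 2) j \<alpha> \<beta> lam) = (\<lambda>y. 0)" if W: "scalar_test W"
    by (rule S[OF scalar_test_rot[OF W]], unfold s, rule psiL_Q_annihilated[OF adm _ scalar_test_rot[OF W] scalar_test_zonal[OF W]]) simp_all
  have In: "reT (Suc 2) j \<alpha> \<beta> lam = reT (Suc 2) j \<alpha> \<beta>' lam"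
    by (rule reT_indep[OF adm b b]) (simp add: s)
  show "b 3 j \<alpha> \<beta> lam = 0" "\<mu> 3 j \<alpha> \<beta> lam = 0" "imT 3 j \<alpha> \<beta> lam y = 0" "even_fun (reT 3 j \<alpha> \<beta> lam)"
    "reT 3 j \<alpha> \<beta> lam = reT 3 j \<alpha> \<beta>' lam"
    using b m I Ev In by (simp_all add: fun_eq_iff)
  show "scalar_test W \<Longrightarrow> rot_act W (reT 3 j \<alpha> \<beta> lam) = (\<lambda>y. 0)"
    using Sc by simp
qed

end

context profile_construction
begin

section \<open>Ingredients for orders 4 to 6\<close>

lemma alpha_derivative_annihilated:
  assumes adm: "admissible \<alpha> lam" and B: "bounded_linear B"
    and W: "\<And>a. admissible a lam \<Longrightarrow> rot_act W (\<lambda>y. B (T N j a \<beta> lam y)) = (\<lambda>y. 0)"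
  shows "rot_act W (\<lambda>y. B (dird v (\<lambda>a. T N j a \<beta> lam y) \<alpha>)) = (\<lambda>y. 0)"
  by (rule rot_act_dird[OF B T_diff(1)[OF adm]])
    (use admissible_eventually[OF adm] in eventually_elim, rule W)

lemma beta_derivative_annihilated:
  assumes adm: "admissible \<alpha> lam" and B: "bounded_linear B"
    and W: "\<And>v. rot_act W (\<lambda>y. B (T N j \<alpha> v lam y)) = (\<lambda>y. 0)"
  shows "rot_act W (\<lambda>y. B (dird v (\<lambda>v. T N j \<alpha> v lam y) \<beta>)) = (\<lambda>y. 0)"
  by (rule rot_act_dird[OF B T_diff(2)[OF adm]]) (simp add: W)

lemma Re_T_T0:
  assumes adm: "admissible \<alpha> lam"
  shows "(\<lambda>x. Re (T 0 j \<alpha> \<beta> lam x * cnj (T 0 j \<alpha> \<beta> lam x))) = (\<lambda>x. (Q x)\<^sup>2)"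
    "(\<lambda>x. Re (T i j \<alpha> \<beta> lam x * cnj (T 0 j \<alpha> \<beta> lam x))) = (\<lambda>x. Q x * reT i j \<alpha> \<beta> lam x)"
    "(\<lambda>x. Re (T 0 j \<alpha> \<beta> lam x * cnj (T i j \<alpha> \<beta> lam x))) = (\<lambda>x. Q x * reT i j \<alpha> \<beta> lam x)"
  by (simp_all add: T_0[OF adm] fun_eq_iff power2_eq_square)

text \<open>The density Q Re T^(i) enters the source of the next order through its monopole field
  \<psi>^(1); with total mass 0 this field disappears.\<close>

lemma integral_Q_reT:
  assumes adm: "admissible \<alpha> lam"
    and W: "\<And>W. scalar_test W \<Longrightarrow> rot_act W (reT (Suc N) j \<alpha> \<beta> lam) = (\<lambda>y. 0)"
  shows "(LINT x|lborel. Q x * reT (Suc N) j \<alpha> \<beta> lam x) = 0"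
proof -
  obtain W where "scalar_test W" using scalar_test_exists by blast
  moreover have "integrable lborel (\<lambda>y. reT (Suc N) j \<alpha> \<beta> lam y * Q y)"
    using integrable_exp_decaying[OF Q_mult_cont_exp[OF T_regular(1,2)[OF adm]]] by (simp add: mult.commute)
  ultimately have "(LINT y|lborel. reT (Suc N) j \<alpha> \<beta> lam y * Q y) = 0"
    using W by (intro scalar_test_integral)
  then show ?thesis by (simp add: mult.commute)
qed

lemma psiL_1_zero:
  assumes "admissible \<alpha> lam" "(LINT x|lborel. f x) = 0"
  shows "psiL chi L (Suc 0) f j \<alpha> lam y = 0"
  using psi_1[OF admissible_nz[OF assms(1)], of f j lam y] assms(2) by (simp add: psiL_def)

text \<open>Degree n and the density contribute the same sign, and the two cancel.\<close>

lemma psiL_even: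
  assumes adm: "admissible \<alpha> lam" and n: "n < 10" and f: "\<And>x. f (- x) = (-1) ^ n * f x"
  shows "psiL chi L (Suc n) f j \<alpha> lam (- y) = psiL chi L (Suc n) f j \<alpha> lam y"
proof -
  have "psi (Suc n) f j \<alpha> lam (- y) = (-1) ^ n * (-1) ^ n * psi (Suc n) f j \<alpha> lam y"
    by (rule psi_parity[where f = f and s = "(-1) ^ n", OF admissible_nz[OF adm] f])
  also have "\<dots> = psi (Suc n) f j \<alpha> lam y"
    by (simp add: power_add[symmetric])
  finally show ?thesis using n by (simp add: psiL_def)
qed

lemma phi_even:
  assumes "\<And>x. f (- x) = f x"
  shows "phi f (- y) = phi f y"
proof -
  have "phi (\<lambda>x. f (- x)) y = phi f (- y)"
    by (rule phi_orthogonal) (simp add: orthogonal_transformation_neg)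
  then show ?thesis by (simp only: assms)
qed

lemma psi_Q_1': "admissible \<alpha> lam \<Longrightarrow>
    psiL chi L (Suc 0) (\<lambda>x. (Q x)\<^sup>2) j \<alpha> lam y = - (mass / (4 * pi * lam $ (j + 1)) * (1 / norm \<alpha>))"
  using psi_Q_1 by (simp only: One_nat_def)

lemma integral_Q_reT_3:
  assumes "admissible \<alpha> lam"
  shows "(LINT x|lborel. Q x * reT 3 j \<alpha> \<beta> lam x) = 0"
  using integral_Q_reT[OF assms, of 2 j \<beta>] reT_3_scalar[OF assms] by (simp add: numeral_3_eq_3 numeral_2_eq_2)

lemma one_to_three: "n \<in> {1..3} \<longleftrightarrow> n = 1 \<or> n = 2 \<or> n = (3::nat)"
  by auto

text \<open>\<psi>^(1) of Q^2 times T^(3) cancels the mass term, \<psi>^(1) of Q T^(3) is zero for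
  lack of mass, and the terms with b^(2) meet T^(2) = 0.\<close>

lemma Ehat_3:
  assumes adm: "admissible \<alpha> lam"
  shows "Eh 3 j \<alpha> \<beta> lam y = \<i> * dird (2 *\<^sub>R \<beta>) (\<lambda>a. T 3 j a \<beta> lam y) \<alpha>"
proof -
  have bn: "b n j \<alpha> \<beta> lam = 0" if "n \<in> {1..3}" "n \<noteq> 2" for n j
    using that b_1[OF adm] b_3[OF adm] unfolding one_to_three by blast
  have mn: "\<mu> n j \<alpha> \<beta> lam = 0" if "n \<in> {1..3}" for n j
    using that mu_1[OF adm] mu_2[OF adm] mu_3[OF adm] unfolding one_to_three by blast
  have d: "dird v (\<lambda>v. T 2 j \<alpha> v lam y) \<beta> = 0" for v
    by (simp add: T_2[OF adm] dird_const)
  have ar: "3 + 1 - 3 = Suc 0" "3 - 1 = (2::nat)" "(3::nat) \<noteq> 5" "2 \<le> (3::nat)" "{3..3} = {3::nat}" by auto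
  have p1: "psiL chi L (Suc 0) (\<lambda>x. Q x * reT 3 (j + 1) \<alpha> \<beta> lam x) j \<alpha> lam y = 0"
    by (rule psiL_1_zero[OF adm integral_Q_reT_3[OF adm]])
  show ?thesis
    by (subst Ehat_low_order[OF adm], simp, erule (1) bn, erule mn, erule T_12[OF adm])
      (simp only: ar if_True if_False Re_T_T0(1)[OF adm] Re_T_T0(2,3)[OF adm, where i = 3] sum.insert sum.empty
        finite.emptyI empty_iff not_False_eq_True p1 d psi_Q_1'[OF adm], simp add: T_2[OF adm])
qed

subsection \<open>Order 4\<close>

text \<open>T^(3) is real and its \<alpha>-derivative carries a factor i, so it feeds the imaginary
  part alone, which inherits even parity and the scalar tests. The real part is driven by \<psi>^(4)
  of Q^2, of degree 3: odd and annihilated by vector tests.\<close>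

lemma
  assumes adm: "admissible \<alpha> lam"
  shows b_4: "b 4 j \<alpha> \<beta> lam = 0" and mu_4: "\<mu> 4 j \<alpha> \<beta> lam = 0"
    and reT_4_odd: "odd_fun (reT 4 j \<alpha> \<beta> lam)"
    and reT_4_vector: "vector_test e W \<Longrightarrow> rot_act W (reT 4 j \<alpha> \<beta> lam) = (\<lambda>y. 0)"
    and reT_4_indep: "reT 4 j \<alpha> \<beta> lam = reT 4 j \<alpha> \<beta>' lam"
    and imT_4_even: "even_fun (imT 4 j \<alpha> \<beta> lam)"
    and imT_4_scalar: "scalar_test W \<Longrightarrow> rot_act W (imT 4 j \<alpha> \<beta> lam) = (\<lambda>y. 0)"
proof -
  define D where "D = (\<lambda>\<beta> y. dird (2 *\<^sub>R \<beta>) (\<lambda>a. T 3 j a \<beta> lam y) \<alpha>)"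
  have ImD: "Im (D \<beta> y) = 0" for \<beta> y
  proof -
    have "rot_act [(1, \<lambda>y. y)] (\<lambda>y. Im (D \<beta> y)) = (\<lambda>y. 0)"
      unfolding D_def by (rule alpha_derivative_annihilated[OF adm bounded_linear_Im]) (simp add: imT_3)
    then show ?thesis unfolding rot_act_id by meson
  qed
  have ReD: "rot_act W (\<lambda>y. Re (D \<beta> y)) = (\<lambda>y. 0)"
    if "\<And>a. admissible a lam \<Longrightarrow> rot_act W (reT 3 j a \<beta> lam) = (\<lambda>y. 0)" for W \<beta>
    unfolding D_def by (rule alpha_derivative_annihilated[OF adm bounded_linear_Re that])
  have E: "Re (Eh 3 j \<alpha> \<beta> lam y) = 0" "Im (Eh 3 j \<alpha> \<beta> lam y) = Re (D \<beta> y)" for \<beta> y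
    using ImD[of \<beta> y] by (simp_all add: Ehat_3[OF adm] D_def)
  have s: "source 3 j \<alpha> \<beta> lam = (\<lambda>y. psiL chi L (3 + 1) (\<lambda>x. (Q x)\<^sup>2) j \<alpha> lam y * Q y)" for \<beta>
    by (rule ext) (simp only: source_def E diff_zero)
  have vs: "rot_act W (source 3 j \<alpha> \<beta> lam) = (\<lambda>y. 0)" if W: "vector_test e W" for W e \<beta>
    unfolding s by (rule psiL_Q_annihilated[OF adm _ vector_test_rot[OF W] vector_test_zonal[OF W]]) simp_all
  have so: "odd_fun (source 3 j \<alpha> \<beta> lam)" for \<beta>
    unfolding s by (rule psiL_Q_odd[OF adm]) simp_all
  have I_even: "rot_act (parity (-1)) (\<lambda>y. Im (Eh 3 j \<alpha> \<beta> lam y)) = (\<lambda>y. 0)"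
    unfolding E by (rule ReD) (use reT_3_even in \<open>simp only: even_fun_iff\<close>)
  have I_scalar: "rot_act W (\<lambda>y. Im (Eh 3 j \<alpha> \<beta> lam y)) = (\<lambda>y. 0)" if "scalar_test W" for W
    unfolding E by (rule ReD) (rule reT_3_scalar[OF _ that])
  have b: "b (Suc 3) j \<alpha> \<beta> lam = 0" for \<beta> by (rule b_eq_0[OF adm vs])
  have m: "\<mu> (Suc 3) j \<alpha> \<beta> lam = 0" by (rule mu_eq_0[OF adm I_scalar])
  have R: "rot_act W (reT (Suc 3) j \<alpha> \<beta> lam) = (\<lambda>y. 0)" if "is_rot_comb W" "rot_act W (source 3 j \<alpha> \<beta> lam) = (\<lambda>y. 0)" for W
    by (rule reT_annihilated[OF adm _ that]) (simp only: b inner_zero_left mult_zero_right mult_zero_left add_0_left)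
  have 1: "odd_fun (reT (Suc 3) j \<alpha> \<beta> lam)"
    unfolding odd_fun_iff by (rule R[OF is_rot_comb_parity]) (use so in \<open>simp only: odd_fun_iff\<close>)
  have 2: "rot_act W (reT (Suc 3) j \<alpha> \<beta> lam) = (\<lambda>y. 0)" if W: "vector_test e W"
    by (rule R[OF vector_test_rot[OF W] vs[OF W]])
  have 3: "reT (Suc 3) j \<alpha> \<beta> lam = reT (Suc 3) j \<alpha> \<beta>' lam"
    by (rule reT_indep[OF adm b b]) (simp only: s)
  have 4: "even_fun (imT (Suc 3) j \<alpha> \<beta> lam)"
    unfolding even_fun_iff by (rule imT_annihilated[OF adm m is_rot_comb_parity I_even])
  have 5: "rot_act W (imT (Suc 3) j \<alpha> \<beta> lam) = (\<lambda>y. 0)" if W: "scalar_test W"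
    by (rule imT_annihilated[OF adm m scalar_test_rot[OF W] I_scalar[OF W]])
  have S3: "Suc 3 = 4" by simp
  show "b 4 j \<alpha> \<beta> lam = 0" "\<mu> 4 j \<alpha> \<beta> lam = 0" "odd_fun (reT 4 j \<alpha> \<beta> lam)"
    "reT 4 j \<alpha> \<beta> lam = reT 4 j \<alpha> \<beta>' lam" "even_fun (imT 4 j \<alpha> \<beta> lam)"
    using b[of \<beta>] m 1 3 4 unfolding S3 .
  show "vector_test e W \<Longrightarrow> rot_act W (reT 4 j \<alpha> \<beta> lam) = (\<lambda>y. 0)" using 2 unfolding S3 .
  show "scalar_test W \<Longrightarrow> rot_act W (imT 4 j \<alpha> \<beta> lam) = (\<lambda>y. 0)" using 5 unfolding S3 .
qed

lemma integral_Q_reT_4: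
  assumes "admissible \<alpha> lam"
  shows "(LINT x|lborel. Q x * reT 4 j \<alpha> \<beta> lam x) = 0"
proof -
  have "Suc 3 = 4" by simp
  then show ?thesis
    using integral_Q_reT[OF assms, of 3 j \<beta>] scalar_test_odd[OF _ reT_4_odd[OF assms]] by simp
qed

text \<open>\<psi>^(2) sees only the mass and the dipole moment of the density; the first is 0 and
  evenness removes the second.\<close>

lemma psi_2_QT3:
  assumes adm: "admissible \<alpha> lam"
  shows "psiL chi L 2 (\<lambda>x. Q x * reT 3 (j + 1) \<alpha> \<beta> lam x) j \<alpha> lam y = 0"
proof -
  have T: "Ck 2 (reT 3 (j + 1) \<alpha> \<beta> lam)" "exp_decaying (reT 3 (j + 1) \<alpha> \<beta> lam)"
    using T_regular(1,2)[OF adm, of 2] by (simp_all add: numeral_3_eq_3 numeral_2_eq_2)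
  have "psi (Suc (Suc 0)) (\<lambda>x. Q x * reT 3 (j + 1) \<alpha> \<beta> lam x) j \<alpha> lam y = 0"
    by (subst psi_2_even[OF admissible_nz[OF adm] Q_mult_cont_exp[OF T]])
      (use reT_3_even[OF adm] in \<open>simp_all add: even_fun_def Q_minus integral_Q_reT_3[OF adm]\<close>)
  then show ?thesis by (simp add: psiL_def numeral_2_eq_2)
qed

lemma one_to_four: "n \<in> {1..4} \<longleftrightarrow> n = 1 \<or> n = 2 \<or> n = 3 \<or> n = (4::nat)"
  by auto

text \<open>In addition to the cancellation of the mass term, \<psi>^(2) of Q^2 times T^(3) now
  cancels the b^(2)-term, and the \<beta>-derivative falls on T^(3), which does not depend on
  \<beta>.\<close>

lemma Ehat_4:
  assumes adm: "admissible \<alpha> lam"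
  shows "Eh 4 j \<alpha> \<beta> lam y = \<i> * dird (2 *\<^sub>R \<beta>) (\<lambda>a. T 4 j a \<beta> lam y) \<alpha>"
proof -
  have bn: "b n j \<alpha> \<beta> lam = 0" if "n \<in> {1..4}" "n \<noteq> 2" for n j
    using that b_1[OF adm] b_3[OF adm] b_4[OF adm] unfolding one_to_four by blast
  have mn: "\<mu> n j \<alpha> \<beta> lam = 0" if "n \<in> {1..4}" for n j
    using that mu_1[OF adm] mu_2[OF adm] mu_3[OF adm] mu_4[OF adm] unfolding one_to_four by blast
  have d: "dird v (\<lambda>v. T 3 j \<alpha> v lam y) \<beta> = 0" for v
  proof -
    have "T 3 j \<alpha> v lam y = T 3 j \<alpha> \<beta> lam y" for v
      using fun_cong[OF reT_3_indep[OF adm, of j v \<beta>], of y] imT_3[OF adm] by (simp add: complex_eq_iff)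
    then have "(\<lambda>v. T 3 j \<alpha> v lam y) = (\<lambda>v. T 3 j \<alpha> \<beta> lam y)" by blast
    then show ?thesis by (simp only: dird_const)
  qed
  have ar: "4 + 1 - 3 = (2::nat)" "4 + 1 - 4 = Suc 0" "4 - 1 = (3::nat)" "(4::nat) \<noteq> 5" "2 \<le> (4::nat)" "{3..4} = {3, 4::nat}"
    "3 \<notin> {4::nat}" by auto
  have p1: "psiL chi L (Suc 0) (\<lambda>x. Q x * reT 4 (j + 1) \<alpha> \<beta> lam x) j \<alpha> lam y = 0"
    by (rule psiL_1_zero[OF adm integral_Q_reT_4[OF adm]])
  show ?thesis
    by (subst Ehat_low_order[OF adm], simp, erule (1) bn, erule mn, erule T_12[OF adm])
      (simp only: ar if_True if_False Re_T_T0(1)[OF adm] Re_T_T0(2,3)[OF adm, where i = 3] Re_T_T0(2,3)[OF adm, where i = 4]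
        sum.insert sum.empty finite.emptyI finite.insertI empty_iff not_False_eq_True p1 d psi_2_QT3[OF adm]
        psi_Q_1'[OF adm] psi_Q_2[OF adm, of j y \<beta>], simp add: algebra_simps)
qed

subsection \<open>Order 5\<close>

text \<open>The factor i exchanges the parts of T^(4). The real source gets the \<alpha>-derivative
  of the even imaginary part beside \<psi>^(5) of degree 4; the imaginary source gets that of the
  odd real part, which both kinds of tests annihilate.\<close>

lemma
  assumes adm: "admissible \<alpha> lam"
  shows b_5: "b 5 j \<alpha> \<beta> lam = 0" and mu_5: "\<mu> 5 j \<alpha> \<beta> lam = 0"
    and reT_5_scalar: "scalar_test W \<Longrightarrow> rot_act W (reT 5 j \<alpha> \<beta> lam) = (\<lambda>y. 0)"
    and imT_5_vector: "vector_test e W \<Longrightarrow> rot_act W (imT 5 j \<alpha> \<beta> lam) = (\<lambda>y. 0)"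
proof -
  define D where "D = (\<lambda>y. dird (2 *\<^sub>R \<beta>) (\<lambda>a. T 4 j a \<beta> lam y) \<alpha>)"
  have ImD: "rot_act W (\<lambda>y. Im (D y)) = (\<lambda>y. 0)"
    if "\<And>a. admissible a lam \<Longrightarrow> rot_act W (imT 4 j a \<beta> lam) = (\<lambda>y. 0)" for W
    unfolding D_def by (rule alpha_derivative_annihilated[OF adm bounded_linear_Im that])
  have ReD: "rot_act W (\<lambda>y. Re (D y)) = (\<lambda>y. 0)"
    if "\<And>a. admissible a lam \<Longrightarrow> rot_act W (reT 4 j a \<beta> lam) = (\<lambda>y. 0)" for W
    unfolding D_def by (rule alpha_derivative_annihilated[OF adm bounded_linear_Re that])
  have E: "Re (Eh 4 j \<alpha> \<beta> lam y) = - Im (D y)" "Im (Eh 4 j \<alpha> \<beta> lam y) = Re (D y)" for y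
    by (simp_all add: Ehat_4[OF adm] D_def)
  have s: "source 4 j \<alpha> \<beta> lam = (\<lambda>y. psiL chi L (4 + 1) (\<lambda>x. (Q x)\<^sup>2) j \<alpha> lam y * Q y + Im (D y))"
    by (rule ext) (simp only: source_def E diff_minus_eq_add)
  have "even_fun (\<lambda>y. Im (D y))"
    unfolding even_fun_iff by (rule ImD) (use imT_4_even in \<open>simp only: even_fun_iff\<close>)
  moreover have "even_fun (\<lambda>y. psiL chi L (4 + 1) (\<lambda>x. (Q x)\<^sup>2) j \<alpha> lam y * Q y)"
    by (rule psiL_Q_even[OF adm]) simp_all
  ultimately have sev: "even_fun (source 4 j \<alpha> \<beta> lam)"
    unfolding s even_fun_def by (simp only: simp_thms)
  have ss: "rot_act W (source 4 j \<alpha> \<beta> lam) = (\<lambda>y. 0)" if W: "scalar_test W" for W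
  proof -
    have "rot_act W (\<lambda>y. psiL chi L (4 + 1) (\<lambda>x. (Q x)\<^sup>2) j \<alpha> lam y * Q y) = (\<lambda>y. 0)"
      by (rule psiL_Q_annihilated[OF adm _ scalar_test_rot[OF W] scalar_test_zonal[OF W]]) simp_all
    moreover have "rot_act W (\<lambda>y. Im (D y)) = (\<lambda>y. 0)"
      by (rule ImD) (rule imT_4_scalar[OF _ W])
    ultimately show ?thesis unfolding s rot_act_add by (simp only: add_0)
  qed
  have I_scalar: "rot_act W (\<lambda>y. Im (Eh 4 j \<alpha> \<beta> lam y)) = (\<lambda>y. 0)" if W: "scalar_test W" for W
    unfolding E by (rule ReD) (rule scalar_test_odd[OF W reT_4_odd])
  have I_vector: "rot_act W (\<lambda>y. Im (Eh 4 j \<alpha> \<beta> lam y)) = (\<lambda>y. 0)" if W: "vector_test e W" for W e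
    unfolding E by (rule ReD) (rule reT_4_vector[OF _ W])
  have b: "b (Suc 4) j \<alpha> \<beta> lam = 0" by (rule b_eq_0[OF adm]) (rule vector_test_even[OF _ sev])
  have m: "\<mu> (Suc 4) j \<alpha> \<beta> lam = 0" by (rule mu_eq_0[OF adm I_scalar])
  have 1: "rot_act W (reT (Suc 4) j \<alpha> \<beta> lam) = (\<lambda>y. 0)" if W: "scalar_test W"
    by (rule reT_annihilated[OF adm _ scalar_test_rot[OF W] ss[OF W]])
      (simp only: b inner_zero_left mult_zero_right mult_zero_left add_0_left)
  have 2: "rot_act W (imT (Suc 4) j \<alpha> \<beta> lam) = (\<lambda>y. 0)" if W: "vector_test e W"
    by (rule imT_annihilated[OF adm m vector_test_rot[OF W] I_vector[OF W]])
  have S4: "Suc 4 = 5" by simp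
  show "b 5 j \<alpha> \<beta> lam = 0" "\<mu> 5 j \<alpha> \<beta> lam = 0" using b m unfolding S4 .
  show "scalar_test W \<Longrightarrow> rot_act W (reT 5 j \<alpha> \<beta> lam) = (\<lambda>y. 0)" using 1 unfolding S4 .
  show "vector_test e W \<Longrightarrow> rot_act W (imT 5 j \<alpha> \<beta> lam) = (\<lambda>y. 0)" using 2 unfolding S4 .
qed

lemma integral_Q_reT_5:
  assumes "admissible \<alpha> lam"
  shows "(LINT x|lborel. Q x * reT 5 j \<alpha> \<beta> lam x) = 0"
proof -
  have "Suc 4 = 5" by simp
  then show ?thesis
    using integral_Q_reT[OF assms, of 4 j \<beta>] reT_5_scalar[OF assms] by simp
qed

lemma one_to_five: "n \<in> {1..5} \<longleftrightarrow> n = 1 \<or> n = 2 \<or> n = 3 \<or> n = 4 \<or> n = (5::nat)"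
  by auto

text \<open>Terms quadratic in T^(3) appear for the first time, with \<psi>^(3) of Q^2 times T^(3)
  and the \<beta>-derivative of T^(4). The mass term and the b^(2)-term cancel as before.\<close>

lemma Ehat_5:
  assumes adm: "admissible \<alpha> lam"
  shows "Eh 5 j \<alpha> \<beta> lam y =
    - (1 / (lam $ j)\<^sup>2) *\<^sub>R (phi (\<lambda>x. (reT 3 j \<alpha> \<beta> lam x)\<^sup>2) y *\<^sub>R of_real (Q y)
        + 2 *\<^sub>R (phi (\<lambda>x. Q x * reT 3 j \<alpha> \<beta> lam x) y *\<^sub>R T 3 j \<alpha> \<beta> lam y))
    - (2 *\<^sub>R (psiL chi L 3 (\<lambda>x. Q x * reT 3 (j + 1) \<alpha> \<beta> lam x) j \<alpha> lam y *\<^sub>R of_real (Q y))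
        + psiL chi L 3 (\<lambda>x. (Q x)\<^sup>2) j \<alpha> lam y *\<^sub>R T 3 j \<alpha> \<beta> lam y
        + 2 *\<^sub>R (psiL chi L 2 (\<lambda>x. Q x * reT 4 (j + 1) \<alpha> \<beta> lam x) j \<alpha> lam y *\<^sub>R of_real (Q y)))
    + \<i> * dird (2 *\<^sub>R \<beta>) (\<lambda>a. T 5 j a \<beta> lam y) \<alpha>
    + \<i> * dird (b 2 2 \<alpha> \<beta> lam - b 2 1 \<alpha> \<beta> lam) (\<lambda>v. T 4 j \<alpha> v lam y) \<beta>"
proof -
  have bn: "b n j \<alpha> \<beta> lam = 0" if "n \<in> {1..5}" "n \<noteq> 2" for n j
    using that b_1[OF adm] b_3[OF adm] b_4[OF adm] b_5[OF adm] unfolding one_to_five by blast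
  have mn: "\<mu> n j \<alpha> \<beta> lam = 0" if "n \<in> {1..5}" for n j
    using that mu_1[OF adm] mu_2[OF adm] mu_3[OF adm] mu_4[OF adm] mu_5[OF adm] unfolding one_to_five by blast
  have ar: "5 + 1 - 3 = (3::nat)" "5 + 1 - 4 = (2::nat)" "5 + 1 - 5 = Suc 0" "5 - 1 = (4::nat)" "2 \<le> (5::nat)"
    "{3..5} = {3, 4, 5::nat}" "3 \<notin> {4, 5::nat}" "4 \<notin> {5::nat}" by auto
  have p1: "psiL chi L (Suc 0) (\<lambda>x. Q x * reT 5 (j + 1) \<alpha> \<beta> lam x) j \<alpha> lam y = 0"
    by (rule psiL_1_zero[OF adm integral_Q_reT_5[OF adm]])
  have sq: "(\<lambda>x. Re (T 3 j \<alpha> \<beta> lam x * cnj (T 3 j \<alpha> \<beta> lam x))) = (\<lambda>x. (reT 3 j \<alpha> \<beta> lam x)\<^sup>2)"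
    by (simp add: fun_eq_iff imT_3[OF adm] power2_eq_square)
  show ?thesis
    by (subst Ehat_low_order[OF adm], simp, erule (1) bn, erule mn, erule T_12[OF adm])
      (simp only: ar if_True simp_thms Re_T_T0(1)[OF adm] sq Re_T_T0(2,3)[OF adm, where i = 3] Re_T_T0(2,3)[OF adm, where i = 4]
        Re_T_T0(2,3)[OF adm, where i = 5] sum.insert sum.empty finite.emptyI finite.insertI empty_iff not_False_eq_True p1
        psi_Q_1'[OF adm] psi_Q_2[OF adm, of j y \<beta>], simp only: T_0[OF adm], simp add: algebra_simps scaleR_conv_of_real)
qed

subsection \<open>Order 6\<close>

text \<open>For products of profiles only parity is known, and parity suffices: all of
  \<open>G\<close> is even, hence invisible to the gradient of Q. The other real sources, \<psi>^(6)
  of degree 5 and the \<alpha>-derivative of Im T^(5), are annihilated by vector tests.\<close>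

lemma
  assumes adm: "admissible \<alpha> lam"
  shows b_6: "b 6 j \<alpha> \<beta> lam = 0" and mu_6: "\<mu> 6 j \<alpha> \<beta> lam = 0"
proof -
  define D where "D = (\<lambda>y. dird (2 *\<^sub>R \<beta>) (\<lambda>a. T 5 j a \<beta> lam y) \<alpha>)"
  define B where "B = (\<lambda>y. dird (b 2 2 \<alpha> \<beta> lam - b 2 1 \<alpha> \<beta> lam) (\<lambda>v. T 4 j \<alpha> v lam y) \<beta>)"
  define G where "G = (\<lambda>y. (1 / (lam $ j)\<^sup>2) * (phi (\<lambda>x. (reT 3 j \<alpha> \<beta> lam x)\<^sup>2) y * Q y
        + 2 * (phi (\<lambda>x. Q x * reT 3 j \<alpha> \<beta> lam x) y * reT 3 j \<alpha> \<beta> lam y))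
      + (2 * (psiL chi L 3 (\<lambda>x. Q x * reT 3 (j + 1) \<alpha> \<beta> lam x) j \<alpha> lam y * Q y)
        + (psiL chi L 3 (\<lambda>x. (Q x)\<^sup>2) j \<alpha> lam y * reT 3 j \<alpha> \<beta> lam y)
        + 2 * (psiL chi L 2 (\<lambda>x. Q x * reT 4 (j + 1) \<alpha> \<beta> lam x) j \<alpha> lam y * Q y))
      + Im (B y))"
  \<comment> \<open>T^(4) depends on \<beta> at most through its imaginary part, so i B is real and
    the imaginary source, which decides \<open>\<mu>\<close>, is only the \<alpha>-derivative of Re
    T^(5).\<close>
  have ReB: "Re (B y) = 0" for y
  proof -
    have "(\<lambda>v. reT 4 j \<alpha> v lam y) = (\<lambda>v. reT 4 j \<alpha> \<beta> lam y)"
      using reT_4_indep[OF adm, of j _ \<beta>] by metis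
    then have "dird w (\<lambda>v. reT 4 j \<alpha> v lam y) \<beta> = 0" for w by (simp only: dird_const)
    then show ?thesis
      unfolding B_def by (simp add: dird_bounded_linear[OF bounded_linear_Re T_diff(2)[OF adm], symmetric])
  qed
  have E: "Re (Eh 5 j \<alpha> \<beta> lam y) = - G y - Im (D y)" "Im (Eh 5 j \<alpha> \<beta> lam y) = Re (D y)" for y
  proof -
    have "dird (2 *\<^sub>R \<beta>) (\<lambda>a. T 5 j a \<beta> lam y) \<alpha> = D y"
      "dird (b 2 2 \<alpha> \<beta> lam - b 2 1 \<alpha> \<beta> lam) (\<lambda>v. T 4 j \<alpha> v lam y) \<beta> = B y"
      by (simp_all only: D_def B_def)
    then show "Re (Eh 5 j \<alpha> \<beta> lam y) = - G y - Im (D y)" "Im (Eh 5 j \<alpha> \<beta> lam y) = Re (D y)"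
      using ReB[of y] imT_3[OF adm, of j \<beta> y] by (simp_all add: Ehat_5[OF adm] G_def algebra_simps)
  qed
  have I: "rot_act W (\<lambda>y. Im (Eh 5 j \<alpha> \<beta> lam y)) = (\<lambda>y. 0)" if W: "scalar_test W" for W
    unfolding E D_def
    by (rule alpha_derivative_annihilated[OF adm bounded_linear_Re]) (rule reT_5_scalar[OF _ W])
  have m: "\<mu> (Suc 5) j \<alpha> \<beta> lam = 0" by (rule mu_eq_0[OF adm I])
  have "even_fun (\<lambda>y. Im (B y))"
    unfolding even_fun_iff B_def
    by (rule beta_derivative_annihilated[OF adm bounded_linear_Im])
      (use imT_4_even[OF adm] in \<open>simp only: even_fun_iff\<close>)
  then have G_even: "even_fun G"
  proof -
    assume Bev: "even_fun (\<lambda>y. Im (B y))"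
    have r3: "reT 3 j \<alpha> \<beta> lam (- x) = reT 3 j \<alpha> \<beta> lam x" for j x
      using reT_3_even[OF adm] by (simp add: even_fun_def)
    have r4: "reT 4 j \<alpha> \<beta> lam (- x) = - reT 4 j \<alpha> \<beta> lam x" for j x
      using reT_4_odd[OF adm] by (simp add: odd_fun_def)
    have S: "Suc 2 = 3" "Suc 1 = 2" by simp_all
    have p3: "psiL chi L 3 f j \<alpha> lam (- y) = psiL chi L 3 f j \<alpha> lam y" if "\<And>x. f (- x) = f x" for f y
      using psiL_even[OF adm, of 2 f j y] that unfolding S by simp
    \<comment> \<open>Degree 1 is odd, but so is the density Q Re T^(4); the field is therefore
      even.\<close>
    have p2: "psiL chi L 2 f j \<alpha> lam (- y) = psiL chi L 2 f j \<alpha> lam y" if "\<And>x. f (- x) = - f x" for f y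
      using psiL_even[OF adm, of 1 f j y] that unfolding S by simp
    show ?thesis
      unfolding even_fun_def G_def
      using Bev unfolding even_fun_def
      by (simp add: r3 r4 Q_minus phi_even p3 p2)
  qed
  have "rot_act W (source 5 j \<alpha> \<beta> lam) = (\<lambda>y. 0)" if W: "vector_test e W" for e W
  proof -
    have s: "source 5 j \<alpha> \<beta> lam = (\<lambda>y. psiL chi L (5 + 1) (\<lambda>x. (Q x)\<^sup>2) j \<alpha> lam y * Q y + (G y + Im (D y)))"
      by (rule ext) (simp add: source_def E)
    have "rot_act W (\<lambda>y. psiL chi L (5 + 1) (\<lambda>x. (Q x)\<^sup>2) j \<alpha> lam y * Q y) = (\<lambda>y. 0)"
      by (rule psiL_Q_annihilated[OF adm _ vector_test_rot[OF W] vector_test_zonal[OF W]]) simp_all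
    moreover have "rot_act W G = (\<lambda>y. 0)" by (rule vector_test_even[OF W G_even])
    moreover have "rot_act W (\<lambda>y. Im (D y)) = (\<lambda>y. 0)"
      unfolding D_def by (rule alpha_derivative_annihilated[OF adm bounded_linear_Im]) (rule imT_5_vector[OF _ W])
    ultimately show ?thesis unfolding s rot_act_add by (simp only: add_0)
  qed
  then have b: "b (Suc 5) j \<alpha> \<beta> lam = 0" by (rule b_eq_0[OF adm])
  have S5: "Suc 5 = 6" by simp
  show "b 6 j \<alpha> \<beta> lam = 0" "\<mu> 6 j \<alpha> \<beta> lam = 0" using b m unfolding S5 .
qed

end

theorem proposition3p4:
  fixes Q chi :: "real ^ 3 \<Rightarrow> real" and L :: real
    and b :: "(real ^ 3) family" and m :: "real family"
    and T :: "(real ^ 3 \<Rightarrow> complex) family"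
  assumes "ground_state Q"
    and "kernel_L2 (Lplus Q) = {\<lambda>x. \<Sum>i\<in>UNIV. c i * dird (axis i 1) Q x | c :: 3 \<Rightarrow> real. True}"
    and "kernel_L2 (Lminus Q) = {\<lambda>x. c * Q x | c :: real. True}"
    and "cutoff chi"
    and "L > 0"
    and "recursive_construction chi L Q b m T"
  shows "\<forall>j \<alpha> \<beta> lam. admissible \<alpha> lam \<longrightarrow>
           (\<forall>y. T 1 j \<alpha> \<beta> lam y = 0 \<and> T 2 j \<alpha> \<beta> lam y = 0) \<and>
           b 2 j \<alpha> \<beta> lam =
             (sg (j - 1) * (L2norm Q)\<^sup>2 / (4 * pi * lam $ (j + 1))) *\<^sub>R
               ((1 / norm \<alpha> ^ 3) *\<^sub>R \<alpha>) \<and>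
           (\<forall>n\<in>{1..6}. n \<noteq> 2 \<longrightarrow> b n j \<alpha> \<beta> lam = 0) \<and>
           (\<forall>n\<in>{1..6}. m n j \<alpha> \<beta> lam = 0)"
proof -
  interpret profile_construction Q chi L b m T
    using assms by unfold_locales
  have six: "n = 1 \<or> n = 2 \<or> n = 3 \<or> n = 4 \<or> n = 5 \<or> n = 6" if "n \<in> {1..6}" for n :: nat
    using that by auto
  show ?thesis
  proof (intro allI impI conjI ballI)
    fix j \<alpha> \<beta> lam y
    assume adm: "admissible \<alpha> lam"
    show "T 1 j \<alpha> \<beta> lam y = 0" "T 2 j \<alpha> \<beta> lam y = 0" by (rule T_1[OF adm] T_2[OF adm])+
    show "b 2 j \<alpha> \<beta> lam = (sg (j - 1) * (L2norm Q)\<^sup>2 / (4 * pi * lam $ (j + 1))) *\<^sub>R ((1 / norm \<alpha> ^ 3) *\<^sub>R \<alpha>)"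
      unfolding L2norm_Q by (rule b_2[OF adm])
    show "b n j \<alpha> \<beta> lam = 0" if "n \<in> {1..6}" "n \<noteq> 2" for n
      using six[OF that(1)] that(2) b_1[OF adm] b_3[OF adm] b_4[OF adm] b_5[OF adm] b_6[OF adm] by blast
    show "m n j \<alpha> \<beta> lam = 0" if "n \<in> {1..6}" for n
      using six[OF that] mu_1[OF adm] mu_2[OF adm] mu_3[OF adm] mu_4[OF adm] mu_5[OF adm] mu_6[OF adm] by blast
  qed
qed

end
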